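(* Let $G$ be a $3$-connected cubic planar graph with dual graph $G^{\ast}$ (with respect to the planar embedding of $G$). There exists a one-to-one correspondence between inequivalent strong embeddings of $G$ on 1) the projective plane and subgraphs of $G^{\ast}$ that are isomorphic to $K_4$; 2) the torus and subgraphs of $G^{\ast}$ that are isomorphic to $K_{2,2,2}$ or isomorphic to $K_{2,2m}$ for some $m\geq 1$, where for $K_{2,2m}$ the vertices in the partition sets of size two are not adjacent in $G^{\ast}$ (so for $K_{2,2}$ this is required of both partition sets); 3) the Klein bottle and subgraphs of $G^{\ast}$ that are isomorphic to $A_3$, $A_5$, $A_6$ or $K_{2,2m-1}$ for some $m\geq 2$, where for $K_{2,2m-1}$ the vertices in the partition set of size two are not adjacent in $G^{\ast}$.
   Context: All graphs are undirected, connected, simple and finite, except that subgraphs of $G^\ast$ (such as copies of $A_3$) may be disconnected. Subgraphs are not required to be induced. A surface is a compact two-dimensional manifold without boundary. All embeddings of graphs on surfaces are cellular (every component of the complement of the embedded graph is homeomorphic to an open disc). A facial walk is a closed walk traversing the boundary of a cell. An embedding is strong if every facial walk is a cycle. By Whitney's theorem a $3$-connected planar graph $G$ has a unique embedding on the sphere; $G^{\ast}$ is its dual graph with respect to this embedding, and it is simple, planar and $3$-connected. Embedding schemes and equivalence: an embedding of $G$ on a surface is described by an embedding scheme $(\rho,\lambda)$, where $\rho=\{\rho_v\mid v\in V(G)\}$ gives a circular ordering $\rho_v$ of the edges at each vertex $v$, and $\lambda:E(G)\to\{-1,1\}$ is a signature: for $e=\{v,w\}$, $\lambda(e)=1$ if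 $\rho_v(e),e,\rho_w^{-1}(e)$ is a subwalk of a facial walk, and $\lambda(e)=-1$ if $\rho_v(e),e,\rho_w(e)$ is a subwalk of a facial walk. A local change at $v$ replaces $\rho_v$ by $\rho_v^{-1}$ and $\lambda(e)$ by $-\lambda(e)$ for all edges $e$ incident to $v$. Two embedding schemes of $G$ are equivalent if one is obtained from the other by a sequence of local changes; two embeddings are inequivalent if their embedding schemes are not equivalent. $K_n$ is the complete graph on $n$ vertices and $K_{n_1,\dots,n_k}$ the complete $k$-partite graph with partition sets of sizes $n_1,\dots,n_k$. The graph $A_3$ is the disjoint union of two copies of $K_4$. The graph $A_5$ consists of two copies of $K_4$ sharing exactly one vertex. The graph $A_6$ has vertices $a,b,c,d,e,f$ and edges $ab,ac,ad,bc,bd,ce,cf,de,df,ef$ (two copies of $K_4$ minus an edge, glued along the two non-adjacent vertices $c,d$). *)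

theory Defs
  imports Main "HOL-Library.FuncSet" "HOL-Combinatorics.Orbits"
begin

section \<open>Graphs\<close>

record 'a graph =
  verts :: "'a set"
  edges :: "'a set set"

definition simple_graph :: "'a graph \<Rightarrow> bool" where
  "simple_graph G \<longleftrightarrow> finite (verts G) \<and> (\<forall>e\<in>edges G. e \<subseteq> verts G \<and> card e = 2)"

definition incident :: "'a graph \<Rightarrow> 'a \<Rightarrow> 'a set set" where
  "incident G v = {e \<in> edges G. v \<in> e}"

definition cubic :: "'a graph \<Rightarrow> bool" where
  "cubic G \<longleftrightarrow> (\<forall>v\<in>verts G. card (incident G v) = 3)"

definition delete_verts :: "'a graph \<Rightarrow> 'a set \<Rightarrow> 'a graph" where
  "delete_verts G X = \<lparr>verts = verts G - X, edges = {e \<in> edges G. e \<inter> X = {}}\<rparr>"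

definition connected_graph :: "'a graph \<Rightarrow> bool" where
  "connected_graph G \<longleftrightarrow> verts G \<noteq> {} \<and>
     (\<forall>u\<in>verts G. \<forall>v\<in>verts G. (\<lambda>x y. {x, y} \<in> edges G)\<^sup>*\<^sup>* u v)"

definition k_connected :: "nat \<Rightarrow> 'a graph \<Rightarrow> bool" where
  "k_connected k G \<longleftrightarrow> k < card (verts G) \<and>
     (\<forall>X\<subseteq>verts G. card X < k \<longrightarrow> connected_graph (delete_verts G X))"

definition is_cycle :: "'a graph \<Rightarrow> 'a list \<Rightarrow> bool" where
  "is_cycle G p \<longleftrightarrow> 3 \<le> length p \<and> distinct p \<and>
     (\<forall>i<length p. {p ! i, p ! (Suc i mod length p)} \<in> edges G)"

definition subgraph :: "'a graph \<Rightarrow> 'a graph \<Rightarrow> bool" where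
  "subgraph H G \<longleftrightarrow> simple_graph H \<and> verts H \<subseteq> verts G \<and> edges H \<subseteq> edges G"

definition graph_iso :: "('a \<Rightarrow> 'b) \<Rightarrow> 'a graph \<Rightarrow> 'b graph \<Rightarrow> bool" where
  "graph_iso \<phi> G H \<longleftrightarrow> bij_betw \<phi> (verts G) (verts H) \<and> edges H = (\<lambda>e. \<phi> ` e) ` edges G"

definition isomorphic :: "'a graph \<Rightarrow> 'b graph \<Rightarrow> bool" where
  "isomorphic G H \<longleftrightarrow> (\<exists>\<phi>. graph_iso \<phi> G H)"

definition complete_graph :: "nat \<Rightarrow> nat graph" where
  "complete_graph n = \<lparr>verts = {..<n}, edges = {{x, y} | x y. x < n \<and> y < n \<and> x \<noteq> y}\<rparr>"

text \<open>The vertex \<open>(i, j)\<close> is the \<open>j\<close>-th vertex of the \<open>i\<close>-th partition set.\<close>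

definition complete_multipartite :: "nat list \<Rightarrow> (nat \<times> nat) graph" where
  "complete_multipartite ns =
     (let V = {(i, j). i < length ns \<and> j < ns ! i}
      in \<lparr>verts = V, edges = {{x, y} | x y. x \<in> V \<and> y \<in> V \<and> fst x \<noteq> fst y}\<rparr>)"

definition graph_A3 :: "nat graph" where
  "graph_A3 = \<lparr>verts = {0, 1, 2, 3, 4, 5, 6, 7},
     edges = {{0, 1}, {0, 2}, {0, 3}, {1, 2}, {1, 3}, {2, 3},
              {4, 5}, {4, 6}, {4, 7}, {5, 6}, {5, 7}, {6, 7}}\<rparr>"

definition graph_A5 :: "nat graph" where
  "graph_A5 = \<lparr>verts = {0, 1, 2, 3, 4, 5, 6},
     edges = {{0, 1}, {0, 2}, {0, 3}, {1, 2}, {1, 3}, {2, 3},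
              {3, 4}, {3, 5}, {3, 6}, {4, 5}, {4, 6}, {5, 6}}\<rparr>"

text \<open>The vertices \<open>a, b, c, d, e, f\<close> are numbered \<open>0, 1, 2, 3, 4, 5\<close>.\<close>

definition graph_A6 :: "nat graph" where
  "graph_A6 = \<lparr>verts = {0, 1, 2, 3, 4, 5},
     edges = {{0, 1}, {0, 2}, {0, 3}, {1, 2}, {1, 3},
              {2, 4}, {2, 5}, {3, 4}, {3, 5}, {4, 5}}\<rparr>"

text \<open>
  Copies \<open>H\<close> of \<open>K\<^bsub>2,n\<^esub>\<close> in \<open>D\<close> in which the two vertices of a partition set of size two are
  never adjacent in \<open>D\<close>. For \<open>n = 2\<close> the condition concerns both partition sets.
\<close>

definition nonadjacent_K2n :: "'a graph \<Rightarrow> nat \<Rightarrow> 'a graph \<Rightarrow> bool" where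
  "nonadjacent_K2n D n H \<longleftrightarrow>
     (\<exists>\<phi>. graph_iso \<phi> (complete_multipartite [2, n]) H \<and>
        (\<forall>i<2. [2, n] ! i = 2 \<longrightarrow> {\<phi> (i, 0), \<phi> (i, 1)} \<notin> edges D))"


section \<open>Embedding schemes\<close>

text \<open>
  Rotations are the identity off the incident edges and signatures are \<open>undefined\<close> off the edge
  set, so that two schemes of a graph are equal iff they agree on the graph.
\<close>

record 'a scheme =
  rot :: "'a \<Rightarrow> 'a set \<Rightarrow> 'a set"
  sig :: "'a set \<Rightarrow> int"

definition embedding_scheme :: "'a graph \<Rightarrow> 'a scheme \<Rightarrow> bool" where
  "embedding_scheme G S \<longleftrightarrow>
     (\<forall>v. rot S v permutes incident G v) \<and>
     (\<forall>v\<in>verts G. cyclic_on (rot S v) (incident G v)) \<and>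
     sig S \<in> edges G \<rightarrow>\<^sub>E {-1, 1}"

definition local_change :: "'a graph \<Rightarrow> 'a \<Rightarrow> 'a scheme \<Rightarrow> 'a scheme" where
  "local_change G v S =
     \<lparr>rot = (rot S)(v := inv (rot S v)),
      sig = (\<lambda>e. if e \<in> incident G v then - sig S e else sig S e)\<rparr>"

definition equivalent :: "'a graph \<Rightarrow> 'a scheme \<Rightarrow> 'a scheme \<Rightarrow> bool" where
  "equivalent G = (\<lambda>S S'. \<exists>v\<in>verts G. S' = local_change G v S)\<^sup>*\<^sup>*"


section \<open>Facial walks\<close>

text \<open>
  A flag \<open>(v, e, s)\<close> with \<open>v \<in> e\<close> and \<open>s \<in> {-1, 1}\<close> stands for the position in a facial walk that is
  about to traverse \<open>e\<close> from \<open>v\<close>, having reached \<open>v\<close> through \<open>\<rho>\<^sub>v(e)\<close> if \<open>s = 1\<close> and through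
  \<open>\<rho>\<^sub>v\<inverse>(e)\<close> if \<open>s = -1\<close>. Let \<open>w\<close> be the other end of \<open>e\<close>. By the meaning of the signature,
  the walk that came through \<open>\<rho>\<^sub>v(e)\<close> leaves \<open>w\<close> through \<open>\<rho>\<^sub>w\<inverse>(e)\<close> if \<open>\<lambda>(e) = 1\<close> and through
  \<open>\<rho>\<^sub>w(e)\<close> if \<open>\<lambda>(e) = -1\<close>, and symmetrically for \<open>\<rho>\<^sub>v\<inverse>(e)\<close>. In all four cases the new
  sign is \<open>s * \<lambda>(e)\<close>.
\<close>

type_synonym 'a flag = "'a \<times> 'a set \<times> int"

definition flags :: "'a graph \<Rightarrow> 'a flag set" where
  "flags G = {(v, e, s). e \<in> edges G \<and> v \<in> e \<and> s \<in> {-1, 1}}"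

definition other_end :: "'a \<Rightarrow> 'a set \<Rightarrow> 'a" where
  "other_end v e = the_elem (e - {v})"

fun next_flag :: "'a scheme \<Rightarrow> 'a flag \<Rightarrow> 'a flag" where
  "next_flag S (v, e, s) =
     (let w = other_end v e; t = s * sig S e
      in (w, (if t = 1 then inv (rot S w) e else rot S w e), t))"

text \<open>The same traversal of \<open>e\<close> within the facial walk run backwards.\<close>

fun reverse_flag :: "'a scheme \<Rightarrow> 'a flag \<Rightarrow> 'a flag" where
  "reverse_flag S (v, e, s) = (other_end v e, e, - s * sig S e)"

text \<open>The closed walk as its cyclic list of vertices; the graph being simple, these determine it.\<close>

definition facial_walk :: "'a scheme \<Rightarrow> 'a flag \<Rightarrow> 'a list" where
  "facial_walk S x =
     map (\<lambda>i. fst ((next_flag S ^^ i) x)) [0..<card (orbit (next_flag S) x)]"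

definition strong :: "'a graph \<Rightarrow> 'a scheme \<Rightarrow> bool" where
  "strong G S \<longleftrightarrow> (\<forall>x\<in>flags G. is_cycle G (facial_walk S x))"

text \<open>A face is the set of flags of its boundary walk, in both directions.\<close>

definition face :: "'a scheme \<Rightarrow> 'a flag \<Rightarrow> 'a flag set" where
  "face S x = orbit (next_flag S) x \<union> orbit (next_flag S) (reverse_flag S x)"

definition faces :: "'a graph \<Rightarrow> 'a scheme \<Rightarrow> 'a flag set set" where
  "faces G S = face S ` flags G"


section \<open>Surfaces\<close>

text \<open>
  By the classification theorem a connected closed surface is determined up to homeomorphism by
  its orientability and its Euler characteristic. The surface of a scheme is the one obtained by
  glueing a disc along each facial walk.
\<close>

datatype surface = Sphere | Projective_Plane | Torus | Klein_Bottle

fun orientable_surface :: "surface \<Rightarrow> bool" where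
  "orientable_surface Sphere = True"
| "orientable_surface Projective_Plane = False"
| "orientable_surface Torus = True"
| "orientable_surface Klein_Bottle = False"

fun euler_char_surface :: "surface \<Rightarrow> int" where
  "euler_char_surface Sphere = 2"
| "euler_char_surface Projective_Plane = 1"
| "euler_char_surface Torus = 0"
| "euler_char_surface Klein_Bottle = 0"

definition euler_char :: "'a graph \<Rightarrow> 'a scheme \<Rightarrow> int" where
  "euler_char G S = int (card (verts G)) - int (card (edges G)) + int (card (faces G S))"

text \<open>
  The surface is orientable iff the local orientations at the vertices can be chosen so that they
  agree along every edge.
\<close>

definition orientable :: "'a graph \<Rightarrow> 'a scheme \<Rightarrow> bool" where
  "orientable G S \<longleftrightarrow> (\<exists>S'. equivalent G S S' \<and> (\<forall>e\<in>edges G. sig S' e = 1))"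

definition embedding_on :: "'a graph \<Rightarrow> surface \<Rightarrow> 'a scheme \<Rightarrow> bool" where
  "embedding_on G F S \<longleftrightarrow> embedding_scheme G S \<and>
     (orientable G S \<longleftrightarrow> orientable_surface F) \<and> euler_char G S = euler_char_surface F"

definition inequivalent_strong_embeddings :: "'a graph \<Rightarrow> surface \<Rightarrow> 'a scheme set set" where
  "inequivalent_strong_embeddings G F =
     {S. embedding_on G F S \<and> strong G S} // {(S, S'). equivalent G S S'}"


section \<open>The dual graph\<close>

text \<open>
  The two sides of \<open>e\<close> are the faces of the flags \<open>(v, e, 1)\<close> and \<open>(v, e, -1)\<close>, for either end \<open>v\<close>
  of \<open>e\<close>. In general the dual is a multigraph; for a 3-connected planar graph it is simple, so that
  nothing is lost by recording its edges as two-element sets of faces.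
\<close>

definition dual_graph :: "'a graph \<Rightarrow> 'a scheme \<Rightarrow> 'a flag set graph" where
  "dual_graph G S = \<lparr>verts = faces G S,
     edges = {{face S (v, e, 1), face S (v, e, -1)} | v e. e \<in> edges G \<and> v \<in> e}\<rparr>"

end

theory Submission
  imports Defs
begin

text \<open>
  Let \<open>P\<close> be the plane embedding of \<open>G\<close> and \<open>D\<close> its dual. At a vertex of degree three there are only
  two cyclic orders, each the inverse of the other, so local changes turn the rotations of any
  scheme into those of \<open>P\<close>, and they do so in one way only. An equivalence class of embeddings is
  therefore the same thing as the set \<open>T\<close> of the edges whose signature differs from the one in \<open>P\<close>
  (lemmas \<open>exists_flip_twist\<close> and \<open>twist_equivalent_unique\<close>). The subgraph that corresponds to the
  class is the set \<open>H\<close> of the edges of \<open>D\<close> that are dual to \<open>T\<close>.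

  Euler characteristic, orientability and strength of the twisted embedding can be read off from
  linear algebra over the field with two elements. Colour the faces of an embedding with two
  colours and take the edges with differently coloured sides. The sets obtained in this way form a
  space of dimension one less than the number of faces, and the embedding is strong iff this space
  covers all edges. For \<open>P\<close> it is the whole cycle space of \<open>G\<close>, by Euler's formula. For the embedding
  twisted on \<open>T\<close> it consists of those \<open>W\<close> in the cycle space for which \<open>T \<inter> W\<close> is a cut of \<open>G\<close>
  (\<open>boundary_space_twist\<close>): twisting matters only at the edges of \<open>W\<close>, and there it demands that
  the colours be exchanged at one of the two ends. If \<open>W\<close> is the boundary of a set \<open>\<Psi>\<close> of faces of
  \<open>P\<close>, then \<open>T \<inter> W\<close> is a cut iff \<open>\<Psi>\<close> is in the kernel of the Laplacian of \<open>H\<close>. Since this matrix is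
  symmetric, its kernel is the orthogonal complement of its image \<open>U\<close>, and it follows that

    \<^item> the Euler characteristic is \<open>2\<close> minus the rank of the Laplacian (\<open>euler_char_twist\<close>),
    \<^item> the embedding is strong iff no edge of \<open>D\<close>, as a two-element set of faces, lies in \<open>U\<close>
      (\<open>strong_twist\<close>),
    \<^item> it is orientable iff all degrees of \<open>H\<close> are even (\<open>orientable_twist_iff\<close>).

  A symmetric matrix of rank one is \<open>x x\<^sup>T\<close>, so in the projective plane \<open>H\<close> is a complete graph on an
  even number of vertices. A symmetric matrix of rank two is \<open>x y\<^sup>T + y x\<^sup>T\<close> if its diagonal vanishes
  and \<open>x x\<^sup>T + y y\<^sup>T\<close> otherwise. With \<open>x = A \<union> C\<close> and \<open>y = B \<union> C\<close> for disjoint \<open>A, B, C\<close> this makes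
  \<open>H\<close> the complete tripartite graph on \<open>A, B, C\<close> (torus), or two cliques \<open>A\<close> and \<open>B\<close> completely joined
  to an independent set \<open>C\<close> (Klein bottle); see \<open>rank_two\<close>. Here \<open>A, B, C\<close> have sizes of the same
  parity, because the rows of a Laplacian sum to zero, and the nonzero elements of \<open>U\<close> are
  \<open>A \<union> B\<close>, \<open>A \<union> C\<close> and \<open>B \<union> C\<close>, none of which may be an edge of \<open>D\<close>. As \<open>D\<close> is planar, it contains
  neither five mutually adjacent vertices nor a complete bipartite graph with three vertices on
  each side, and the sizes that remain are those of the graphs in the theorem. The conditions on
  non-adjacent vertices are what is left of the condition on \<open>U\<close>.
\<close>

section \<open>Linear algebra over the two-element field\<close>

lemma even_card_sym_diff:
  assumes "finite A" "finite B"
  shows "even (card (sym_diff A B)) \<longleftrightarrow> (even (card A) \<longleftrightarrow> even (card B))"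
proof -
  have "card (sym_diff A B) = card (A - B) + card (B - A)"
    using assms by (intro card_Un_disjoint) auto
  moreover have "card A = card (A - B) + card (A \<inter> B)"
    using assms by (metis card_Diff_subset_Int card_mono finite_Int inf_le1 le_add_diff_inverse2)
  moreover have "card B = card (B - A) + card (A \<inter> B)"
    using assms by (metis Int_commute card_Diff_subset_Int card_mono finite_Int inf_le1 le_add_diff_inverse2)
  ultimately show ?thesis by presburger
qed

lemma sym_diff_Int: "sym_diff A B \<inter> C = sym_diff (A \<inter> C) (B \<inter> C)"
  by auto

lemma even_card_sym_diff_Int:
  assumes "finite A" "finite B"
  shows "even (card (sym_diff A B \<inter> C)) \<longleftrightarrow> (even (card (A \<inter> C)) \<longleftrightarrow> even (card (B \<inter> C)))"
  unfolding sym_diff_Int using assms by (intro even_card_sym_diff) auto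

lemma sym_diff_cancel: "sym_diff (sym_diff A B) B = A"
  by auto

text \<open>
  The subsets of a finite set are the vectors of a space over the field with two elements, with
  symmetric difference as addition and the parity of \<open>card (A \<inter> B)\<close> as inner product. Dimensions are
  expressed by cardinalities, which are powers of two.
\<close>

definition subspace :: "'a set set \<Rightarrow> bool" where
  "subspace U \<longleftrightarrow> {} \<in> U \<and> (\<forall>A\<in>U. \<forall>B\<in>U. sym_diff A B \<in> U)"

lemma subspace_zero: "subspace U \<Longrightarrow> {} \<in> U"
  by (simp add: subspace_def)

lemma subspace_sym_diff: "subspace U \<Longrightarrow> A \<in> U \<Longrightarrow> B \<in> U \<Longrightarrow> sym_diff A B \<in> U"
  by (simp add: subspace_def)

lemma subspace_Pow: "subspace (Pow Y)"
  by (auto simp: subspace_def)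

definition additive_on :: "'a set set \<Rightarrow> ('a set \<Rightarrow> 'b set) \<Rightarrow> bool" where
  "additive_on U h \<longleftrightarrow> (\<forall>A\<in>U. \<forall>B\<in>U. h (sym_diff A B) = sym_diff (h A) (h B))"

lemma additive_onD: "additive_on U h \<Longrightarrow> A \<in> U \<Longrightarrow> B \<in> U \<Longrightarrow> h (sym_diff A B) = sym_diff (h A) (h B)"
  by (simp add: additive_on_def)

lemma additive_on_empty:
  assumes "additive_on U h" "subspace U" shows "h {} = {}"
  using additive_onD[OF assms(1) subspace_zero[OF assms(2)] subspace_zero[OF assms(2)]] by auto

lemma subspace_image:
  assumes "additive_on U h" "subspace U" shows "subspace (h ` U)"
  unfolding subspace_def
proof (intro conjI ballI)
  show "{} \<in> h ` U"
    using additive_on_empty[OF assms] subspace_zero[OF assms(2)] by (metis image_eqI)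
next
  fix A B assume "A \<in> h ` U" "B \<in> h ` U"
  then obtain A' B' where "A = h A'" "B = h B'" "A' \<in> U" "B' \<in> U" by auto
  then have "sym_diff A B = h (sym_diff A' B')"
    using additive_onD[OF assms(1)] by simp
  then show "sym_diff A B \<in> h ` U"
    using subspace_sym_diff[OF assms(2) \<open>A' \<in> U\<close> \<open>B' \<in> U\<close>] by auto
qed

text \<open>
  All fibres of an additive map are translates of its kernel.
\<close>

lemma card_image_times_kernel:
  assumes add: "additive_on U h" and sub: "subspace U" and fin: "finite U"
  shows "card (h ` U) * card {A \<in> U. h A = {}} = card U"
proof -
  let ?K = "{A \<in> U. h A = {}}"
  have fibre: "card {A \<in> U. h A = b} = card ?K" if b: "b \<in> h ` U" for b
  proof -
    obtain A0 where A0: "A0 \<in> U" "b = h A0" using b by auto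
    have "bij_betw (sym_diff A0) ?K {A \<in> U. h A = b}"
    proof (rule bij_betw_byWitness[where f' = "sym_diff A0"])
      show "\<forall>A\<in>?K. sym_diff A0 (sym_diff A0 A) = A" by auto
      show "\<forall>A\<in>{A \<in> U. h A = b}. sym_diff A0 (sym_diff A0 A) = A" by auto
      show "sym_diff A0 ` ?K \<subseteq> {A \<in> U. h A = b}"
      proof
        fix X assume "X \<in> sym_diff A0 ` ?K"
        then obtain A where A: "A \<in> U" "h A = {}" "X = sym_diff A0 A" by auto
        then show "X \<in> {A \<in> U. h A = b}"
          using additive_onD[OF add A0(1) A(1)] subspace_sym_diff[OF sub A0(1) A(1)] A0 by simp
      qed
      show "sym_diff A0 ` {A \<in> U. h A = b} \<subseteq> ?K"
      proof
        fix X assume "X \<in> sym_diff A0 ` {A \<in> U. h A = b}"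
        then obtain A where A: "A \<in> U" "h A = b" "X = sym_diff A0 A" by auto
        then show "X \<in> ?K"
          using additive_onD[OF add A0(1) A(1)] subspace_sym_diff[OF sub A0(1) A(1)] A0 by simp
      qed
    qed
    then show ?thesis by (simp add: bij_betw_same_card)
  qed
  have "card U = card (\<Union>b\<in>h ` U. {A \<in> U. h A = b})"
    by (rule arg_cong[where f = card]) auto
  also have "\<dots> = (\<Sum>b\<in>h ` U. card {A \<in> U. h A = b})"
    using fin by (intro card_UN_disjoint) auto
  also have "\<dots> = card (h ` U) * card ?K"
    using fibre by simp
  finally show ?thesis by simp
qed

definition orth :: "'a set \<Rightarrow> 'a set set \<Rightarrow> 'a set set" where
  "orth Y U = {B. B \<subseteq> Y \<and> (\<forall>A\<in>U. even (card (A \<inter> B)))}"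

lemma subspace_orth:
  assumes "finite Y" shows "subspace (orth Y U)"
  unfolding subspace_def orth_def
proof (intro conjI ballI CollectI)
  fix A B C assume "A \<in> {B. B \<subseteq> Y \<and> (\<forall>A\<in>U. even (card (A \<inter> B)))}"
    "B \<in> {B. B \<subseteq> Y \<and> (\<forall>A\<in>U. even (card (A \<inter> B)))}" "C \<in> U"
  moreover from this have "finite A" "finite B" using assms finite_subset by auto
  moreover have "even (card (A \<inter> C))" "even (card (B \<inter> C))"
    using calculation by (auto simp: Int_commute)
  ultimately show "even (card (C \<inter> sym_diff A B))"
    using even_card_sym_diff_Int[of A B C] by (auto simp: Int_commute)
qed auto

text \<open>
  The sum of \<open>(-1)\<^bsup>|A \<inter> B|\<^esup>\<close> over \<open>A \<in> U\<close> and \<open>B \<subseteq> Y\<close> is evaluated in both orders. For fixed \<open>A\<close> the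
  terms cancel unless \<open>A\<close> is empty, for fixed \<open>B\<close> they cancel unless \<open>B\<close> is orthogonal to \<open>U\<close>.
\<close>

lemma card_orth:
  assumes fin: "finite Y" and sub: "subspace U" and UY: "U \<subseteq> Pow Y"
  shows "card U * card (orth Y U) = 2 ^ card Y"
proof -
  define s where "s A B = (-1 :: int) ^ card (A \<inter> B)" for A B :: "'a set"
  have finsub: "finite A" if "A \<subseteq> Y" for A using that fin finite_subset by blast
  have finU: "finite U" using UY fin by (meson finite_Pow_iff finite_subset)
  have s_add: "s (sym_diff A A') B = s A B * s A' B" if "A \<subseteq> Y" "A' \<subseteq> Y" for A A' B
    unfolding s_def using even_card_sym_diff_Int[of A A' B] that finsub
    by (auto simp: minus_one_power_iff)
  have s_comm: "s A B = s B A" for A B by (simp add: s_def Int_commute)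
  have row: "(\<Sum>B\<in>Pow Y. s A B) = (if A = {} then 2 ^ card Y else 0)" if AY: "A \<subseteq> Y" for A
  proof (cases "A = {}")
    case True then show ?thesis using fin by (simp add: s_def card_Pow)
  next
    case False
    then obtain a where a: "a \<in> A" "a \<in> Y" using AY by auto
    have "(\<Sum>B\<in>Pow Y. s A B) = (\<Sum>B\<in>Pow Y. s A (sym_diff B {a}))"
      by (rule sum.reindex_bij_witness[where i = "\<lambda>B. sym_diff B {a}" and j = "\<lambda>B. sym_diff B {a}"])
        (use a in \<open>auto simp: sym_diff_cancel\<close>)
    also have "\<dots> = (\<Sum>B\<in>Pow Y. s A B * s {a} A)"
      by (rule sum.cong[OF refl]) (use a AY in \<open>simp add: s_comm[of A] s_add\<close>)
    also have "\<dots> = - (\<Sum>B\<in>Pow Y. s A B)"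
      using a by (simp add: s_def sum_negf)
    finally show ?thesis using False by simp
  qed
  have col: "(\<Sum>A\<in>U. s A B) = (if B \<in> orth Y U then int (card U) else 0)" if B: "B \<subseteq> Y" for B
  proof (cases "B \<in> orth Y U")
    case True
    then have "s A B = 1" if "A \<in> U" for A using that by (simp add: s_def orth_def)
    then show ?thesis using True by simp
  next
    case False
    then obtain A0 where A0: "A0 \<in> U" "odd (card (A0 \<inter> B))" using B by (auto simp: orth_def)
    have "(\<Sum>A\<in>U. s A B) = (\<Sum>A\<in>U. s (sym_diff A A0) B)"
      by (rule sum.reindex_bij_witness[where i = "\<lambda>A. sym_diff A A0" and j = "\<lambda>A. sym_diff A A0"])
        (simp_all only: sym_diff_cancel subspace_sym_diff[OF sub _ A0(1)])
    also have "\<dots> = (\<Sum>A\<in>U. s A B * s A0 B)"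
      by (rule sum.cong[OF refl], rule s_add) (use A0 UY in auto)
    also have "\<dots> = - (\<Sum>A\<in>U. s A B)"
      using A0 by (simp add: s_def sum_negf)
    finally show ?thesis using False by simp
  qed
  have "int (card U) * int (card (orth Y U)) = (\<Sum>B\<in>Pow Y. if B \<in> orth Y U then int (card U) else 0)"
    using fin by (subst sum.inter_restrict[symmetric]) (auto simp: orth_def Int_def intro!: arg_cong[where f = card])
  also have "\<dots> = (\<Sum>B\<in>Pow Y. \<Sum>A\<in>U. s A B)"
    by (rule sum.cong) (use col in auto)
  also have "\<dots> = (\<Sum>A\<in>U. \<Sum>B\<in>Pow Y. s A B)" by (rule sum.swap)
  also have "\<dots> = (\<Sum>A\<in>U. if A = {} then 2 ^ card Y else 0)"
    by (rule sum.cong[OF refl], rule row) (use UY in auto)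
  also have "\<dots> = 2 ^ card Y"
    using finU subspace_zero[OF sub] by simp
  finally have "int (card U * card (orth Y U)) = int (2 ^ card Y)" by simp
  then show ?thesis by (simp only: of_nat_eq_iff)
qed

lemma orth_orth:
  assumes fin: "finite Y" and sub: "subspace U" and UY: "U \<subseteq> Pow Y"
  shows "orth Y (orth Y U) = U"
proof -
  have sub': "U \<subseteq> orth Y (orth Y U)"
    using UY by (auto simp: orth_def Int_commute)
  have "orth Y U \<subseteq> Pow Y" by (auto simp: orth_def)
  then have "card U * card (orth Y U) = card (orth Y (orth Y U)) * card (orth Y U)"
    using card_orth[OF assms] card_orth[OF fin subspace_orth[OF fin], of U]
    by (metis mult.commute)
  moreover have "card (orth Y U) \<noteq> 0"
    using card_orth[OF assms] by (metis mult_0_right power_not_zero zero_neq_numeral)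
  ultimately have "card U = card (orth Y (orth Y U))" by simp
  moreover have "finite (orth Y (orth Y U))"
    using fin by (auto simp: orth_def)
  ultimately show ?thesis using sub' card_subset_eq by metis
qed

text \<open>
  The set on the right is the image of \<open>W\<close> under the transpose of \<open>h\<close>.
\<close>

lemma additive_adjoint:
  assumes add: "additive_on (Pow A) h" and fin: "finite A" and finh: "\<And>X. X \<subseteq> A \<Longrightarrow> finite (h X)"
    and X: "X \<subseteq> A"
  shows "even (card (h X \<inter> W)) \<longleftrightarrow> even (card ({a \<in> A. odd (card (h {a} \<inter> W))} \<inter> X))"
proof -
  have "finite X" using X fin finite_subset by blast
  then show ?thesis using X
  proof (induction X)
    case empty
    then show ?case using additive_on_empty[OF add subspace_Pow] by simp
  next
    case (insert a X)
    have "insert a X = sym_diff {a} X" using insert by auto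
    then have "h (insert a X) = sym_diff (h {a}) (h X)"
      using additive_onD[OF add, of "{a}" X] insert by simp
    then have "even (card (h (insert a X) \<inter> W)) \<longleftrightarrow>
        (even (card (h {a} \<inter> W)) \<longleftrightarrow> even (card (h X \<inter> W)))"
      using even_card_sym_diff_Int[of "h {a}" "h X" W] finh insert by auto
    then show ?case
      using insert by (simp add: Int_insert_right)
  qed
qed

lemma orth_image_iff:
  assumes "additive_on (Pow A) h" "finite A" "finite Y" "\<And>X. X \<subseteq> A \<Longrightarrow> h X \<subseteq> Y"
  shows "W \<in> orth Y (h ` Pow A) \<longleftrightarrow> W \<subseteq> Y \<and> (\<forall>a\<in>A. even (card (h {a} \<inter> W)))"
proof -
  have finh: "finite (h X)" if "X \<subseteq> A" for X using assms(3,4) that finite_subset by metis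
  have "even (card (h X \<inter> W))" if even: "\<forall>a\<in>A. even (card (h {a} \<inter> W))" and X: "X \<subseteq> A" for X
  proof -
    have none: "{a \<in> A. odd (card (h {a} \<inter> W))} = {}" using even by auto
    show ?thesis using additive_adjoint[OF assms(1,2) finh X, of W] unfolding none by simp
  qed
  then show ?thesis unfolding orth_def by auto
qed

section \<open>Edge cuts of a 3-connected cubic graph\<close>

definition edge_cut :: "'a graph \<Rightarrow> 'a set \<Rightarrow> 'a set set" where
  "edge_cut G X = {e \<in> edges G. odd (card (e \<inter> X))}"

definition cut_space :: "'a graph \<Rightarrow> 'a set set set" where
  "cut_space G = edge_cut G ` Pow (verts G)"

text \<open>
  Orthogonality to all cuts amounts to even degree at every vertex (\<open>cycle_space_iff\<close> below).
\<close>

definition cycle_space :: "'a graph \<Rightarrow> 'a set set set" where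
  "cycle_space G = orth (edges G) (cut_space G)"

lemma edge_cut_subset: "edge_cut G X \<subseteq> edges G"
  by (auto simp: edge_cut_def)

lemma connected_graph_edge_leaving:
  assumes con: "connected_graph K" and A: "A \<subseteq> verts K" "A \<noteq> {}" "A \<noteq> verts K"
  shows "\<exists>x y. {x, y} \<in> edges K \<and> x \<in> A \<and> y \<notin> A"
proof (rule ccontr)
  assume no: "\<not> ?thesis"
  have closed: "y \<in> A" if xy: "{x, y} \<in> edges K" "x \<in> A" for x y
    using no xy by blast
  obtain a b where a: "a \<in> A" and b: "b \<in> verts K" "b \<notin> A" using A by auto
  have "(\<lambda>x y. {x, y} \<in> edges K)\<^sup>*\<^sup>* a b"
    using con a b A unfolding connected_graph_def by blast
  then have "b \<in> A"
    by (induction rule: rtranclp_induct) (use a closed in auto)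
  with b show False by simp
qed

locale cubic_3connected =
  fixes G :: "'a graph"
  assumes simple: "simple_graph G" and conn3: "k_connected 3 G" and cubic: "cubic G"
begin

lemma finite_verts: "finite (verts G)"
  using simple by (simp add: simple_graph_def)

lemma edge_subset: "e \<in> edges G \<Longrightarrow> e \<subseteq> verts G"
  using simple by (auto simp: simple_graph_def)

lemma finite_edges: "finite (edges G)"
  using finite_subset[of "edges G" "Pow (verts G)"] edge_subset finite_verts by auto

lemma card_edge: "e \<in> edges G \<Longrightarrow> card e = 2"
  using simple by (auto simp: simple_graph_def)

lemma edgeE:
  assumes "e \<in> edges G" "v \<in> e"
  obtains w where "e = {v, w}" "v \<noteq> w" "v \<in> verts G" "w \<in> verts G"
proof -
  obtain x y where "e = {x, y}" "x \<noteq> y" using card_edge[OF assms(1)] by (auto simp: card_2_iff)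
  then show thesis using that assms edge_subset[OF assms(1)] by (cases "x = v") auto
qed

lemma finite_edge: "e \<in> edges G \<Longrightarrow> finite e"
  using edge_subset finite_verts finite_subset by blast

lemma doubleton_edge_in_edge_cut:
  assumes "{v, w} \<in> edges G" "v \<noteq> w"
  shows "{v, w} \<in> edge_cut G X \<longleftrightarrow> (v \<in> X) \<noteq> (w \<in> X)"
  using assms by (cases "v \<in> X"; cases "w \<in> X") (auto simp: edge_cut_def)

lemma connected: "connected_graph G"
proof -
  have "connected_graph (delete_verts G {})"
    using conn3 unfolding k_connected_def by auto
  then show ?thesis by (simp add: delete_verts_def connected_graph_def)
qed

lemma additive_edge_cut: "additive_on (Pow (verts G)) (edge_cut G)"
  unfolding additive_on_def
proof (intro ballI)
  fix A B assume AB: "A \<in> Pow (verts G)" "B \<in> Pow (verts G)"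
  then have fin: "finite A" "finite B" using finite_verts finite_subset by auto
  show "edge_cut G (sym_diff A B) = sym_diff (edge_cut G A) (edge_cut G B)"
    using even_card_sym_diff_Int[OF fin] by (auto simp: edge_cut_def Int_commute)
qed

lemma edge_cut_eq_empty_iff:
  assumes "X \<subseteq> verts G" shows "edge_cut G X = {} \<longleftrightarrow> X = {} \<or> X = verts G"
proof
  assume e: "edge_cut G X = {}"
  show "X = {} \<or> X = verts G"
  proof (rule ccontr)
    assume "\<not> ?thesis"
    then obtain x y where xy: "{x, y} \<in> edges G" "x \<in> X" "y \<notin> X"
      using connected_graph_edge_leaving[OF connected assms] by blast
    then have "{x, y} \<in> edge_cut G X" by (subst doubleton_edge_in_edge_cut) auto
    with e show False by auto
  qed
next
  assume "X = {} \<or> X = verts G"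
  moreover have "e \<inter> verts G = e" "even (card e)" if "e \<in> edges G" for e
    using edge_subset[OF that] card_edge[OF that] by auto
  ultimately show "edge_cut G X = {}" by (auto simp: edge_cut_def)
qed

lemma verts_nonempty: "verts G \<noteq> {}"
  using connected by (simp add: connected_graph_def)

lemma subspace_cut_space: "subspace (cut_space G)"
  unfolding cut_space_def by (rule subspace_image[OF additive_edge_cut subspace_Pow])

lemma cut_space_subset: "cut_space G \<subseteq> Pow (edges G)"
  by (auto simp: cut_space_def edge_cut_def)

lemma card_cut_space: "card (cut_space G) * 2 = 2 ^ card (verts G)"
proof -
  have "{X \<in> Pow (verts G). edge_cut G X = {}} = {{}, verts G}"
    using edge_cut_eq_empty_iff by auto
  then show ?thesis
    using card_image_times_kernel[OF additive_edge_cut subspace_Pow] finite_verts verts_nonempty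
    by (simp add: cut_space_def card_Pow)
qed

lemma card_cycle_space: "card (cut_space G) * card (cycle_space G) = 2 ^ card (edges G)"
  unfolding cycle_space_def
  by (rule card_orth[OF finite_edges subspace_cut_space cut_space_subset])

lemma orth_cycle_space: "orth (edges G) (cycle_space G) = cut_space G"
  unfolding cycle_space_def
  by (rule orth_orth[OF finite_edges subspace_cut_space cut_space_subset])

lemma edge_cut_singleton: "edge_cut G {v} = incident G v"
proof -
  have "odd (card (e \<inter> {v})) \<longleftrightarrow> v \<in> e" for e :: "'a set" by (cases "v \<in> e") auto
  then show ?thesis by (auto simp: edge_cut_def incident_def)
qed

lemma cycle_space_iff:
  "W \<in> cycle_space G \<longleftrightarrow> W \<subseteq> edges G \<and> (\<forall>v\<in>verts G. even (card (incident G v \<inter> W)))"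
  unfolding cycle_space_def cut_space_def
  using orth_image_iff[OF additive_edge_cut finite_verts finite_edges edge_cut_subset] by (simp add: edge_cut_singleton)

lemma card_incident: "v \<in> verts G \<Longrightarrow> card (incident G v) = 3"
  using cubic by (simp add: cubic_def)

text \<open>
  If at most two edges left \<open>X\<close>, their ends in \<open>X\<close> would be at most two vertices separating the rest
  of \<open>X\<close> from the complement. So these ends exhaust \<open>X\<close>; but one or two vertices of degree three
  send out at least three edges.
\<close>

lemma card_edge_cut_ge_3:
  assumes X: "X \<subseteq> verts G" "X \<noteq> {}" "X \<noteq> verts G"
  shows "3 \<le> card (edge_cut G X)"
proof (rule ccontr)
  assume "\<not> ?thesis"
  then have small: "card (edge_cut G X) \<le> 2" by simp
  have fincut: "finite (edge_cut G X)" using finite_edges finite_subset[OF edge_cut_subset] by blast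
  define N where "N = {x \<in> X. \<exists>e\<in>edge_cut G X. x \<in> e}"
  have "N \<subseteq> (\<lambda>e. the_elem (e \<inter> X)) ` edge_cut G X"
  proof
    fix x assume "x \<in> N"
    then obtain e where e: "x \<in> X" "e \<in> edge_cut G X" "x \<in> e" by (auto simp: N_def)
    then have "e \<in> edges G" by (simp add: edge_cut_def)
    then obtain w where w: "e = {x, w}" "x \<noteq> w" using edgeE e(3) by blast
    then have "w \<notin> X" using doubleton_edge_in_edge_cut[of x w X] e \<open>e \<in> edges G\<close> by auto
    then have "e \<inter> X = {x}" using w e by auto
    then show "x \<in> (\<lambda>e. the_elem (e \<inter> X)) ` edge_cut G X" using e by (metis image_eqI the_elem_eq)
  qed
  then have cardN: "card N \<le> 2"
    using small fincut by (meson card_image_le card_mono finite_imageI le_trans)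
  show False
  proof (cases "N = X")
    case False
    let ?K = "delete_verts G N"
    have "connected_graph ?K"
      using conn3 cardN subset_trans[OF _ X(1), of N] unfolding k_connected_def
      by (auto simp: N_def)
    moreover have "X - N \<subseteq> verts ?K" "X - N \<noteq> {}" "X - N \<noteq> verts ?K"
      using X False by (auto simp: delete_verts_def N_def)
    ultimately obtain x y where xy: "{x, y} \<in> edges ?K" "x \<in> X - N" "y \<notin> X - N"
      using connected_graph_edge_leaving by blast
    then have "{x, y} \<in> edges G" "y \<notin> N" by (auto simp: delete_verts_def)
    moreover from this have "y \<notin> X" "x \<noteq> y" using xy by auto
    ultimately have "{x, y} \<in> edge_cut G X" using xy by (subst doubleton_edge_in_edge_cut) auto
    then show False using xy by (auto simp: N_def)
  next
    case True
    have "finite X" using X finite_verts finite_subset by blast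
    then have "card X = 1 \<or> card X = 2" using True cardN X
      by (metis One_nat_def card_0_eq le_SucE le_zero_eq numeral_2_eq_2)
    then show False
    proof
      assume "card X = 1"
      then obtain a where "X = {a}" by (auto simp: card_1_singleton_iff)
      then show False using small card_incident[of a] X by (simp add: edge_cut_singleton)
    next
      assume "card X = 2"
      then obtain a b where ab: "X = {a, b}" "a \<noteq> b" by (auto simp: card_2_iff)
      let ?A = "incident G a - {X}" and ?B = "incident G b - {X}"
      have sub: "?A \<union> ?B \<subseteq> edge_cut G X"
      proof
        fix e assume "e \<in> ?A \<union> ?B"
        then have "e \<in> edges G" "e \<noteq> X" "a \<in> e \<or> b \<in> e" by (auto simp: incident_def)
        then show "e \<in> edge_cut G X"
        proof (elim disjE)
          assume "a \<in> e"
          then obtain w where "e = {a, w}" "a \<noteq> w" using edgeE \<open>e \<in> edges G\<close> by blast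
          then show ?thesis using doubleton_edge_in_edge_cut[of a w X] ab \<open>e \<noteq> X\<close> \<open>e \<in> edges G\<close> by auto
        next
          assume "b \<in> e"
          then obtain w where "e = {b, w}" "b \<noteq> w" using edgeE \<open>e \<in> edges G\<close> by blast
          then show ?thesis using doubleton_edge_in_edge_cut[of b w X] ab \<open>e \<noteq> X\<close> \<open>e \<in> edges G\<close> by auto
        qed
      qed
      have disj: "?A \<inter> ?B = {}"
      proof (rule ccontr)
        assume "?A \<inter> ?B \<noteq> {}"
        then obtain e where e: "e \<in> edges G" "a \<in> e" "b \<in> e" "e \<noteq> X" by (auto simp: incident_def)
        then obtain w where "e = {a, w}" using edgeE by blast
        then show False using e ab by auto
      qed
      have fin: "finite (incident G v)" for v using finite_edges by (simp add: incident_def)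
      have "2 \<le> card ?A" "2 \<le> card ?B"
        using card_incident[of a] card_incident[of b] X ab fin by (auto simp: card_Diff_singleton_if)
      then have "4 \<le> card (?A \<union> ?B)" using disj fin by (subst card_Un_disjoint) auto
      also have "\<dots> \<le> card (edge_cut G X)" by (rule card_mono[OF fincut sub])
      finally show False using small by simp
    qed
  qed
qed

end

section \<open>Flags, corners and faces\<close>

lemma cyclic_permutation_3:
  assumes p: "f permutes A" and cyc: "cyclic_on f A" and card: "card A = 3" and a: "a \<in> A"
  shows "A = {a, f a, f (f a)}" "f (f (f a)) = a" "a \<noteq> f a" "a \<noteq> f (f a)" "f a \<noteq> f (f a)"
    "inv f a = f (f a)"
proof -
  have orb: "orbit f a = A" using orbit_cyclic_eq3[OF cyc a] .
  have inj: "f x = f y \<longleftrightarrow> x = y" for x y using permutes_inj[OF p] by (auto dest: injD)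
  have mem: "f x \<in> A \<longleftrightarrow> x \<in> A" for x using permutes_in_image[OF p] .
  show 1: "a \<noteq> f a"
  proof
    assume "a = f a"
    then have "orbit f a = {a}" using orbit_eq_singleton_iff by metis
    then show False using orb card by simp
  qed
  show 2: "f a \<noteq> f (f a)" using 1 inj by simp
  show 3: "a \<noteq> f (f a)"
  proof
    assume ffa: "a = f (f a)"
    have "x \<in> {a, f a}" if "x \<in> orbit f a" for x
      using that
    proof induction
      case (step y)
      then show ?case using ffa[symmetric] by auto
    qed simp
    then have "A \<subseteq> {a, f a}" using orb by blast
    then have "card A \<le> card {a, f a}" by (intro card_mono) auto
    then show False using card 1 by simp
  qed
  show A: "A = {a, f a, f (f a)}"
    using card 1 2 3 a mem by (intro card_seteq[symmetric]) (auto intro: card_ge_0_finite)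
  show 4: "f (f (f a)) = a"
    using A mem[of "f (f a)"] inj 1 2 3 a by auto
  show "inv f a = f (f a)" using 4 permutes_inverses(2)[OF p] by metis
qed

lemma finite_inj_self_in_orbit:
  assumes "finite A" "f ` A \<subseteq> A" "inj_on f A" "x \<in> A"
  shows "x \<in> orbit f x"
proof -
  have "bij_betw f A A" using endo_inj_surj[OF assms(1-3)] assms(3) by (simp add: bij_betw_def)
  then have "perm_restrict f A permutes A"
    by (intro bij_imp_permutes) (auto simp: perm_restrict_simps bij_betw_def inj_on_def)
  then have "x \<in> orbit (perm_restrict f A) x"
    using assms(1) by (intro permutation_self_in_orbit) (auto simp: permutation_permutes)
  moreover have "orbit f x = orbit (perm_restrict f A) x"
    using assms by (intro orbit_cong0[of _ A]) (auto simp: perm_restrict_simps)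
  ultimately show ?thesis by simp
qed

text \<open>
  Turning back at the corner of a flag: the flag of the reversed walk that leaves the vertex
  through the edge by which the walk came. A step of a facial walk traverses an edge and turns a
  corner, so \<open>next_flag\<close> is the product of two involutions, \<open>reverse_flag\<close> and \<open>corner_flag\<close>, and
  faces are orbits of the group that these generate.
\<close>

fun corner_flag :: "'a scheme \<Rightarrow> 'a flag \<Rightarrow> 'a flag" where
  "corner_flag S (v, e, s) = (v, if s = 1 then rot S v e else inv (rot S v) e, - s)"

declare next_flag.simps [simp del] reverse_flag.simps [simp del] corner_flag.simps [simp del]

text \<open>
  Functions on flags that are invariant under both involutions are functions on the set of faces
  (\<open>side_coloring_const_on_face\<close>). Unlike faces they can be compared for different schemes of the
  same graph.
\<close>

definition side_coloring :: "'a graph \<Rightarrow> 'a scheme \<Rightarrow> ('a flag \<Rightarrow> 'b) \<Rightarrow> bool" where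
  "side_coloring G S c \<longleftrightarrow>
     (\<forall>x\<in>flags G. c (reverse_flag S x) = c x \<and> c (corner_flag S x) = c x)"

definition boundary :: "'a graph \<Rightarrow> ('a flag \<Rightarrow> bool) \<Rightarrow> 'a set set" where
  "boundary G c = {e \<in> edges G. \<exists>v\<in>e. c (v, e, 1) \<noteq> c (v, e, -1)}"

text \<open>
  This is the space spanned by the facial walks, each taken as the set of the edges that it
  traverses exactly once.
\<close>

definition boundary_space :: "'a graph \<Rightarrow> 'a scheme \<Rightarrow> 'a set set set" where
  "boundary_space G S = boundary G ` {c. side_coloring G S c}"

definition face_boundary :: "'a graph \<Rightarrow> 'a scheme \<Rightarrow> 'a flag set set \<Rightarrow> 'a set set" where
  "face_boundary G S \<Phi> = boundary G (\<lambda>x. face S x \<in> \<Phi>)"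

locale cubic_scheme = cubic_3connected G for G :: "'a graph" +
  fixes S :: "'a scheme"
  assumes emb: "embedding_scheme G S"
begin

lemma rot_permutes: "rot S v permutes incident G v"
  using emb by (simp add: embedding_scheme_def)

lemma rot_3:
  assumes "e \<in> edges G" "v \<in> e"
  shows "incident G v = {e, rot S v e, rot S v (rot S v e)}" "rot S v (rot S v (rot S v e)) = e"
    "e \<noteq> rot S v e" "e \<noteq> rot S v (rot S v e)" "rot S v e \<noteq> rot S v (rot S v e)"
    "inv (rot S v) e = rot S v (rot S v e)"
proof -
  have "v \<in> verts G" using edge_subset assms by blast
  then have "cyclic_on (rot S v) (incident G v)" "card (incident G v) = 3" "e \<in> incident G v"
    using emb card_incident assms by (auto simp: embedding_scheme_def incident_def)
  note c = cyclic_permutation_3[OF rot_permutes this]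
  show "incident G v = {e, rot S v e, rot S v (rot S v e)}" "rot S v (rot S v (rot S v e)) = e"
    "e \<noteq> rot S v e" "e \<noteq> rot S v (rot S v e)" "rot S v e \<noteq> rot S v (rot S v e)"
    "inv (rot S v) e = rot S v (rot S v e)"
    by (fact c)+
qed

lemma rot_edge: "rot S v e \<in> edges G \<and> v \<in> rot S v e \<longleftrightarrow> e \<in> edges G \<and> v \<in> e"
  using permutes_in_image[OF rot_permutes, of v e] by (auto simp: incident_def)

lemma inv_rot_edge: "inv (rot S v) e \<in> edges G \<and> v \<in> inv (rot S v) e \<longleftrightarrow> e \<in> edges G \<and> v \<in> e"
  using permutes_in_image[OF permutes_inv[OF rot_permutes], of v e] by (auto simp: incident_def)

lemma rot_inv_rot [simp]: "rot S v (inv (rot S v) e) = e" "inv (rot S v) (rot S v e) = e"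
  using permutes_inverses[OF rot_permutes] by auto

lemma sig_cases: "e \<in> edges G \<Longrightarrow> sig S e = 1 \<or> sig S e = -1"
  using emb by (auto simp: embedding_scheme_def PiE_def Pi_def)

end

lemma (in cubic_3connected) other_end_doubleton: "v \<noteq> w \<Longrightarrow> other_end v {v, w} = w"
  by (simp add: other_end_def insert_Diff_if)

lemma flags_iff: "(v, e, s) \<in> flags G \<longleftrightarrow> e \<in> edges G \<and> v \<in> e \<and> (s = 1 \<or> s = -1)"
  by (auto simp: flags_def)

lemma (in cubic_3connected) flagE:
  assumes "x \<in> flags G"
  obtains v w e s where "x = (v, e, s)" "e = {v, w}" "v \<noteq> w" "e \<in> edges G" "v \<in> e" "w \<in> e"
    "v \<in> verts G" "w \<in> verts G" "s = 1 \<or> s = -1" "other_end v e = w" "other_end w e = v"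
proof -
  obtain v e s where x: "x = (v, e, s)" by (metis prod_cases3)
  then have e: "e \<in> edges G" "v \<in> e" "s = 1 \<or> s = -1" using assms by (auto simp: flags_iff)
  obtain w where w: "e = {v, w}" "v \<noteq> w" "v \<in> verts G" "w \<in> verts G"
    using edgeE[OF e(1,2)] .
  have "other_end v e = w" using w by (simp add: other_end_doubleton)
  moreover have "other_end w e = v"
    using w other_end_doubleton[of w v] by (simp add: insert_commute)
  ultimately show thesis using x e w by (intro that[of v e s w]) auto
qed

lemma (in cubic_3connected) finite_flags: "finite (flags G)"
proof -
  have "flags G \<subseteq> verts G \<times> edges G \<times> {1, -1}"
    using edge_subset by (auto simp: flags_def)
  then show ?thesis using finite_verts finite_edges by (metis finite.emptyI finite.insertI finite_SigmaI finite_subset)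
qed

context cubic_scheme
begin

lemma reverse_in_flags: "x \<in> flags G \<Longrightarrow> reverse_flag S x \<in> flags G"
  by (erule flagE) (auto simp: reverse_flag.simps flags_iff dest!: sig_cases)

lemma corner_in_flags: "x \<in> flags G \<Longrightarrow> corner_flag S x \<in> flags G"
  by (cases x) (use rot_edge inv_rot_edge in \<open>auto simp: corner_flag.simps flags_iff\<close>)

lemma reverse_reverse: "x \<in> flags G \<Longrightarrow> reverse_flag S (reverse_flag S x) = x"
  by (erule flagE) (auto simp: reverse_flag.simps dest!: sig_cases)

lemma corner_corner: "x \<in> flags G \<Longrightarrow> corner_flag S (corner_flag S x) = x"
  by (cases x) (auto simp: corner_flag.simps flags_iff)

lemma next_eq: "x \<in> flags G \<Longrightarrow> next_flag S x = corner_flag S (reverse_flag S x)"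
  by (erule flagE)
    (auto simp: reverse_flag.simps corner_flag.simps next_flag.simps Let_def dest!: sig_cases)

lemma next_in_flags: "x \<in> flags G \<Longrightarrow> next_flag S x \<in> flags G"
  by (simp add: next_eq corner_in_flags reverse_in_flags)

lemma next_reverse_next: "x \<in> flags G \<Longrightarrow> next_flag S (reverse_flag S (next_flag S x)) = reverse_flag S x"
  by (simp add: next_eq corner_in_flags reverse_in_flags reverse_reverse corner_corner)

lemma self_in_orbit: "x \<in> flags G \<Longrightarrow> x \<in> orbit (next_flag S) x"
proof (rule finite_inj_self_in_orbit[OF finite_flags])
  show "next_flag S ` flags G \<subseteq> flags G" using next_in_flags by auto
  show "inj_on (next_flag S) (flags G)"
    by (rule inj_onI) (metis next_reverse_next next_in_flags reverse_reverse)
qed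

lemma orbit_subset_flags:
  assumes "x \<in> flags G" shows "orbit (next_flag S) x \<subseteq> flags G"
proof
  fix y assume "y \<in> orbit (next_flag S) x"
  then show "y \<in> flags G" by induction (use assms next_in_flags in auto)
qed

lemma orbit_next: "x \<in> flags G \<Longrightarrow> orbit (next_flag S) (next_flag S x) = orbit (next_flag S) x"
  by (rule self_in_orbit_step[OF self_in_orbit])

lemma self_in_face: "x \<in> flags G \<Longrightarrow> x \<in> face S x"
  by (simp add: face_def self_in_orbit)

lemma side_coloring_face: "side_coloring G S (face S)"
  unfolding side_coloring_def
proof (intro ballI conjI)
  fix x assume x: "x \<in> flags G"
  show "face S (reverse_flag S x) = face S x"
    by (auto simp: face_def reverse_reverse x)
  have "corner_flag S x = next_flag S (reverse_flag S x)"
    by (simp add: next_eq reverse_in_flags reverse_reverse x)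
  then have "orbit (next_flag S) (corner_flag S x) = orbit (next_flag S) (reverse_flag S x)"
    by (simp add: orbit_next reverse_in_flags x)
  moreover have "next_flag S (reverse_flag S (corner_flag S x)) = x"
    by (simp add: next_eq reverse_in_flags corner_in_flags corner_corner reverse_reverse x)
  then have "orbit (next_flag S) (reverse_flag S (corner_flag S x)) = orbit (next_flag S) x"
    using orbit_next[of "reverse_flag S (corner_flag S x)"] x by (simp add: corner_in_flags reverse_in_flags)
  ultimately show "face S (corner_flag S x) = face S x"
    by (auto simp: face_def)
qed

lemma side_coloring_const_on_face:
  assumes c: "side_coloring G S c" and x: "x \<in> flags G" and y: "y \<in> face S x"
  shows "c y = c x"
proof -
  have orb: "c y = c x" if "x \<in> flags G" "y \<in> orbit (next_flag S) x" for x y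
    using that(2)
  proof induction
    case base
    then show ?case using c that(1) by (simp add: side_coloring_def next_eq reverse_in_flags)
  next
    case (step y)
    then have "y \<in> flags G" using orbit_subset_flags[OF that(1)] by blast
    then show ?case using c step by (simp add: side_coloring_def next_eq reverse_in_flags)
  qed
  have "c y = c x \<or> c y = c (reverse_flag S x)"
    using y orb x reverse_in_flags unfolding face_def by blast
  then show ?thesis using c x by (auto simp: side_coloring_def)
qed

lemma side_coloring_face_eq:
  assumes "side_coloring G S c" "x \<in> flags G" "y \<in> flags G" "face S x = face S y"
  shows "c x = c y"
  by (metis assms self_in_face side_coloring_const_on_face)

lemma face_eq_iff: "x \<in> flags G \<Longrightarrow> y \<in> flags G \<Longrightarrow> face S y = face S x \<longleftrightarrow> y \<in> face S x"
  by (metis self_in_face side_coloring_const_on_face side_coloring_face)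

lemma in_boundary_iff:
  assumes c: "side_coloring G S c" and e: "e \<in> edges G" "v \<in> e"
  shows "e \<in> boundary G c \<longleftrightarrow> c (v, e, 1) \<noteq> c (v, e, -1)"
proof -
  have "(c (u, e, 1) \<noteq> c (u, e, -1)) = (c (v, e, 1) \<noteq> c (v, e, -1))" if u: "u \<in> e" "u \<noteq> v" for u
  proof -
    have fl: "(v, e, 1) \<in> flags G" "(v, e, -1) \<in> flags G" using e by (auto simp: flags_iff)
    obtain w where w: "e = {v, w}" "v \<noteq> w" using edgeE[OF e] by blast
    then have "other_end v e = u" using u other_end_doubleton by auto
    then have "reverse_flag S (v, e, 1) = (u, e, - sig S e)" "reverse_flag S (v, e, -1) = (u, e, sig S e)"
      by (auto simp: reverse_flag.simps)
    then have "c (u, e, - sig S e) = c (v, e, 1)" "c (u, e, sig S e) = c (v, e, -1)"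
      using c fl unfolding side_coloring_def by metis+
    then show ?thesis using sig_cases[OF e(1)] by auto
  qed
  then show ?thesis using e by (auto simp: boundary_def)
qed

lemma side_coloring_eq_corner:
  assumes c: "side_coloring G S c" and e: "e \<in> edges G" "v \<in> e"
  shows "c (v, rot S v e, -1) = c (v, e, 1)"
proof -
  have "corner_flag S (v, e, 1) = (v, rot S v e, -1)" by (simp add: corner_flag.simps)
  then show ?thesis using c e unfolding side_coloring_def by (metis flags_iff)
qed

text \<open>
  On a turn around a vertex the colour changes an even number of times.
\<close>

lemma boundary_in_cycle_space:
  assumes c: "side_coloring G S c" shows "boundary G c \<in> cycle_space G"
  unfolding cycle_space_iff
proof (intro conjI ballI)
  show "boundary G c \<subseteq> edges G" by (auto simp: boundary_def)
  fix v assume "v \<in> verts G"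
  then obtain a where a: "a \<in> edges G" "v \<in> a"
    using card_incident[of v] by (metis (mono_tags, lifting) card.empty incident_def mem_Collect_eq subsetI subset_empty zero_neq_numeral)
  note r = rot_3[OF a]
  have b: "rot S v a \<in> edges G" "v \<in> rot S v a" using rot_edge[of v a] a by auto
  then have d: "rot S v (rot S v a) \<in> edges G" "v \<in> rot S v (rot S v a)"
    using rot_edge[of v "rot S v a"] by auto
  note cs = side_coloring_eq_corner[OF c a] side_coloring_eq_corner[OF c b] side_coloring_eq_corner[OF c d]
  note bs = in_boundary_iff[OF c a] in_boundary_iff[OF c b] in_boundary_iff[OF c d]
  show "even (card (incident G v \<inter> boundary G c))"
    unfolding r(1) using cs bs r(2-5)
    by (cases "c (v, a, 1)"; cases "c (v, rot S v a, 1)"; cases "c (v, rot S v (rot S v a), 1)")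
      (simp_all add: Int_insert_left)
qed

lemma boundary_space_subset: "boundary_space G S \<subseteq> cycle_space G"
  using boundary_in_cycle_space by (auto simp: boundary_space_def)

lemma side_coloring_const:
  assumes c: "side_coloring G S c"
    and sides: "\<And>v e. e \<in> edges G \<Longrightarrow> v \<in> e \<Longrightarrow> c (v, e, 1) = c (v, e, -1)"
    and x: "x \<in> flags G" and y: "y \<in> flags G"
  shows "c y = c x"
proof -
  have local: "c (v, e', s') = c (v, e, s)" if f: "(v, e, s) \<in> flags G" "(v, e', s') \<in> flags G" for v e s e' s'
  proof -
    have e: "e \<in> edges G" "v \<in> e" "e' \<in> incident G v" using f by (auto simp: flags_iff incident_def)
    have s: "c (v, d, t) = c (v, d, 1)" if "d \<in> edges G" "v \<in> d" "t = 1 \<or> t = -1" for d and t :: int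
      using sides[OF that(1,2)] that(3) by auto
    have step: "c (v, rot S v d, 1) = c (v, d, 1)" "rot S v d \<in> edges G" "v \<in> rot S v d"
      if d: "d \<in> edges G" "v \<in> d" for d
      using side_coloring_eq_corner[OF c d] sides[of "rot S v d" v] rot_edge[of v d] d by auto
    have "c (v, e', 1) = c (v, e, 1)"
      using e(3) rot_3(1)[OF e(1,2)] step[OF e(1,2)] step[of "rot S v e"] by auto
    moreover have "c (v, e', s') = c (v, e', 1)" "c (v, e, s) = c (v, e, 1)"
      using s[of e' s'] s[of e s] f by (simp_all add: flags_iff)
    ultimately show ?thesis by simp
  qed
  obtain v0 e0 s0 where x0: "x = (v0, e0, s0)" by (metis prod_cases3)
  define A where "A = {v \<in> verts G. \<forall>e s. (v, e, s) \<in> flags G \<longrightarrow> c (v, e, s) = c x}"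
  have "A = verts G"
  proof (rule ccontr)
    assume ne: "A \<noteq> verts G"
    have "c (v0, e, s) = c x" if "(v0, e, s) \<in> flags G" for e s
      using local[of v0 e0 s0 e s] x x0 that by simp
    moreover have "v0 \<in> verts G" using x x0 edge_subset[of e0] by (auto simp: flags_iff)
    ultimately have "v0 \<in> A" unfolding A_def by blast
    then have "A \<subseteq> verts G" "A \<noteq> {}" by (auto simp: A_def)
    then obtain v w where vw: "{v, w} \<in> edges G" "v \<in> A" "w \<notin> A"
      using connected_graph_edge_leaving[OF connected] ne by blast
    have fv: "(v, {v, w}, 1) \<in> flags G" using vw by (simp add: flags_iff)
    have "v \<noteq> w" using vw by auto
    then have "other_end v {v, w} = w" by (rule other_end_doubleton)
    then obtain s where "reverse_flag S (v, {v, w}, 1) = (w, {v, w}, s)" by (simp add: reverse_flag.simps)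
    then have "(w, {v, w}, s) \<in> flags G" "c (w, {v, w}, s) = c (v, {v, w}, 1)"
      using reverse_in_flags[OF fv] c fv unfolding side_coloring_def by (metis)+
    moreover have "c (v, {v, w}, 1) = c x" using vw fv by (simp add: A_def)
    ultimately have "c (w, e, t) = c x" if "(w, e, t) \<in> flags G" for e t
      using local[of w "{v, w}" s e t] that by simp
    then have "w \<in> A" using edge_subset[OF vw(1)] unfolding A_def by blast
    then show False using vw by simp
  qed
  moreover obtain v e s where y0: "y = (v, e, s)" by (metis prod_cases3)
  moreover have "v \<in> verts G" using y y0 edge_subset by (auto simp: flags_iff)
  ultimately show ?thesis using y by (auto simp: A_def)
qed

lemma side_coloring_face_mem: "side_coloring G S (\<lambda>x. face S x \<in> \<Phi>)"
  using side_coloring_face by (simp add: side_coloring_def)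

lemma finite_faces: "finite (faces G S)"
  by (simp add: faces_def finite_flags)

lemma boundary_space_eq: "boundary_space G S = face_boundary G S ` Pow (faces G S)"
proof (intro subset_antisym subsetI)
  fix W assume "W \<in> boundary_space G S"
  then obtain c where c: "side_coloring G S c" "W = boundary G c" by (auto simp: boundary_space_def)
  define P where "P = face S ` {x \<in> flags G. c x}"
  have iff: "face S x \<in> P \<longleftrightarrow> c x" if x: "x \<in> flags G" for x
  proof
    assume "face S x \<in> P"
    then obtain y where "y \<in> flags G" "c y" "face S x = face S y" by (auto simp: P_def)
    then show "c x" using side_coloring_face_eq[OF c(1) x] by blast
  qed (use x in \<open>auto simp: P_def\<close>)
  have "face S (v, e, s) \<in> P \<longleftrightarrow> c (v, e, s)" if "e \<in> edges G" "v \<in> e" "s = 1 \<or> s = -1" for v e s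
    by (rule iff) (use that in \<open>simp add: flags_iff\<close>)
  then have "boundary G c = face_boundary G S P"
    unfolding face_boundary_def boundary_def by (simp cong: conj_cong)
  moreover have "P \<subseteq> faces G S" by (auto simp: faces_def P_def)
  ultimately show "W \<in> face_boundary G S ` Pow (faces G S)" using c by blast
next
  fix W assume "W \<in> face_boundary G S ` Pow (faces G S)"
  then show "W \<in> boundary_space G S"
    using side_coloring_face_mem by (auto simp: boundary_space_def face_boundary_def)
qed

lemma in_face_boundary_iff:
  assumes "e \<in> edges G" "v \<in> e"
  shows "e \<in> face_boundary G S \<Phi> \<longleftrightarrow> (face S (v, e, 1) \<in> \<Phi>) \<noteq> (face S (v, e, -1) \<in> \<Phi>)"
  unfolding face_boundary_def by (rule in_boundary_iff[OF side_coloring_face_mem assms])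

lemma face_boundary_subset: "face_boundary G S \<Phi> \<subseteq> edges G"
  by (auto simp: face_boundary_def boundary_def)

lemma edge_nonempty: "e \<in> edges G \<Longrightarrow> \<exists>v. v \<in> e"
  using card_edge by (metis all_not_in_conv card.empty zero_neq_numeral)

lemma additive_face_boundary: "additive_on (Pow (faces G S)) (face_boundary G S)"
  unfolding additive_on_def
proof (intro ballI set_eqI)
  fix A B e
  show "e \<in> face_boundary G S (sym_diff A B) \<longleftrightarrow> e \<in> sym_diff (face_boundary G S A) (face_boundary G S B)"
  proof (cases "e \<in> edges G")
    case True
    then obtain v where "v \<in> e" using edge_nonempty by auto
    from in_face_boundary_iff[OF True this] show ?thesis by auto
  next
    case False
    then show ?thesis using face_boundary_subset by auto
  qed
qed

lemma flags_nonempty: "flags G \<noteq> {}"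
proof -
  obtain v where "v \<in> verts G" using verts_nonempty by auto
  then have "incident G v \<noteq> {}" using card_incident[of v] by auto
  then obtain e where "e \<in> edges G" "v \<in> e" by (auto simp: incident_def)
  then have "(v, e, 1) \<in> flags G" by (simp add: flags_iff)
  then show ?thesis by auto
qed

text \<open>
  If both sides of every edge have the same colour, the colour is constant around every vertex and
  along every edge, hence on all faces because \<open>G\<close> is connected.
\<close>

lemma face_boundary_eq_empty_iff:
  assumes "\<Phi> \<subseteq> faces G S"
  shows "face_boundary G S \<Phi> = {} \<longleftrightarrow> \<Phi> = {} \<or> \<Phi> = faces G S"
proof
  assume e: "face_boundary G S \<Phi> = {}"
  have "(face S y \<in> \<Phi>) = (face S x \<in> \<Phi>)" if "x \<in> flags G" "y \<in> flags G" for x y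
    by (rule side_coloring_const[OF side_coloring_face_mem _ that]) (use e in_face_boundary_iff in auto)
  then show "\<Phi> = {} \<or> \<Phi> = faces G S" using assms unfolding faces_def by blast
next
  assume a: "\<Phi> = {} \<or> \<Phi> = faces G S"
  have "face S (v, e, s) \<in> faces G S" if "e \<in> edges G" "v \<in> e" "s = 1 \<or> s = -1" for v e s
    using that by (auto simp: faces_def flags_iff)
  with a show "face_boundary G S \<Phi> = {}" by (auto simp: face_boundary_def boundary_def)
qed

lemma card_boundary_space: "card (boundary_space G S) * 2 = 2 ^ card (faces G S)"
proof -
  have "{\<Phi> \<in> Pow (faces G S). face_boundary G S \<Phi> = {}} = {{}, faces G S}"
    using face_boundary_eq_empty_iff by auto
  moreover have "faces G S \<noteq> {}" using flags_nonempty by (simp add: faces_def)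
  ultimately show ?thesis
    using card_image_times_kernel[OF additive_face_boundary subspace_Pow] finite_faces
    by (simp add: boundary_space_eq card_Pow)
qed

end

section \<open>Strong embeddings\<close>

lemma orbit_enumeration:
  assumes "x \<in> orbit f x"
  shows "orbit f x = (\<lambda>i. (f ^^ i) x) ` {0..<card (orbit f x)}"
    "inj_on (\<lambda>i. (f ^^ i) x) {0..<card (orbit f x)}"
    "(f ^^ card (orbit f x)) x = x"
proof -
  let ?N = "funpow_dist1 f x x"
  have orb: "orbit f x = (\<lambda>i. (f ^^ i) x) ` {0..<?N}" by (rule orbit_conv_funpow_dist1[OF assms])
  have inj: "inj_on (\<lambda>i. (f ^^ i) x) {0..<?N}" by (rule inj_on_funpow_dist1[OF assms])
  have N: "card (orbit f x) = ?N" using card_image[OF inj] orb by simp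
  show "orbit f x = (\<lambda>i. (f ^^ i) x) ` {0..<card (orbit f x)}" unfolding N by (rule orb)
  show "inj_on (\<lambda>i. (f ^^ i) x) {0..<card (orbit f x)}" unfolding N by (rule inj)
  show "(f ^^ card (orbit f x)) x = x" unfolding N by (rule funpow_dist1_prop[OF assms])
qed

context cubic_scheme
begin

lemma next_flagE:
  assumes "x \<in> flags G"
  obtains v w e e' s t where "x = (v, e, s)" "next_flag S x = (w, e', t)" "e = {v, w}" "v \<noteq> w"
    "e \<in> edges G" "e' \<in> edges G" "w \<in> e'" "e' \<noteq> e"
proof -
  obtain v w e s where x: "x = (v, e, s)" "e = {v, w}" "v \<noteq> w" "e \<in> edges G" "v \<in> e" "w \<in> e"
    "other_end v e = w"
    using flagE[OF assms] by metis
  define e' where "e' = (if s * sig S e = 1 then inv (rot S w) e else rot S w e)"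
  have "next_flag S x = (w, e', s * sig S e)" using x by (simp add: next_flag.simps e'_def)
  moreover have "e' \<in> edges G \<and> w \<in> e'" using rot_edge[of w e] inv_rot_edge[of w e] x by (auto simp: e'_def)
  moreover have "e' \<noteq> e" using rot_3[of e w] x unfolding e'_def by metis
  ultimately show thesis using x by (intro that[of v e s w e' "s * sig S e"]) auto
qed

lemma inj_next: "inj_on (next_flag S) (flags G)"
  by (rule inj_onI) (metis next_reverse_next next_in_flags reverse_reverse)

text \<open>
  Going backwards, a walk that returns along itself would have to turn around at an edge or at a
  corner, and no flag is its own reversal on either.
\<close>

lemma reverse_notin_orbit:
  assumes "x \<in> flags G" shows "reverse_flag S x \<notin> orbit (next_flag S) x"
proof -
  have no_return: "(next_flag S ^^ k) x \<noteq> reverse_flag S x" if "x \<in> flags G" for k x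
    using that
  proof (induction k arbitrary: x rule: less_induct)
    case (less k)
    have ne: "reverse_flag S x \<noteq> x" "next_flag S x \<noteq> reverse_flag S x"
    proof -
      obtain v w e s where x: "x = (v, e, s)" "v \<noteq> w" "other_end v e = w" "e \<in> edges G"
        using flagE[OF less.prems] by metis
      then show "reverse_flag S x \<noteq> x" by (simp add: reverse_flag.simps)
      obtain e' u t where "next_flag S x = (u, e', t)" "e' \<noteq> e"
        using next_flagE[OF less.prems] x(1) by (metis prod.inject)
      then show "next_flag S x \<noteq> reverse_flag S x" using x by (simp add: reverse_flag.simps)
    qed
    show ?case
    proof
      assume eq: "(next_flag S ^^ k) x = reverse_flag S x"
      then have "k \<noteq> 0" "k \<noteq> 1" using ne by (metis funpow_0, metis One_nat_def funpow_simps_right(1) funpow.simps(2) comp_apply id_apply)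
      then obtain j where j: "k = Suc (Suc j)" by (metis One_nat_def not0_implies_Suc)
      have fl: "(next_flag S ^^ i) y \<in> flags G" if "y \<in> flags G" for i y
        using that by (induction i) (auto simp: next_in_flags)
      have "next_flag S ((next_flag S ^^ j) (next_flag S x)) = next_flag S (reverse_flag S (next_flag S x))"
        using eq next_reverse_next[OF less.prems] by (simp add: j funpow_swap1)
      then have "(next_flag S ^^ j) (next_flag S x) = reverse_flag S (next_flag S x)"
        using inj_next less.prems by (auto dest!: inj_onD simp: fl next_in_flags reverse_in_flags)
      then show False using less.IH[of j "next_flag S x"] less.prems by (simp add: j next_in_flags)
    qed
  qed
  show ?thesis
  proof
    assume "reverse_flag S x \<in> orbit (next_flag S) x"
    then obtain k where "reverse_flag S x = (next_flag S ^^ k) x" unfolding orbit_altdef by blast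
    then show False using no_return[OF assms, of k] by simp
  qed
qed

lemma face_eq_of_orbit:
  assumes "x \<in> flags G" "y \<in> orbit (next_flag S) x" shows "face S y = face S x"
  using side_coloring_const_on_face[OF side_coloring_face assms(1)] assms(2) by (simp add: face_def)

lemma face_corner:
  assumes "e \<in> edges G" "v \<in> e" shows "face S (v, rot S v e, -1) = face S (v, e, 1)"
  by (rule side_coloring_eq_corner[OF side_coloring_face assms])

text \<open>
  The corner turned backwards is the successor of the reversed flag.
\<close>

lemma corner_notin_orbit:
  assumes y: "y \<in> flags G" shows "corner_flag S y \<notin> orbit (next_flag S) y"
proof
  assume a: "corner_flag S y \<in> orbit (next_flag S) y"
  have "corner_flag S y = next_flag S (reverse_flag S y)"
    by (simp add: next_eq reverse_in_flags reverse_reverse y)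
  then have "corner_flag S y \<in> orbit (next_flag S) (reverse_flag S y)" by (simp add: orbit.base)
  then have "reverse_flag S y \<in> orbit (next_flag S) (corner_flag S y)"
    using orbit_swap self_in_orbit[OF reverse_in_flags[OF y]] by metis
  then have "reverse_flag S y \<in> orbit (next_flag S) y" using a orbit_trans by metis
  then show False using reverse_notin_orbit[OF y] by simp
qed

definition distinct_sides :: bool where
  "distinct_sides \<longleftrightarrow> (\<forall>e\<in>edges G. \<forall>v\<in>e. face S (v, e, 1) \<noteq> face S (v, e, -1))"

text \<open>
  Two of the three corners at a vertex have an edge in common, whose two sides they contain. So a
  facial walk that passes a vertex twice has both sides of some edge.
\<close>

lemma inj_on_orbit:
  assumes d: distinct_sides and x: "x \<in> flags G"
  shows "inj_on fst (orbit (next_flag S) x)"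
proof -
  have wlog: "False" if y: "(v, e, s) \<in> orbit (next_flag S) x"
    and z: "(v, rot S v e, s') \<in> orbit (next_flag S) x" for v e s s'
  proof -
    have fl: "(v, e, s) \<in> flags G" "(v, rot S v e, s') \<in> flags G"
      using orbit_subset_flags[OF x] y z by auto
    then have e: "e \<in> edges G" "v \<in> e" and s: "s = 1 \<or> s = -1" "s' = 1 \<or> s' = -1"
      by (auto simp: flags_iff)
    let ?r = "rot S v e" let ?q = "rot S v ?r"
    have r: "?r \<in> edges G" "v \<in> ?r" using rot_edge[of v e] e by auto
    have q: "?q \<in> edges G" "v \<in> ?q" using rot_edge[of v ?r] r by auto
    have same: "face S (v, e, s) = face S (v, ?r, s')"
      using face_eq_of_orbit[OF x] y z by simp
    have cor: "face S (v, ?r, -1) = face S (v, e, 1)" "face S (v, ?q, -1) = face S (v, ?r, 1)"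
        "face S (v, e, -1) = face S (v, ?q, 1)"
      using face_corner[OF e] face_corner[OF r] face_corner[OF q] rot_3(2)[OF e] by auto
    have ds: "face S (v, e, 1) \<noteq> face S (v, e, -1)" "face S (v, ?r, 1) \<noteq> face S (v, ?r, -1)"
        "face S (v, ?q, 1) \<noteq> face S (v, ?q, -1)"
      using d e r q unfolding distinct_sides_def by blast+
    have "s = 1 \<and> s' = -1" using same cor ds s by metis
    then have "corner_flag S (v, e, s) = (v, ?r, s')" by (simp add: corner_flag.simps)
    moreover have "(v, ?r, s') \<in> orbit (next_flag S) (v, e, s)"
      using orbit_swap[OF self_in_orbit[OF x] y] z orbit_trans by metis
    ultimately show False using corner_notin_orbit[OF fl(1)] by simp
  qed
  show ?thesis
  proof (rule inj_onI, rule ccontr)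
    fix y z assume yz: "y \<in> orbit (next_flag S) x" "z \<in> orbit (next_flag S) x" "fst y = fst z" "y \<noteq> z"
    obtain v e s where y: "y = (v, e, s)" by (metis prod_cases3)
    obtain e' s' where z: "z = (v, e', s')" using yz(3) y by (metis fst_conv prod_cases3)
    have "y \<in> flags G" "z \<in> flags G" using orbit_subset_flags[OF x] yz by auto
    then have e: "e \<in> edges G" "v \<in> e" and s: "s = 1 \<or> s = -1" and e': "e' \<in> incident G v" "e' \<in> edges G" "v \<in> e'"
      and s': "s' = 1 \<or> s' = -1"
      using y z by (auto simp: flags_iff incident_def)
    have same: "face S (v, e, s) = face S (v, e', s')"
      using face_eq_of_orbit[OF x] yz y z by simp
    consider "e' = e" | "e' = rot S v e" | "e' = rot S v (rot S v e)" using e' rot_3(1)[OF e] by auto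
    then show False
    proof cases
      case 1
      then have "s \<noteq> s'" using yz y z by auto
      then have "face S (v, e, 1) = face S (v, e, -1)" using s s' same 1 by auto
      then show False using d e unfolding distinct_sides_def by blast
    next
      case 2 then show False using wlog yz y z by blast
    next
      case 3
      then have "rot S v e' = e" using rot_3(2)[OF e] by simp
      then show False using wlog[of v e' s' s] yz y z by simp
    qed
  qed
qed

text \<open>
  A vertex of degree three that occurs twice on a facial walk is passed at two corners with a
  common edge; conversely, a face that has both sides of an edge passes the ends of it twice.
\<close>

lemma strong_iff_distinct_sides: "strong G S \<longleftrightarrow> distinct_sides"
proof
  assume str: "strong G S"
  have inj: "inj_on fst (orbit (next_flag S) x)" if x: "x \<in> flags G" for x
  proof -
    have "distinct (facial_walk S x)" using str x by (simp add: strong_def is_cycle_def)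
    then have "inj_on (\<lambda>i. fst ((next_flag S ^^ i) x)) {0..<card (orbit (next_flag S) x)}"
      by (simp add: facial_walk_def distinct_map)
    then have "inj_on fst ((\<lambda>i. (next_flag S ^^ i) x) ` {0..<card (orbit (next_flag S) x)})"
      by (auto simp: inj_on_def)
    then show ?thesis using orbit_enumeration(1)[OF self_in_orbit[OF x]] by simp
  qed
  show distinct_sides
    unfolding distinct_sides_def
  proof (intro ballI notI)
    fix e v assume e: "e \<in> edges G" "v \<in> e" and eq: "face S (v, e, 1) = face S (v, e, -1)"
    let ?x = "(v, e, 1 :: int)" and ?y = "(v, e, -1 :: int)"
    have fl: "?x \<in> flags G" "?y \<in> flags G" using e by (auto simp: flags_iff)
    have "?y \<in> face S ?x" using face_eq_iff[OF fl] eq by simp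
    then consider "?y \<in> orbit (next_flag S) ?x" | "?y \<in> orbit (next_flag S) (reverse_flag S ?x)"
      by (auto simp: face_def)
    then show False
    proof cases
      case 1
      then have "?y = ?x" using inj_onD[OF inj[OF fl(1)], of ?y ?x] self_in_orbit[OF fl(1)] by simp
      then show False by simp
    next
      case 2
      have "next_flag S (reverse_flag S ?x) = (v, rot S v e, -1)"
        by (simp add: next_eq reverse_in_flags reverse_reverse fl corner_flag.simps)
      then have "(v, rot S v e, -1) \<in> orbit (next_flag S) (reverse_flag S ?x)"
        by (metis orbit.base)
      then have "(v, rot S v e, -1) = ?y"
        using inj_onD[OF inj[OF reverse_in_flags[OF fl(1)]], of "(v, rot S v e, -1)" ?y] 2 by simp
      then show False using rot_3(3)[OF e] by simp
    qed
  qed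
next
  assume d: distinct_sides
  show "strong G S"
    unfolding strong_def
  proof
    fix x assume x: "x \<in> flags G"
    let ?n = "next_flag S" and ?N = "card (orbit (next_flag S) x)"
    note en = orbit_enumeration[OF self_in_orbit[OF x]]
    have inj: "inj_on fst (orbit ?n x)" by (rule inj_on_orbit[OF d x])
    have fl: "(?n ^^ i) x \<in> flags G" for i
      using x by (induction i) (auto simp: next_in_flags)
    have len: "length (facial_walk S x) = ?N" by (simp add: facial_walk_def)
    have nth: "facial_walk S x ! i = fst ((?n ^^ i) x)" if "i < ?N" for i
      using that by (simp add: facial_walk_def)
    have N0: "?N \<noteq> 0" using en(1) orbit_nonempty[of ?n x] by (metis atLeastLessThan_empty image_empty le_refl)
    have inj': "inj_on (fst \<circ> (\<lambda>i. (?n ^^ i) x)) {0..<?N}"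
      using comp_inj_on[OF en(2)] inj en(1) by simp
    have "distinct (facial_walk S x)"
      using inj' by (simp add: facial_walk_def distinct_map comp_def)
    moreover have "{facial_walk S x ! i, facial_walk S x ! (Suc i mod ?N)} \<in> edges G" if i: "i < ?N" for i
    proof -
      have "facial_walk S x ! (Suc i mod ?N) = fst ((?n ^^ Suc i) x)"
      proof (cases "Suc i = ?N")
        case True
        then show ?thesis using nth[of 0] N0 en(3) by simp
      next
        case False
        then show ?thesis using nth[of "Suc i"] i by simp
      qed
      moreover obtain v w e e' s t where "(?n ^^ i) x = (v, e, s)" "?n ((?n ^^ i) x) = (w, e', t)"
          "e = {v, w}" "e \<in> edges G"
        using next_flagE[OF fl[of i]] by metis
      ultimately show ?thesis using nth[OF i] by simp
    qed
    moreover have "3 \<le> ?N"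
    proof -
      obtain v w e e' s t where 1: "x = (v, e, s)" "?n x = (w, e', t)" "e = {v, w}" "v \<noteq> w" "e' \<noteq> e" "w \<in> e'"
          "e' \<in> edges G"
        using next_flagE[OF x] by metis
      obtain u e'' t' where 2: "?n (?n x) = (u, e'', t')" "e' = {w, u}" "w \<noteq> u"
        using next_flagE[OF next_in_flags[OF x]] 1(2) by (metis prod.inject)
      have "?N \<noteq> 1" using en(3) 1 by auto
      moreover have "?N \<noteq> 2"
      proof
        assume "?N = 2"
        then have "?n (?n x) = x" using en(3) by (simp add: numeral_2_eq_2)
        then have "u = v" using 1 2 by simp
        then show False using 1 2 by auto
      qed
      ultimately show ?thesis using N0 by linarith
    qed
    ultimately show "is_cycle G (facial_walk S x)"
      by (simp add: is_cycle_def len)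
  qed
qed

lemma strong_iff_boundary_space: "strong G S \<longleftrightarrow> edges G \<subseteq> \<Union>(boundary_space G S)"
  unfolding strong_iff_distinct_sides distinct_sides_def
proof (intro iffI subsetI ballI)
  fix e assume d: "\<forall>e\<in>edges G. \<forall>v\<in>e. face S (v, e, 1) \<noteq> face S (v, e, -1)" and e: "e \<in> edges G"
  obtain v where v: "v \<in> e" using edge_nonempty[OF e] by auto
  have "e \<in> face_boundary G S {face S (v, e, 1)}"
    unfolding in_face_boundary_iff[OF e v] using d e v by auto
  moreover have "{face S (v, e, 1)} \<in> Pow (faces G S)" using e v by (auto simp: faces_def flags_iff)
  ultimately show "e \<in> \<Union>(boundary_space G S)" unfolding boundary_space_eq by blast
next
  fix e v assume u: "edges G \<subseteq> \<Union>(boundary_space G S)" and e: "e \<in> edges G" "v \<in> e"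
  then obtain c where c: "side_coloring G S c" "e \<in> boundary G c" by (auto simp: boundary_space_def)
  then have "c (v, e, 1) \<noteq> c (v, e, -1)" using in_boundary_iff[OF c(1) e] by simp
  then show "face S (v, e, 1) \<noteq> face S (v, e, -1)"
    using side_coloring_face_eq[OF c(1)] e by (meson flags_iff)
qed

end

section \<open>Equivalence classes of embeddings as edge sets\<close>

text \<open>
  A local change at every vertex of \<open>X\<close>: the signature of an edge with both ends in \<open>X\<close> changes
  twice.
\<close>

definition flip :: "'a graph \<Rightarrow> 'a set \<Rightarrow> 'a scheme \<Rightarrow> 'a scheme" where
  "flip G X S = \<lparr>rot = (\<lambda>v. if v \<in> X then inv (rot S v) else rot S v),
     sig = (\<lambda>e. if e \<in> edge_cut G X then - sig S e else sig S e)\<rparr>"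

definition twist :: "'a set set \<Rightarrow> 'a scheme \<Rightarrow> 'a scheme" where
  "twist T S = S\<lparr>sig := \<lambda>e. if e \<in> T then - sig S e else sig S e\<rparr>"

lemma rot_twist [simp]: "rot (twist T S) = rot S"
  by (simp add: twist_def)

lemma sig_twist: "sig (twist T S) e = (if e \<in> T then - sig S e else sig S e)"
  by (simp add: twist_def)

lemma rot_flip: "rot (flip G X S) v = (if v \<in> X then inv (rot S v) else rot S v)"
  by (simp add: flip_def)

lemma sig_flip: "sig (flip G X S) e = (if e \<in> edge_cut G X then - sig S e else sig S e)"
  by (simp add: flip_def)

lemma scheme_eqI: "(\<And>v. rot S v = rot S' v) \<Longrightarrow> (\<And>e. sig S e = sig S' e) \<Longrightarrow> S = (S' :: 'a scheme)"
  by (cases S; cases S') auto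

lemma cyclic_permutations_3_cases:
  assumes f: "f permutes A" "cyclic_on f A" and g: "g permutes A" "cyclic_on g A" and A: "card A = 3"
  shows "f = g \<or> f = inv g"
proof -
  obtain a where a: "a \<in> A" using A by fastforce
  note F = cyclic_permutation_3[OF f A a] and H = cyclic_permutation_3[OF g A a]
  have G: "inv g (g x) = x" for x using permutes_inverses(2)[OF g(1)] by simp
  have off: "f x = x" "g x = x" "inv g x = x" if "x \<notin> A" for x
    using that f(1) g(1) permutes_inv[OF g(1)] by (auto simp: permutes_def)
  have "f a = g a \<and> f (f a) = g (g a) \<or> f a = g (g a) \<and> f (f a) = g a"
    using F(1,3,4,5) H(1,3,4,5) by (metis insert_iff singletonD)
  then show ?thesis
  proof
    assume e: "f a = g a \<and> f (f a) = g (g a)"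
    have "f x = g x" for x
    proof (cases "x \<in> A")
      case True
      then have "x = a \<or> x = f a \<or> x = f (f a)" using F(1) by auto
      then show ?thesis using e F(2) H(2) by metis
    qed (use off in auto)
    then show ?thesis by auto
  next
    assume e: "f a = g (g a) \<and> f (f a) = g a"
    have "f x = inv g x" for x
    proof (cases "x \<in> A")
      case True
      then have "x = a \<or> x = f a \<or> x = f (f a)" using F(1) by auto
      then show ?thesis using e F(2) H(2) G by metis
    qed (use off in auto)
    then show ?thesis by auto
  qed
qed

context cubic_3connected
begin

lemma inv_inv_rot: "embedding_scheme G S \<Longrightarrow> inv (inv (rot S v)) = rot S v"
  using permutes_inv_inv[of "rot S v" "incident G v"] by (simp add: embedding_scheme_def)

lemma embedding_scheme_flip:
  assumes S: "embedding_scheme G S" shows "embedding_scheme G (flip G X S)"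
proof -
  have p: "rot S v permutes incident G v" for v using S by (simp add: embedding_scheme_def)
  have fin: "finite (incident G v)" for v using finite_edges by (simp add: incident_def)
  have "cyclic_on (inv (rot S v)) (incident G v)" if "v \<in> verts G" for v
  proof -
    have "permutation (rot S v)" using p fin permutation_permutes by blast
    then show ?thesis using S that by (simp add: embedding_scheme_def cyclic_on_def orbit_inv_eq)
  qed
  moreover have "sig (flip G X S) \<in> edges G \<rightarrow>\<^sub>E {-1, 1}"
    using S edge_cut_subset[of G X] by (auto simp: sig_flip embedding_scheme_def PiE_def Pi_def extensional_def)
  ultimately show ?thesis
    using S p permutes_inv[OF p] by (auto simp: embedding_scheme_def rot_flip)
qed

lemma embedding_scheme_twist:
  assumes S: "embedding_scheme G S" and T: "T \<subseteq> edges G" shows "embedding_scheme G (twist T S)"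
  using S T by (auto simp: sig_twist embedding_scheme_def PiE_def Pi_def extensional_def)

lemma edge_cut_sym_diff:
  "X \<subseteq> verts G \<Longrightarrow> Y \<subseteq> verts G \<Longrightarrow> edge_cut G (sym_diff X Y) = sym_diff (edge_cut G X) (edge_cut G Y)"
  using additive_onD[OF additive_edge_cut] by simp

lemma flip_flip:
  assumes S: "embedding_scheme G S" and XY: "X \<subseteq> verts G" "Y \<subseteq> verts G"
  shows "flip G X (flip G Y S) = flip G (sym_diff X Y) S"
  by (rule scheme_eqI) (auto simp: rot_flip sig_flip edge_cut_sym_diff[OF XY] inv_inv_rot[OF S])

lemma flip_empty: "flip G {} S = S"
  by (rule scheme_eqI) (simp_all add: rot_flip sig_flip edge_cut_def)

lemma local_change_eq_flip: "local_change G v S = flip G {v} S"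
  by (rule scheme_eqI) (auto simp: local_change_def rot_flip sig_flip edge_cut_singleton)

lemma equivalent_iff_flip:
  assumes S: "embedding_scheme G S"
  shows "equivalent G S S' \<longleftrightarrow> (\<exists>X\<subseteq>verts G. S' = flip G X S)"
proof
  assume "equivalent G S S'"
  then show "\<exists>X\<subseteq>verts G. S' = flip G X S"
    unfolding equivalent_def
  proof (induction rule: rtranclp_induct)
    case base
    then show ?case using flip_empty by (metis empty_subsetI)
  next
    case (step S' S'')
    then obtain X v where X: "X \<subseteq> verts G" "S' = flip G X S" "v \<in> verts G" "S'' = local_change G v S'"
      by auto
    then have "S'' = flip G (sym_diff {v} X) S" by (simp add: local_change_eq_flip flip_flip[OF S])
    moreover have "sym_diff {v} X \<subseteq> verts G" using X by auto
    ultimately show ?case by blast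
  qed
next
  assume "\<exists>X\<subseteq>verts G. S' = flip G X S"
  then obtain X where X: "X \<subseteq> verts G" "S' = flip G X S" by auto
  have "finite X" using X finite_verts finite_subset by auto
  then have "equivalent G S (flip G X S)" using X(1)
  proof (induction X)
    case empty
    then show ?case by (simp add: flip_empty equivalent_def)
  next
    case (insert v X)
    have "insert v X = sym_diff {v} X" using insert by auto
    then have "flip G (insert v X) S = local_change G v (flip G X S)"
      using flip_flip[OF S, of "{v}" X] insert by (simp add: local_change_eq_flip)
    then show ?case using insert unfolding equivalent_def
      by (metis (mono_tags, lifting) insert_subset rtranclp.rtrancl_into_rtrancl)
  qed
  then show "equivalent G S S'" using X by simp
qed

lemma embedding_scheme_equivalent:
  "embedding_scheme G S \<Longrightarrow> equivalent G S S' \<Longrightarrow> embedding_scheme G S'"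
  using equivalent_iff_flip[of S S'] embedding_scheme_flip[of S] by auto

lemma equivalent_trans: "equivalent G S S' \<Longrightarrow> equivalent G S' S'' \<Longrightarrow> equivalent G S S''"
  by (simp add: equivalent_def)

lemma equivalent_refl: "equivalent G S S"
  by (simp add: equivalent_def)

lemma equivalent_sym:
  assumes S: "embedding_scheme G S" and eq: "equivalent G S S'" shows "equivalent G S' S"
proof -
  obtain X where X: "X \<subseteq> verts G" "S' = flip G X S" using eq equivalent_iff_flip[OF S] by auto
  then have "flip G X S' = S" by (simp add: flip_flip[OF S] flip_empty)
  then show ?thesis
    using equivalent_iff_flip[OF embedding_scheme_equivalent[OF S eq]] X by metis
qed

text \<open>
  Inverting the rotation at a vertex exchanges the two sides of each edge as seen from there, so the
  colouring is transported by changing the sign of the flags at \<open>X\<close>.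
\<close>

lemma boundary_space_flip_subset:
  assumes S: "embedding_scheme G S" and X: "X \<subseteq> verts G"
  shows "boundary_space G S \<subseteq> boundary_space G (flip G X S)"
proof
  fix W assume "W \<in> boundary_space G S"
  then obtain c where c: "side_coloring G S c" "W = boundary G c" by (auto simp: boundary_space_def)
  define c' where "c' = (\<lambda>(v, e, s). c (v, e, if v \<in> X then - s else s))"
  have c'_eq: "c' (v, e, s) = c (v, e, if v \<in> X then - s else s)" for v e s by (simp add: c'_def)
  have rev: "c (reverse_flag S x) = c x" and cor: "c (corner_flag S x) = c x" if "x \<in> flags G" for x
    using c(1) that unfolding side_coloring_def by blast+
  have "side_coloring G (flip G X S) c'"
    unfolding side_coloring_def
  proof (intro ballI conjI)
    fix x assume x: "x \<in> flags G"
    obtain v w e s where xe: "x = (v, e, s)" "e = {v, w}" "v \<noteq> w" "e \<in> edges G" "v \<in> e"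
        "s = 1 \<or> s = -1" "other_end v e = w"
      using flagE[OF x] by metis
    have fl: "(v, e, s) \<in> flags G" "(v, e, -s) \<in> flags G" using xe by (auto simp: flags_iff)
    have r: "c (w, e, - s * sig S e) = c (v, e, s)" "c (w, e, s * sig S e) = c (v, e, - s)"
      using rev[OF fl(1)] rev[OF fl(2)] xe by (simp_all add: reverse_flag.simps)
    have k: "c (v, if s = 1 then rot S v e else inv (rot S v) e, - s) = c (v, e, s)"
      "c (v, if - s = 1 then rot S v e else inv (rot S v) e, s) = c (v, e, - s)"
      using cor[OF fl(1)] cor[OF fl(2)] by (simp_all add: corner_flag.simps)
    have inX: "e \<in> edge_cut G X \<longleftrightarrow> (v \<in> X) \<noteq> (w \<in> X)"
      using doubleton_edge_in_edge_cut[of v w X] xe by simp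
    show "c' (reverse_flag (flip G X S) x) = c' x"
      using r inX xe by (auto simp: reverse_flag.simps sig_flip c'_eq)
    show "c' (corner_flag (flip G X S) x) = c' x"
      using k xe(1,6) by (auto simp: corner_flag.simps rot_flip c'_eq inv_inv_rot[OF S])
  qed
  moreover have "boundary G c' = boundary G c" by (auto simp: boundary_def c'_eq split: if_splits)
  ultimately show "W \<in> boundary_space G (flip G X S)" using c by (auto simp: boundary_space_def)
qed

lemma boundary_space_flip:
  assumes S: "embedding_scheme G S" and X: "X \<subseteq> verts G"
  shows "boundary_space G (flip G X S) = boundary_space G S"
  using boundary_space_flip_subset[OF S X]
    boundary_space_flip_subset[OF embedding_scheme_flip[OF S] X, of X]
  by (simp add: flip_flip[OF S X X] flip_empty)

text \<open>
  At a vertex of degree three the two rotations are equal or inverse to each other.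
\<close>

lemma exists_flip_twist:
  assumes P: "embedding_scheme G P" and S: "embedding_scheme G S"
  shows "\<exists>T\<subseteq>edges G. equivalent G (twist T P) S"
proof -
  define X where "X = {v \<in> verts G. rot S v \<noteq> rot P v}"
  define T where "T = {e \<in> edges G. sig (flip G X P) e \<noteq> sig S e}"
  have X: "X \<subseteq> verts G" by (auto simp: X_def)
  have T: "T \<subseteq> edges G" by (auto simp: T_def)
  have "S = flip G X (twist T P)"
  proof (rule scheme_eqI)
    fix v
    show "rot S v = rot (flip G X (twist T P)) v"
    proof (cases "v \<in> verts G")
      case True
      then have "rot S v = rot P v \<or> rot S v = inv (rot P v)"
        using P S True by (intro cyclic_permutations_3_cases[OF _ _ _ _ card_incident[OF True]])
          (simp_all add: embedding_scheme_def)
      then show ?thesis using True by (auto simp: rot_flip X_def)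
    next
      case False
      then have "incident G v = {}" using edge_subset by (auto simp: incident_def)
      then have "rot S v permutes {}" "rot P v permutes {}"
        using S P unfolding embedding_scheme_def by metis+
      then have "rot S v = id" "rot P v = id" by (simp_all only: permutes_empty)
      then show ?thesis using False by (auto simp: rot_flip X_def)
    qed
  next
    fix e
    show "sig S e = sig (flip G X (twist T P)) e"
    proof (cases "e \<in> edges G")
      case True
      have "sig P e = 1 \<or> sig P e = -1" "sig S e = 1 \<or> sig S e = -1"
        using S P True by (auto simp: embedding_scheme_def PiE_def Pi_def)
      then show ?thesis using True by (auto simp: sig_flip sig_twist T_def)
    next
      case False
      then have "e \<notin> edge_cut G X" "e \<notin> T" using edge_cut_subset T by auto
      moreover have "sig S e = undefined" "sig P e = undefined"
        using S P False by (auto simp: embedding_scheme_def PiE_def extensional_def)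
      ultimately show ?thesis by (simp add: sig_flip sig_twist)
    qed
  qed
  then show ?thesis using equivalent_iff_flip[OF embedding_scheme_twist[OF P T]] X T by blast
qed

text \<open>
  A rotation of three edges differs from its inverse, so local changes that restore all rotations
  are made an even number of times at each vertex.
\<close>

lemma twist_equivalent_unique:
  assumes P: "embedding_scheme G P" and T: "T \<subseteq> edges G" "T' \<subseteq> edges G"
    and eq: "equivalent G (twist T P) (twist T' P)"
  shows "T = T'"
proof -
  interpret P: cubic_scheme G P by unfold_locales (rule P)
  obtain X where X: "X \<subseteq> verts G" "twist T' P = flip G X (twist T P)"
    using eq equivalent_iff_flip[OF embedding_scheme_twist[OF P T(1)]] by auto
  have "v \<notin> X" for v
  proof
    assume v: "v \<in> X"
    then have "v \<in> verts G" using X by auto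
    then have "incident G v \<noteq> {}" using card_incident[of v] by auto
    then obtain e where e: "e \<in> edges G" "v \<in> e" by (auto simp: incident_def)
    have "rot P v = inv (rot P v)" using X(2) v by (metis rot_flip rot_twist)
    then show False using P.rot_3[OF e] by metis
  qed
  then have "X = {}" by auto
  then have "twist T' P = twist T P" using X flip_empty by metis
  then have "sig (twist T' P) e = sig (twist T P) e" for e by simp
  moreover have "sig P e \<noteq> - sig P e" if "e \<in> edges G" for e
    using P.sig_cases[OF that] by auto
  ultimately have "e \<in> T \<longleftrightarrow> e \<in> T'" if "e \<in> edges G" for e
    using that unfolding sig_twist by metis
  then show ?thesis using T by auto
qed

text \<open>
  Around a vertex there are exactly two colourings with boundary \<open>W\<close>, and each is the complement of
  the other. Along an edge outside \<open>W\<close> the choices at its ends are related in the same way for either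
  signature, since both sides have the same colour. Along an edge of \<open>W\<close> the relation is inverted by
  a twist. So a colouring for one scheme gives a colouring for the other after complementing it on
  a set \<open>X\<close> of vertices, and \<open>X\<close> has to satisfy \<open>edge_cut G X = T \<inter> W\<close>.
\<close>

lemma boundary_space_twist:
  assumes P: "embedding_scheme G P" and T: "T \<subseteq> edges G" and W: "W \<in> boundary_space G P"
  shows "W \<in> boundary_space G (twist T P) \<longleftrightarrow> T \<inter> W \<in> cut_space G"
proof -
  interpret P: cubic_scheme G P by unfold_locales (rule P)
  interpret Q: cubic_scheme G "twist T P" by unfold_locales (rule embedding_scheme_twist[OF P T])
  obtain c where c: "side_coloring G P c" "W = boundary G c" using W by (auto simp: boundary_space_def)
  have sideW: "e \<in> W \<longleftrightarrow> c (v, e, 1) \<noteq> c (v, e, -1)" if "e \<in> edges G" "v \<in> e" for v e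
    using P.in_boundary_iff[OF c(1) that] c(2) by simp
  have rev: "c (reverse_flag P x) = c x" and cor: "c (corner_flag P x) = c x" if "x \<in> flags G" for x
    using c(1) that unfolding side_coloring_def by blast+
  have corner_twist: "corner_flag (twist T P) x = corner_flag P x" for x
    by (cases x) (simp add: corner_flag.simps)
  show ?thesis
  proof
    assume "T \<inter> W \<in> cut_space G"
    then obtain X where X: "X \<subseteq> verts G" "T \<inter> W = edge_cut G X" by (auto simp: cut_space_def)
    define c' where "c' = (\<lambda>(v, e, s). c (v, e, s) \<noteq> (v \<in> X))"
    have c'_eq: "c' (v, e, s) \<longleftrightarrow> c (v, e, s) \<noteq> (v \<in> X)" for v e s by (simp add: c'_def)
    have "side_coloring G (twist T P) c'"
      unfolding side_coloring_def
    proof (intro ballI conjI)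
      fix x assume x: "x \<in> flags G"
      obtain v w e s where xe: "x = (v, e, s)" "e = {v, w}" "v \<noteq> w" "e \<in> edges G" "v \<in> e" "w \<in> e"
          "s = 1 \<or> s = -1" "other_end v e = w"
        using flagE[OF x] by metis
      have r: "c (w, e, - s * sig P e) = c (v, e, s)"
        using rev[OF x] xe by (simp add: reverse_flag.simps)
      have inX: "e \<in> T \<inter> W \<longleftrightarrow> (v \<in> X) \<noteq> (w \<in> X)"
        using doubleton_edge_in_edge_cut[of v w X] xe X by simp
      have sw: "e \<in> W \<longleftrightarrow> c (w, e, 1) \<noteq> c (w, e, -1)" by (rule sideW[OF xe(4,6)])
      show "c' (reverse_flag (twist T P) x) = c' x"
        using r inX sw xe(1,7,8) P.sig_cases[OF xe(4)]
        by (cases "e \<in> T"; cases "e \<in> W") (auto simp: reverse_flag.simps sig_twist c'_eq)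
      have k: "c (v, if s = 1 then rot P v e else inv (rot P v) e, - s) = c (v, e, s)"
        using cor[OF x] xe(1) by (simp add: corner_flag.simps)
      show "c' (corner_flag (twist T P) x) = c' x"
        using k xe(1,7) by (auto simp: corner_flag.simps c'_eq)
    qed
    moreover have "boundary G c' = boundary G c" by (auto simp: boundary_def c'_eq)
    ultimately show "W \<in> boundary_space G (twist T P)" using c by (auto simp: boundary_space_def)
  next
    assume "W \<in> boundary_space G (twist T P)"
    then obtain c' where c': "side_coloring G (twist T P) c'" "W = boundary G c'"
      by (auto simp: boundary_space_def)
    have sideW': "e \<in> W \<longleftrightarrow> c' (v, e, 1) \<noteq> c' (v, e, -1)" if "e \<in> edges G" "v \<in> e" for v e
      using Q.in_boundary_iff[OF c'(1) that] c'(2) by simp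
    have rev': "c' (reverse_flag (twist T P) x) = c' x" and cor': "c' (corner_flag P x) = c' x"
      if "x \<in> flags G" for x
      using c'(1) that unfolding side_coloring_def corner_twist by blast+
    define d where "d x \<longleftrightarrow> c x \<noteq> c' x" for x
    have d_side: "d (v, e, s) = d (v, e, 1)" if "e \<in> edges G" "v \<in> e" "s = 1 \<or> s = -1" for v e s
      using sideW[OF that(1,2)] sideW'[OF that(1,2)] that(3) by (auto simp: d_def)
    have d_rot: "d (v, rot P v e, 1) = d (v, e, 1)" if "e \<in> edges G" "v \<in> e" for v e
    proof -
      have "corner_flag P (v, e, 1) = (v, rot P v e, -1)" by (simp add: corner_flag.simps)
      moreover have "(v, e, 1) \<in> flags G" using that by (simp add: flags_iff)
      ultimately have "d (v, rot P v e, -1) = d (v, e, 1)" using cor cor' unfolding d_def by metis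
      moreover have "rot P v e \<in> edges G" "v \<in> rot P v e" using P.rot_edge[of v e] that by auto
      ultimately show ?thesis using d_side by metis
    qed
    have d_vert: "d (v, e', 1) = d (v, e, 1)" if e: "e \<in> edges G" "v \<in> e" "e' \<in> edges G" "v \<in> e'" for v e e'
    proof -
      have "e' \<in> incident G v" using e by (simp add: incident_def)
      moreover have "rot P v e \<in> edges G" "v \<in> rot P v e" using P.rot_edge[of v e] e by auto
      ultimately show ?thesis using P.rot_3(1)[OF e(1,2)] d_rot[OF e(1,2)] d_rot[of "rot P v e" v] by auto
    qed
    define X where "X = {v \<in> verts G. \<exists>e\<in>incident G v. d (v, e, 1)}"
    have X: "v \<in> X \<longleftrightarrow> d (v, e, 1)" if "e \<in> edges G" "v \<in> e" for v e
    proof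
      assume "v \<in> X"
      then obtain e' where "e' \<in> edges G" "v \<in> e'" "d (v, e', 1)" by (auto simp: X_def incident_def)
      then show "d (v, e, 1)" using d_vert[OF that] by metis
    next
      assume "d (v, e, 1)"
      then show "v \<in> X" using that edge_subset[OF that(1)] unfolding X_def incident_def by blast
    qed
    have "e \<in> edge_cut G X \<longleftrightarrow> e \<in> T \<inter> W" if e: "e \<in> edges G" for e
    proof -
      obtain v where v: "v \<in> e" using P.edge_nonempty[OF e] by auto
      have x: "(v, e, 1) \<in> flags G" using e v by (simp add: flags_iff)
      obtain w where w: "e = {v, w}" "v \<noteq> w" using edgeE[OF e v] by metis
      have o: "other_end v e = w" using w other_end_doubleton by simp
      have we: "w \<in> e" using w by auto
      have cut: "e \<in> edge_cut G X \<longleftrightarrow> d (v, e, 1) \<noteq> d (w, e, 1)"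
        using doubleton_edge_in_edge_cut[of v w X] w e X[OF e v] X[OF e we] by simp
      have r: "c (w, e, - sig P e) = c (v, e, 1)"
        using rev[OF x] o by (simp add: reverse_flag.simps)
      have r': "c' (w, e, - (if e \<in> T then - sig P e else sig P e)) = c' (v, e, 1)"
        using rev'[OF x] o by (simp add: reverse_flag.simps sig_twist)
      note sw = sideW[OF e v] sideW[OF e we] sideW'[OF e v] sideW'[OF e we]
      show ?thesis
        using cut r r' sw P.sig_cases[OF e] unfolding d_def
        by (cases "e \<in> T"; cases "e \<in> W") auto
    qed
    then have "edge_cut G X = T \<inter> W" using edge_cut_subset T by blast
    moreover have "X \<subseteq> verts G" by (auto simp: X_def)
    ultimately show "T \<inter> W \<in> cut_space G" by (auto simp: cut_space_def)
  qed
qed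

text \<open>
  The signature becomes constantly \<open>1\<close> by local changes on \<open>X\<close> iff \<open>X\<close> cuts exactly the edges with
  signature \<open>-1\<close>.
\<close>

lemma orientable_iff_cut:
  assumes S: "embedding_scheme G S"
  shows "orientable G S \<longleftrightarrow> {e \<in> edges G. sig S e = -1} \<in> cut_space G"
proof -
  interpret S: cubic_scheme G S by unfold_locales (rule S)
  have all_1: "(\<forall>e\<in>edges G. sig (flip G X S) e = 1) \<longleftrightarrow> edge_cut G X = {e \<in> edges G. sig S e = -1}" for X
    using S.sig_cases edge_cut_subset[of G X] unfolding sig_flip by (auto split: if_splits)
  have "orientable G S \<longleftrightarrow> (\<exists>X\<subseteq>verts G. \<forall>e\<in>edges G. sig (flip G X S) e = 1)"
    unfolding orientable_def equivalent_iff_flip[OF S] by blast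
  then show ?thesis unfolding all_1 cut_space_def by blast
qed

lemma orientable_twist:
  assumes P: "embedding_scheme G P" and T: "T \<subseteq> edges G" and o: "orientable G P"
  shows "orientable G (twist T P) \<longleftrightarrow> T \<in> cut_space G"
proof -
  interpret P: cubic_scheme G P by unfold_locales (rule P)
  let ?N = "{e \<in> edges G. sig P e = -1}"
  have N: "?N \<in> cut_space G" using o orientable_iff_cut[OF P] by simp
  have "{e \<in> edges G. sig (twist T P) e = -1} = sym_diff T ?N"
    using P.sig_cases T by (auto simp: sig_twist split: if_splits)
  moreover have "sym_diff T ?N \<in> cut_space G \<longleftrightarrow> T \<in> cut_space G"
  proof
    assume "sym_diff T ?N \<in> cut_space G"
    from subspace_sym_diff[OF subspace_cut_space this N] show "T \<in> cut_space G"
      by (simp only: sym_diff_cancel)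
  qed (rule subspace_sym_diff[OF subspace_cut_space _ N])
  ultimately show ?thesis using orientable_iff_cut[OF embedding_scheme_twist[OF P T]] by simp
qed

end

section \<open>The Laplacian of the dual edge set\<close>

text \<open>
  The Laplacian matrix of the graph \<open>(F, H)\<close> modulo two, as a map on sets of vertices. Its diagonal
  entries are the parities of the degrees.
\<close>

definition laplacian :: "'b set \<Rightarrow> 'b set set \<Rightarrow> 'b set \<Rightarrow> 'b set" where
  "laplacian F H X = {f \<in> F. odd (card {e \<in> H. f \<in> e \<and> odd (card (e \<inter> X))})}"

definition laplacian_image :: "'b set \<Rightarrow> 'b set set \<Rightarrow> 'b set set" where
  "laplacian_image F H = laplacian F H ` Pow F"

locale plane_cubic = cubic_3connected G for G :: "'a graph" +
  fixes P :: "'a scheme"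
  assumes planar: "embedding_on G Sphere P"

sublocale plane_cubic \<subseteq> cubic_scheme G P
  by unfold_locales (use planar in \<open>simp add: embedding_on_def\<close>)

context plane_cubic
begin

abbreviation F where "F \<equiv> faces G P"
abbreviation bd where "bd \<equiv> face_boundary G P"

lemma orientable_plane: "orientable G P"
  using planar by (simp add: embedding_on_def)

lemma card_faces_plane: "card F + card (verts G) = card (edges G) + 2"
  using planar by (simp add: embedding_on_def euler_char_def)

text \<open>
  One inclusion holds for every embedding, and by Euler's formula the dimensions agree.
\<close>

lemma boundary_space_plane: "boundary_space G P = cycle_space G"
proof (rule card_subset_eq[OF _ boundary_space_subset])
  show "finite (cycle_space G)" using finite_edges by (simp add: cycle_space_def orth_def)
  have "card (boundary_space G P) * 2 * 2 ^ card (verts G) = 2 ^ (card F + card (verts G))"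
    by (simp add: card_boundary_space power_add)
  also have "\<dots> = 2 ^ card (edges G) * 4" by (simp add: card_faces_plane power_add)
  also have "\<dots> = card (cut_space G) * 2 * card (cycle_space G) * 2" using card_cycle_space by simp
  also have "\<dots> = card (cycle_space G) * 2 * 2 ^ card (verts G)" by (simp add: card_cut_space)
  finally show "card (boundary_space G P) = card (cycle_space G)" by simp
qed

lemma cut_space_iff:
  "T \<in> cut_space G \<longleftrightarrow> T \<subseteq> edges G \<and> (\<forall>f\<in>F. even (card (bd {f} \<inter> T)))"
proof -
  have "cut_space G = orth (edges G) (bd ` Pow F)"
    using orth_cycle_space boundary_space_plane boundary_space_eq by simp
  then show ?thesis
    using orth_image_iff[OF additive_face_boundary finite_faces finite_edges face_boundary_subset] by simp
qed

lemma card_cut_space_ge_3: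
  assumes "T \<in> cut_space G" "T \<noteq> {}" shows "3 \<le> card T"
proof -
  obtain X where X: "X \<subseteq> verts G" "T = edge_cut G X" using assms by (auto simp: cut_space_def)
  then show ?thesis using card_edge_cut_ge_3[OF X(1)] edge_cut_eq_empty_iff[OF X(1)] assms(2) by auto
qed

definition sides :: "'a set \<Rightarrow> 'a flag set set" where
  "sides e = face P ` {x \<in> flags G. fst (snd x) = e}"

lemma face_other_end:
  assumes e: "e \<in> edges G" "v \<in> e" "w \<in> e" and s: "s = 1 \<or> s = -1"
  shows "face P (w, e, s) \<in> {face P (v, e, 1), face P (v, e, -1)}"
proof (cases "w = v")
  case False
  obtain u where u: "e = {w, u}" "w \<noteq> u" using edgeE[OF e(1,3)] by metis
  then have "other_end w e = v" using e False other_end_doubleton[of w u] by auto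
  then have "reverse_flag P (w, e, s) = (v, e, - s * sig P e)" by (simp add: reverse_flag.simps)
  then have "face P (w, e, s) = face P (v, e, - s * sig P e)"
    using side_coloring_face e s unfolding side_coloring_def by (metis flags_iff)
  moreover have "- s * sig P e = 1 \<or> - s * sig P e = -1" using sig_cases[OF e(1)] s by auto
  ultimately show ?thesis by (metis insertI1 insertI2)
qed (use s in auto)

lemma sides_eq:
  assumes e: "e \<in> edges G" "v \<in> e" shows "sides e = {face P (v, e, 1), face P (v, e, -1)}"
proof
  show "sides e \<subseteq> {face P (v, e, 1), face P (v, e, -1)}"
  proof
    fix f assume "f \<in> sides e"
    then obtain w s where "(w, e, s) \<in> flags G" "f = face P (w, e, s)" by (auto simp: sides_def)
    then show "f \<in> {face P (v, e, 1), face P (v, e, -1)}"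
      using face_other_end[OF e, of w s] by (simp add: flags_iff)
  qed
  show "{face P (v, e, 1), face P (v, e, -1)} \<subseteq> sides e"
    using e by (auto simp: sides_def flags_iff)
qed

lemma orth_boundaries_in_cut_space:
  assumes "T \<subseteq> edges G" "\<And>f. even (card (bd {f} \<inter> T))" shows "T \<in> cut_space G"
  using assms by (simp add: cut_space_iff)

text \<open>
  An edge with the same face on both sides would be orthogonal to the cycle space, that is, a bridge.
\<close>

lemma faces_distinct:
  assumes e: "e \<in> edges G" "v \<in> e" shows "face P (v, e, 1) \<noteq> face P (v, e, -1)"
proof
  assume "face P (v, e, 1) = face P (v, e, -1)"
  then have "e \<notin> bd \<Phi>" for \<Phi> using in_face_boundary_iff[OF e] by simp
  then have "{e} \<in> cut_space G" using e by (intro orth_boundaries_in_cut_space) auto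
  then show False using card_cut_space_ge_3 by fastforce
qed

lemma card_sides:
  assumes e: "e \<in> edges G" shows "card (sides e) = 2"
proof -
  obtain v where v: "v \<in> e" using edge_nonempty[OF e] by auto
  show ?thesis using faces_distinct[OF e v] by (simp add: sides_eq[OF e v])
qed

lemma sides_subset: "sides e \<subseteq> F"
  by (auto simp: sides_def faces_def)

lemma in_bd_iff:
  assumes e: "e \<in> edges G" shows "e \<in> bd \<Phi> \<longleftrightarrow> odd (card (sides e \<inter> \<Phi>))"
proof -
  obtain v where v: "v \<in> e" using edge_nonempty[OF e] by auto
  show ?thesis
    unfolding in_face_boundary_iff[OF e v] sides_eq[OF e v] using faces_distinct[OF e v]
    by (cases "face P (v, e, 1) \<in> \<Phi>"; cases "face P (v, e, -1) \<in> \<Phi>")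
      (simp_all add: Int_insert_left)
qed

lemma in_bd_singleton_iff:
  assumes e: "e \<in> edges G" shows "e \<in> bd {f} \<longleftrightarrow> f \<in> sides e"
  unfolding in_bd_iff[OF e] by (cases "f \<in> sides e") auto

text \<open>
  Two edges with the same two faces meet every cycle of \<open>G\<close> evenly, so they would form a cut.
\<close>

lemma inj_on_sides: "inj_on sides (edges G)"
proof (rule inj_onI, rule ccontr)
  fix e e' assume e: "e \<in> edges G" "e' \<in> edges G" "sides e = sides e'" "e \<noteq> e'"
  have "e \<in> bd \<Phi> \<longleftrightarrow> e' \<in> bd \<Phi>" for \<Phi>
    using e(3) by (simp add: in_bd_iff[OF e(1)] in_bd_iff[OF e(2)])
  then have "even (card (bd \<Phi> \<inter> {e, e'}))" for \<Phi>
    using e(4) by (cases "e \<in> bd \<Phi>") simp_all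
  then have "{e, e'} \<in> cut_space G" using e by (intro orth_boundaries_in_cut_space) auto
  then have "3 \<le> card {e, e'}" by (rule card_cut_space_ge_3) simp
  then show False using e(4) by simp
qed

abbreviation D where "D \<equiv> dual_graph G P"

lemma verts_dual: "verts D = F"
  by (simp add: dual_graph_def)

lemma edges_dual: "edges D = sides ` edges G"
proof
  show "edges D \<subseteq> sides ` edges G" using sides_eq by (fastforce simp: dual_graph_def)
  show "sides ` edges G \<subseteq> edges D"
  proof
    fix d assume "d \<in> sides ` edges G"
    then obtain e where e: "e \<in> edges G" "d = sides e" by auto
    obtain v where "v \<in> e" using edge_nonempty[OF e(1)] by auto
    then show "d \<in> edges D" using e sides_eq[of e v] by (auto simp: dual_graph_def)
  qed
qed

lemma simple_dual: "simple_graph D"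
  using finite_faces sides_subset card_sides by (auto simp: simple_graph_def verts_dual edges_dual)

lemma card_sides_image: "T \<subseteq> edges G \<Longrightarrow> card (sides ` T) = card T"
  using inj_on_sides by (meson card_image inj_on_subset)

lemma degree_sides:
  assumes "T \<subseteq> edges G" shows "card {d \<in> sides ` T. f \<in> d} = card (bd {f} \<inter> T)"
proof -
  have "{d \<in> sides ` T. f \<in> d} = sides ` (bd {f} \<inter> T)"
    using in_bd_singleton_iff[OF subsetD[OF assms]] by auto
  moreover have "bd {f} \<inter> T \<subseteq> edges G" using assms by auto
  ultimately show ?thesis using card_sides_image by simp
qed

lemma cut_space_iff_degrees:
  assumes "T \<subseteq> edges G"
  shows "T \<in> cut_space G \<longleftrightarrow> (\<forall>f\<in>F. even (card {d \<in> sides ` T. f \<in> d}))"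
  using assms by (simp add: cut_space_iff degree_sides)

lemma laplacian_sides:
  assumes T: "T \<subseteq> edges G"
  shows "laplacian F (sides ` T) \<Psi> = {f \<in> F. odd (card (bd {f} \<inter> (T \<inter> bd \<Psi>)))}"
proof -
  have "{d \<in> sides ` T. f \<in> d \<and> odd (card (d \<inter> \<Psi>))} = sides ` (bd {f} \<inter> (T \<inter> bd \<Psi>))" for f
    using in_bd_singleton_iff[OF subsetD[OF T]] in_bd_iff[OF subsetD[OF T]] by auto
  moreover have "bd {f} \<inter> (T \<inter> bd \<Psi>) \<subseteq> edges G" for f using T by auto
  ultimately show ?thesis unfolding laplacian_def using card_sides_image by simp
qed

lemma finite_bd: "finite (bd \<Phi>)"
  using face_boundary_subset finite_edges finite_subset by blast

text \<open>
  The bilinear form of the Laplacian is the intersection of the boundaries within \<open>T\<close>, and thus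
  symmetric.
\<close>

lemma laplacian_pairing:
  assumes T: "T \<subseteq> edges G" and X: "X \<subseteq> F"
  shows "even (card (laplacian F (sides ` T) \<Psi> \<inter> X)) \<longleftrightarrow> even (card (T \<inter> bd \<Psi> \<inter> bd X))"
  unfolding laplacian_sides[OF T]
  using additive_adjoint[OF additive_face_boundary finite_faces finite_bd X, of "T \<inter> bd \<Psi>"]
  by (simp add: Int_commute)

lemma additive_laplacian:
  assumes T: "T \<subseteq> edges G" shows "additive_on (Pow F) (laplacian F (sides ` T))"
  unfolding additive_on_def
proof (intro ballI)
  fix A B assume AB: "A \<in> Pow F" "B \<in> Pow F"
  have "bd (sym_diff A B) = sym_diff (bd A) (bd B)" by (rule additive_onD[OF additive_face_boundary AB])
  moreover have "even (card (bd {f} \<inter> (T \<inter> sym_diff (bd A) (bd B)))) \<longleftrightarrow>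
      (even (card (bd {f} \<inter> (T \<inter> bd A))) \<longleftrightarrow> even (card (bd {f} \<inter> (T \<inter> bd B))))" for f
  proof -
    have "bd {f} \<inter> (T \<inter> Y) = Y \<inter> (bd {f} \<inter> T)" for Y by auto
    then show ?thesis by (simp only: even_card_sym_diff_Int[OF finite_bd finite_bd])
  qed
  ultimately show "laplacian F (sides ` T) (sym_diff A B) =
      sym_diff (laplacian F (sides ` T) A) (laplacian F (sides ` T) B)"
    unfolding laplacian_sides[OF T] by auto
qed

lemma laplacian_image_subset: "laplacian_image F H \<subseteq> Pow F"
  by (auto simp: laplacian_image_def laplacian_def)

lemma subspace_laplacian_image:
  assumes T: "T \<subseteq> edges G" shows "subspace (laplacian_image F (sides ` T))"
  unfolding laplacian_image_def by (rule subspace_image[OF additive_laplacian[OF T] subspace_Pow])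

definition laplacian_kernel :: "'a set set \<Rightarrow> 'a flag set set set" where
  "laplacian_kernel T = {\<Psi> \<in> Pow F. T \<inter> bd \<Psi> \<in> cut_space G}"

lemma laplacian_eq_empty_iff:
  assumes T: "T \<subseteq> edges G" shows "laplacian F (sides ` T) \<Psi> = {} \<longleftrightarrow> T \<inter> bd \<Psi> \<in> cut_space G"
  unfolding laplacian_sides[OF T] cut_space_iff using T by auto

lemma orth_laplacian_image:
  assumes T: "T \<subseteq> edges G" shows "orth F (laplacian_image F (sides ` T)) = laplacian_kernel T"
proof -
  have "even (card (laplacian F (sides ` T) \<Psi> \<inter> X)) \<longleftrightarrow> even (card (laplacian F (sides ` T) X \<inter> \<Psi>))"
    if "X \<subseteq> F" "\<Psi> \<subseteq> F" for X \<Psi>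
    using laplacian_pairing[OF T that(1), of \<Psi>] laplacian_pairing[OF T that(2), of X]
    by (simp only: Int_commute Int_left_commute)
  then have "X \<in> orth F (laplacian_image F (sides ` T)) \<longleftrightarrow>
      X \<subseteq> F \<and> (\<forall>\<Psi>\<in>Pow F. even (card (laplacian F (sides ` T) X \<inter> \<Psi>)))" for X
    by (auto simp: orth_def laplacian_image_def)
  moreover have "(\<forall>\<Psi>\<in>Pow F. even (card (laplacian F (sides ` T) X \<inter> \<Psi>))) \<longleftrightarrow> laplacian F (sides ` T) X = {}" for X
  proof
    assume a: "\<forall>\<Psi>\<in>Pow F. even (card (laplacian F (sides ` T) X \<inter> \<Psi>))"
    show "laplacian F (sides ` T) X = {}"
    proof (rule ccontr)
      assume "laplacian F (sides ` T) X \<noteq> {}"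
      then obtain f where f: "f \<in> laplacian F (sides ` T) X" by auto
      then have "f \<in> F" by (simp add: laplacian_def)
      then have "even (card (laplacian F (sides ` T) X \<inter> {f}))" using a by blast
      then show False using f by simp
    qed
  qed simp
  ultimately show ?thesis
    unfolding laplacian_kernel_def laplacian_eq_empty_iff[OF T] by auto
qed

lemma bd_laplacian_kernel:
  assumes T: "T \<subseteq> edges G" shows "bd ` laplacian_kernel T = boundary_space G (twist T P)"
proof -
  interpret Q: cubic_scheme G "twist T P" by unfold_locales (rule embedding_scheme_twist[OF emb T])
  have sub: "boundary_space G (twist T P) \<subseteq> bd ` Pow F"
    using Q.boundary_space_subset boundary_space_plane boundary_space_eq by simp
  have iff: "bd \<Psi> \<in> boundary_space G (twist T P) \<longleftrightarrow> \<Psi> \<in> laplacian_kernel T" if "\<Psi> \<subseteq> F" for \<Psi>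
  proof -
    have "bd \<Psi> \<in> boundary_space G P" using that boundary_space_eq by auto
    then show ?thesis using boundary_space_twist[OF emb T] that by (simp add: laplacian_kernel_def)
  qed
  show ?thesis
  proof (intro subset_antisym subsetI)
    fix W assume "W \<in> bd ` laplacian_kernel T"
    then obtain \<Psi> where "W = bd \<Psi>" "\<Psi> \<in> laplacian_kernel T" by auto
    moreover from this have "\<Psi> \<subseteq> F" by (simp add: laplacian_kernel_def)
    ultimately show "W \<in> boundary_space G (twist T P)" using iff by simp
  next
    fix W assume W: "W \<in> boundary_space G (twist T P)"
    then obtain \<Psi> where "W = bd \<Psi>" "\<Psi> \<subseteq> F" using sub by auto
    then show "W \<in> bd ` laplacian_kernel T" using iff W by auto
  qed
qed

text \<open>
  Each boundary comes from a set of faces and from its complement.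
\<close>

lemma card_laplacian_kernel:
  assumes T: "T \<subseteq> edges G" shows "card (laplacian_kernel T) = 2 ^ card (faces G (twist T P))"
proof -
  interpret Q: cubic_scheme G "twist T P" by unfold_locales (rule embedding_scheme_twist[OF emb T])
  have sub: "subspace (laplacian_kernel T)"
    using subspace_orth[OF finite_faces] orth_laplacian_image[OF T] by metis
  have "laplacian_kernel T \<subseteq> Pow F" by (auto simp: laplacian_kernel_def)
  then have add: "additive_on (laplacian_kernel T) bd" and fin: "finite (laplacian_kernel T)"
    using additive_face_boundary finite_faces finite_subset[of _ "Pow F"] unfolding additive_on_def by blast+
  have zero: "{} \<in> cut_space G" by (rule subspace_zero[OF subspace_cut_space])
  have bd0: "bd {} = {}" "bd F = {}" using face_boundary_eq_empty_iff by auto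
  have kernel: "{\<Psi> \<in> laplacian_kernel T. bd \<Psi> = {}} = {{}, F}"
  proof (intro subset_antisym subsetI)
    fix \<Psi> assume "\<Psi> \<in> {{}, F}"
    then show "\<Psi> \<in> {\<Psi> \<in> laplacian_kernel T. bd \<Psi> = {}}"
      by (elim insertE) (simp_all add: laplacian_kernel_def bd0 zero)
  next
    fix \<Psi> assume "\<Psi> \<in> {\<Psi> \<in> laplacian_kernel T. bd \<Psi> = {}}"
    then have "\<Psi> \<subseteq> F" "bd \<Psi> = {}" by (simp_all add: laplacian_kernel_def)
    then show "\<Psi> \<in> {{}, F}" using face_boundary_eq_empty_iff[of \<Psi>] by blast
  qed
  have "{} \<noteq> F" using flags_nonempty by (auto simp: faces_def)
  then have two: "card {{}, F} = 2" by simp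
  have "card (bd ` laplacian_kernel T) * 2 = card (laplacian_kernel T)"
    using card_image_times_kernel[OF add sub fin] unfolding kernel two .
  then show ?thesis using bd_laplacian_kernel[OF T] Q.card_boundary_space by simp
qed

lemma card_laplacian_image:
  assumes T: "T \<subseteq> edges G"
  shows "card (laplacian_image F (sides ` T)) * 2 ^ card (faces G (twist T P)) = 2 ^ card F"
  using card_orth[OF finite_faces subspace_laplacian_image[OF T] laplacian_image_subset]
  by (simp add: orth_laplacian_image[OF T] card_laplacian_kernel[OF T])

lemma euler_char_twist:
  assumes T: "T \<subseteq> edges G"
  shows "euler_char G (twist T P) = 2 - int n \<longleftrightarrow> card (laplacian_image F (sides ` T)) = 2 ^ n"
proof -
  let ?k = "card (faces G (twist T P))"
  have "euler_char G (twist T P) = 2 - int n \<longleftrightarrow> card F = n + ?k"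
    unfolding euler_char_def using card_faces_plane by (intro iffI; linarith)
  also have "\<dots> \<longleftrightarrow> (2 :: nat) ^ card F = 2 ^ (n + ?k)"
    by (rule power_inject_exp[symmetric]) simp
  also have "\<dots> \<longleftrightarrow> card (laplacian_image F (sides ` T)) * 2 ^ ?k = 2 ^ n * 2 ^ ?k"
    by (simp only: card_laplacian_image[OF T] power_add)
  also have "\<dots> \<longleftrightarrow> card (laplacian_image F (sides ` T)) = 2 ^ n"
    by simp
  finally show ?thesis .
qed

text \<open>
  Some set in the kernel contains exactly one side of an edge unless the pair of its sides is
  orthogonal to the kernel, which means that it lies in the image.
\<close>

lemma strong_twist:
  assumes T: "T \<subseteq> edges G"
  shows "strong G (twist T P) \<longleftrightarrow> edges D \<inter> laplacian_image F (sides ` T) = {}"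
proof -
  interpret Q: cubic_scheme G "twist T P" by unfold_locales (rule embedding_scheme_twist[OF emb T])
  let ?U = "laplacian_image F (sides ` T)"
  have "orth F (laplacian_kernel T) = ?U"
    using orth_orth[OF finite_faces subspace_laplacian_image[OF T] laplacian_image_subset]
    unfolding orth_laplacian_image[OF T] .
  then have in_U: "sides e \<in> ?U \<longleftrightarrow> sides e \<in> orth F (laplacian_kernel T)" for e by simp
  have in_U': "sides e \<in> ?U \<longleftrightarrow> (\<forall>\<Psi>\<in>laplacian_kernel T. even (card (\<Psi> \<inter> sides e)))" for e
    unfolding in_U orth_def mem_Collect_eq by (intro iffI conjI) (use sides_subset[of e] in simp_all)
  have in_bd: "e \<in> bd \<Psi> \<longleftrightarrow> odd (card (\<Psi> \<inter> sides e))" if "e \<in> edges G" for e \<Psi>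
    unfolding in_bd_iff[OF that] by (simp only: Int_commute)
  have "sides e \<in> ?U \<longleftrightarrow> \<not> (\<exists>\<Psi>\<in>laplacian_kernel T. e \<in> bd \<Psi>)" if e: "e \<in> edges G" for e
    unfolding in_U' in_bd[OF e] by simp
  then have "edges G \<subseteq> \<Union>(bd ` laplacian_kernel T) \<longleftrightarrow> (\<forall>e\<in>edges G. sides e \<notin> ?U)"
    by (simp add: subset_iff) blast
  then show ?thesis
    unfolding Q.strong_iff_boundary_space bd_laplacian_kernel[OF T, symmetric] edges_dual
    by (simp only:) blast
qed

lemma orientable_twist_iff:
  assumes T: "T \<subseteq> edges G"
  shows "orientable G (twist T P) \<longleftrightarrow> (\<forall>f\<in>F. even (card {d \<in> sides ` T. f \<in> d}))"
  unfolding orientable_twist[OF emb T orientable_plane] by (rule cut_space_iff_degrees[OF T])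

end

section \<open>Non-planar subgraphs of the dual\<close>

definition all_even :: "'b set set \<Rightarrow> bool" where
  "all_even Y \<longleftrightarrow> (\<forall>f. even (card {d \<in> Y. f \<in> d}))"

text \<open>
  A set of \<open>h\<close> edges on \<open>a\<close> vertices has at least \<open>2\<^bsup>h - a + 1\<^esup>\<close> even subsets: the vertices of odd
  degree depend additively on the subset and their number is even.
\<close>

lemma even_subsets_lower_bound:
  assumes fin: "finite A" "A \<noteq> {}" and H: "\<And>d. d \<in> H \<Longrightarrow> d \<subseteq> A \<and> card d = 2"
  shows "2 ^ (card H + 1) \<le> 2 ^ card A * card {Y. Y \<subseteq> H \<and> all_even Y}"
proof -
  define deg where "deg Y = {f \<in> A. odd (card {d \<in> Y. f \<in> d})}" for Y
  have finH: "finite H" using H fin by (intro finite_subset[of H "Pow A"]) auto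
  have add: "additive_on (Pow H) deg"
    unfolding additive_on_def
  proof (intro ballI)
    fix X Y assume XY: "X \<in> Pow H" "Y \<in> Pow H"
    then have f: "finite X" "finite Y" using finH finite_subset by auto
    have "{d \<in> Z. f \<in> d} = Z \<inter> {d. f \<in> d}" for Z :: "'a set set" and f by auto
    then show "deg (sym_diff X Y) = sym_diff (deg X) (deg Y)"
      unfolding deg_def by (simp only: even_card_sym_diff_Int[OF f]) blast
  qed
  have degA: "deg Y \<subseteq> A" for Y by (auto simp: deg_def)
  have "A \<in> orth A (deg ` Pow H)"
    unfolding orth_image_iff[OF add finH fin(1) degA]
  proof (intro conjI ballI subset_refl)
    fix d assume d: "d \<in> H"
    have "{d' \<in> {d}. f \<in> d'} = (if f \<in> d then {d} else {})" for f by auto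
    then have "deg {d} \<inter> A = d" using H[OF d] by (auto simp: deg_def split: if_splits)
    then show "even (card (deg {d} \<inter> A))" using H[OF d] by simp
  qed
  then have "deg ` Pow H \<subseteq> orth A {{}, A}" by (auto simp: orth_def Int_commute dest: subsetD[OF degA])
  moreover have "subspace {{}, A}" by (auto simp: subspace_def)
  then have "card {{}, A} * card (orth A {{}, A}) = 2 ^ card A" by (rule card_orth[OF fin(1)]) auto
  then have "2 * card (orth A {{}, A}) = 2 ^ card A" using fin(2)[symmetric] by simp
  moreover have "finite (orth A {{}, A})" using fin by (auto simp: orth_def)
  ultimately have "2 * card (deg ` Pow H) \<le> 2 ^ card A" by (metis card_mono mult_le_mono2)
  moreover have "{Y \<in> Pow H. deg Y = {}} \<subseteq> {Y. Y \<subseteq> H \<and> all_even Y}"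
  proof
    fix Y assume "Y \<in> {Y \<in> Pow H. deg Y = {}}"
    then have Y: "Y \<subseteq> H" "deg Y = {}" by auto
    have "even (card {d \<in> Y. f \<in> d})" for f
    proof (cases "f \<in> A")
      case False
      then have "{d \<in> Y. f \<in> d} = {}" using Y H by blast
      then show ?thesis by (metis card.empty even_zero)
    qed (use Y in \<open>auto simp: deg_def\<close>)
    then show "Y \<in> {Y. Y \<subseteq> H \<and> all_even Y}" using Y by (simp add: all_even_def)
  qed
  then have "card {Y \<in> Pow H. deg Y = {}} \<le> card {Y. Y \<subseteq> H \<and> all_even Y}"
    using finH by (intro card_mono) auto
  ultimately have "2 * card (deg ` Pow H) * card {Y \<in> Pow H. deg Y = {}}
      \<le> 2 ^ card A * card {Y. Y \<subseteq> H \<and> all_even Y}"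
    by (intro mult_le_mono)
  moreover have "card (deg ` Pow H) * card {Y \<in> Pow H. deg Y = {}} = 2 ^ card H"
    using card_image_times_kernel[OF add subspace_Pow] finH by (simp add: card_Pow)
  ultimately show ?thesis by (simp add: mult.assoc)
qed

context cubic_3connected
begin

definition component :: "'a set set \<Rightarrow> 'a \<Rightarrow> 'a set" where
  "component T v = {w \<in> verts G. (\<lambda>x y. {x, y} \<in> edges G - T)\<^sup>*\<^sup>* v w}"

lemma component_self: "v \<in> verts G \<Longrightarrow> v \<in> component T v"
  by (simp add: component_def)

lemma component_eq:
  assumes "w \<in> component T v" shows "component T w = component T v"
proof -
  let ?R = "\<lambda>x y. {x, y} \<in> edges G - T"
  have sym: "symp ?R" by (auto intro!: sympI simp: insert_commute)
  have vw: "?R\<^sup>*\<^sup>* v w" using assms by (simp add: component_def)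
  then have "?R\<^sup>*\<^sup>* w v" by (rule sympD[OF symp_rtranclp[OF sym]])
  then show ?thesis using vw unfolding component_def by (meson rtranclp_trans)
qed

lemma component_edge:
  assumes "{v, w} \<in> edges G - T" shows "component T w = component T v"
  by (rule component_eq) (use assms edge_subset in \<open>auto simp: component_def\<close>)

lemma edge_cut_component_subset:
  assumes v: "v \<in> verts G" shows "edge_cut G (component T v) \<subseteq> T"
proof
  fix e assume e: "e \<in> edge_cut G (component T v)"
  then have eE: "e \<in> edges G" by (simp add: edge_cut_def)
  obtain a where "a \<in> e" using card_edge[OF eE] by fastforce
  then obtain b where ab: "e = {a, b}" "a \<noteq> b" "a \<in> verts G" "b \<in> verts G" using edgeE[OF eE] by metis
  have "(a \<in> component T v) \<noteq> (b \<in> component T v)"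
    using e eE doubleton_edge_in_edge_cut[of a b] ab by simp
  then show "e \<in> T"
    using component_edge[of a b T] component_eq component_self ab eE by (metis Diff_iff)
qed

text \<open>
  Every edge of \<open>T\<close> leaves at most two components of \<open>G - T\<close>, and every component is left by at
  least \<open>g\<close> edges.
\<close>

lemma cuts_within_girth_bound:
  assumes T: "T \<subseteq> edges G"
    and girth: "\<And>C. C \<in> cut_space G \<Longrightarrow> C \<subseteq> T \<Longrightarrow> C \<noteq> {} \<Longrightarrow> g \<le> card C"
    and many: "2 ^ k \<le> card {C \<in> cut_space G. C \<subseteq> T}" and k: "1 \<le> k"
  shows "g * (k + 1) \<le> 2 * card T"
proof -
  define K where "K = component T ` verts G"
  define Z where "Z = {X \<in> Pow (verts G). edge_cut G X \<subseteq> T}"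
  have finT: "finite T" using T finite_edges finite_subset by blast
  have finK: "finite K" using finite_verts by (simp add: K_def)
  have subV: "component T v \<subseteq> verts G" for v by (auto simp: component_def)
  have "Z \<subseteq> Union ` Pow K"
  proof
    fix X assume X: "X \<in> Z"
    then have XV: "X \<subseteq> verts G" "edge_cut G X \<subseteq> T" by (auto simp: Z_def)
    have closed: "w \<in> X" if "(\<lambda>x y. {x, y} \<in> edges G - T)\<^sup>*\<^sup>* v w" "v \<in> X" for v w
      using that
    proof (induction rule: rtranclp_induct)
      case (step y z)
      then have "y \<noteq> z" "{y, z} \<notin> edge_cut G X" "{y, z} \<in> edges G"
        using card_edge[of "{y, z}"] XV by auto
      then show ?case using step doubleton_edge_in_edge_cut[of y z X] by simp
    qed
    then have "component T v \<subseteq> X" if "v \<in> X" for v using that by (auto simp: component_def)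
    then have "X = \<Union>(component T ` X)" using component_self XV by blast
    then show "X \<in> Union ` Pow K" using XV unfolding K_def by blast
  qed
  then have "card Z \<le> 2 ^ card K"
    using finK by (metis card_Pow card_image_le card_mono finite_Pow_iff finite_imageI le_trans)
  moreover have "card (edge_cut G ` Z) * card {X \<in> Z. edge_cut G X = {}} = card Z"
  proof (rule card_image_times_kernel)
    show "additive_on Z (edge_cut G)" using additive_edge_cut by (auto simp: additive_on_def Z_def)
    show "subspace Z"
      unfolding subspace_def
    proof (intro conjI ballI)
      show "{} \<in> Z" by (auto simp: Z_def edge_cut_def)
      fix X Y assume "X \<in> Z" "Y \<in> Z"
      moreover from this have "edge_cut G (sym_diff X Y) = sym_diff (edge_cut G X) (edge_cut G Y)"
        by (intro additive_onD[OF additive_edge_cut]) (auto simp: Z_def)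
      ultimately show "sym_diff X Y \<in> Z" by (auto simp: Z_def)
    qed
    show "finite Z" using finite_verts by (simp add: Z_def)
  qed
  moreover have "edge_cut G (verts G) = {}" "edge_cut G {} = {}" using edge_cut_eq_empty_iff by auto
  then have "{X \<in> Z. edge_cut G X = {}} = {{}, verts G}"
    using edge_cut_eq_empty_iff by (auto simp: Z_def)
  then have "card {X \<in> Z. edge_cut G X = {}} = 2" using verts_nonempty by simp
  moreover have "edge_cut G ` Z = {C \<in> cut_space G. C \<subseteq> T}" by (auto simp: Z_def cut_space_def)
  ultimately have "2 * 2 ^ k \<le> (2 :: nat) ^ card K" using many by (metis mult.commute mult_le_mono2 le_trans)
  then have "(2 :: nat) ^ (k + 1) \<le> 2 ^ card K" by simp
  then have kK: "k + 1 \<le> card K" by (rule power_le_imp_le_exp[rotated]) simp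
  have g: "g \<le> card (edge_cut G C)" if C: "C \<in> K" for C
  proof -
    obtain v where v: "v \<in> verts G" "C = component T v" using C by (auto simp: K_def)
    have "C \<noteq> verts G"
    proof
      assume CV: "C = verts G"
      then have "component T w = C" if "w \<in> verts G" for w using component_eq[of w T v] that v by simp
      then have "K \<subseteq> {C}" by (auto simp: K_def)
      then have "card K \<le> card {C}" by (intro card_mono) auto
      then show False using kK k by simp
    qed
    moreover have "C \<noteq> {}" using component_self v by blast
    ultimately have "edge_cut G C \<noteq> {}" using edge_cut_eq_empty_iff[of C] subV v by simp
    then show ?thesis
      using girth[of "edge_cut G C"] edge_cut_component_subset v subV by (auto simp: cut_space_def)
  qed
  have "card {C \<in> K. e \<in> edge_cut G C} \<le> 2" if e: "e \<in> T" for e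
  proof -
    have "{C \<in> K. e \<in> edge_cut G C} \<subseteq> component T ` e"
    proof
      fix C assume "C \<in> {C \<in> K. e \<in> edge_cut G C}"
      then obtain v where v: "v \<in> verts G" "C = component T v" "e \<in> edge_cut G C" by (auto simp: K_def)
      then have "e \<inter> C \<noteq> {}" by (auto simp: edge_cut_def)
      then obtain w where w: "w \<in> e" "w \<in> component T v" using v by auto
      have "C = component T w" using component_eq[OF w(2)] v by simp
      then show "C \<in> component T ` e" using w by simp
    qed
    moreover have "finite e" "card e = 2" using e T finite_edge card_edge by auto
    ultimately have "card {C \<in> K. e \<in> edge_cut G C} \<le> card (component T ` e)"
      "card (component T ` e) \<le> 2"
      using card_image_le[of e "component T"] by (auto intro: card_mono)
    then show ?thesis by (rule le_trans)
  qed
  then have "(\<Sum>e\<in>T. card {C \<in> K. e \<in> edge_cut G C}) \<le> (\<Sum>e\<in>T. 2)" by (intro sum_mono)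
  moreover have "(\<Sum>e\<in>T. card {C \<in> K. e \<in> edge_cut G C}) = (\<Sum>C\<in>K. card {e \<in> T. e \<in> edge_cut G C})"
    by (rule sum_multicount_gen) (use finT finK in auto)
  moreover have "{e \<in> T. e \<in> edge_cut G C} = edge_cut G C" if "C \<in> K" for C
    using that edge_cut_component_subset by (auto simp: K_def)
  moreover have "(\<Sum>C\<in>K. g) \<le> (\<Sum>C\<in>K. card (edge_cut G C))" by (rule sum_mono) (rule g)
  ultimately have "card K * g \<le> card T * 2" by simp
  then show ?thesis using mult_le_mono2[OF kK, of g] by (simp add: mult.commute)
qed

end

context plane_cubic
begin

text \<open>
  Even subgraphs of the dual are cuts of \<open>G\<close>. This is the bound that Euler's formula gives for the
  plane graph \<open>(A, H)\<close> whose cycles have length at least \<open>g\<close>.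
\<close>

lemma dual_girth_bound:
  assumes H: "H \<subseteq> edges D" and A: "finite A" "A \<noteq> {}" "\<And>d. d \<in> H \<Longrightarrow> d \<subseteq> A"
    and girth: "\<And>Y. Y \<subseteq> H \<Longrightarrow> all_even Y \<Longrightarrow> Y \<noteq> {} \<Longrightarrow> g \<le> card Y"
    and big: "card A \<le> card H"
  shows "g * (card H + 2) \<le> 2 * card H + g * card A"
proof -
  define T where "T = {e \<in> edges G. sides e \<in> H}"
  have T: "T \<subseteq> edges G" "sides ` T = H" using H by (auto simp: T_def edges_dual)
  have even_iff: "C \<in> cut_space G \<longleftrightarrow> all_even (sides ` C)" if "C \<subseteq> edges G" for C
  proof -
    have "even (card {d \<in> sides ` C. f \<in> d})" if "f \<notin> F" for f
    proof -
      have "{d \<in> sides ` C. f \<in> d} = {}" using sides_subset that by auto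
      then show ?thesis by (metis card.empty even_zero)
    qed
    then show ?thesis
      unfolding cut_space_iff_degrees[OF that] all_even_def by blast
  qed
  let ?Cs = "{C \<in> cut_space G. C \<subseteq> T}" and ?Ys = "{Y. Y \<subseteq> H \<and> all_even Y}"
  have "?Ys \<subseteq> image sides ` ?Cs"
  proof
    fix Y assume Y: "Y \<in> ?Ys"
    then have "Y \<subseteq> sides ` T" using T by simp
    then obtain C where C: "C \<subseteq> T" "Y = sides ` C" by (rule subset_imageE)
    then have "C \<in> ?Cs" using even_iff[of C] T(1) Y by simp
    then show "Y \<in> image sides ` ?Cs" using C(2) by blast
  qed
  moreover have "finite ?Cs"
    by (rule finite_subset[of _ "Pow (edges G)"]) (use cut_space_subset finite_edges in auto)
  ultimately have "card ?Ys \<le> card ?Cs" by (meson card_image_le card_mono finite_imageI le_trans)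
  moreover have "2 ^ (card H + 1) \<le> 2 ^ card A * card ?Ys"
    by (rule even_subsets_lower_bound[OF A(1,2)]) (use A(3) H simple_dual in \<open>auto simp: simple_graph_def\<close>)
  ultimately have "2 ^ (card H + 1) \<le> 2 ^ card A * card ?Cs" by (meson le_trans mult_le_mono2)
  moreover have "(2 :: nat) ^ (card H + 1) = 2 ^ card A * 2 ^ (card H + 1 - card A)"
    using big by (simp flip: power_add)
  ultimately have "2 ^ (card H + 1 - card A) \<le> card ?Cs" by simp
  moreover have "g \<le> card C" if "C \<in> cut_space G" "C \<subseteq> T" "C \<noteq> {}" for C
  proof -
    have CE: "C \<subseteq> edges G" using that T by simp
    have "g \<le> card (sides ` C)" using that T even_iff[OF CE] by (intro girth) auto
    then show ?thesis by (simp add: card_sides_image[OF CE])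
  qed
  ultimately have "g * (card H + 1 - card A + 1) \<le> 2 * card T"
    using cuts_within_girth_bound[OF T(1), of g "card H + 1 - card A"] big by auto
  moreover have "card T = card H" using card_sides_image[OF T(1)] T(2) by simp
  moreover have "card H + 1 - card A + 1 + card A = card H + 2" using big by simp
  then have "g * (card H + 1 - card A + 1) + g * card A = g * (card H + 2)" by (metis distrib_left)
  ultimately show ?thesis by linarith
qed

end

lemma all_even_other_edge:
  assumes "finite Y" "all_even Y" "d \<in> Y" "a \<in> d"
  obtains d' where "d' \<in> Y" "a \<in> d'" "d' \<noteq> d"
proof -
  have "{d' \<in> Y. a \<in> d'} \<noteq> {d}"
  proof
    assume "{d' \<in> Y. a \<in> d'} = {d}"
    then have "card {d' \<in> Y. a \<in> d'} = 1" by simp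
    then show False using assms(2) unfolding all_even_def by (metis odd_one)
  qed
  then show thesis using assms that by blast
qed

lemma all_even_card_ge_3:
  assumes fin: "finite Y" and even: "all_even Y" and ne: "Y \<noteq> {}" and two: "\<And>d. d \<in> Y \<Longrightarrow> card d = 2"
  shows "3 \<le> card Y"
proof -
  obtain d where d: "d \<in> Y" using ne by auto
  then obtain a b where ab: "d = {a, b}" "a \<noteq> b" using two by (meson card_2_iff)
  obtain d' where d': "d' \<in> Y" "a \<in> d'" "d' \<noteq> d" using all_even_other_edge[OF fin even d] ab by blast
  obtain d'' where d'': "d'' \<in> Y" "b \<in> d''" "d'' \<noteq> d" using all_even_other_edge[OF fin even d] ab by blast
  have "d' \<noteq> d''"
  proof
    assume "d' = d''"
    then have "d \<subseteq> d'" using d' d'' ab by auto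
    moreover have "finite d'" using two[OF d'(1)] by (metis card.infinite zero_neq_numeral)
    ultimately have "d = d'" using two d d' by (metis card_subset_eq)
    then show False using d' by simp
  qed
  then have "card {d, d', d''} = 3" using d' d'' by auto
  moreover have "card {d, d', d''} \<le> card Y" using fin d d' d'' by (intro card_mono) auto
  ultimately show ?thesis by simp
qed

lemma all_even_bipartite_card_ge_4:
  assumes fin: "finite Y" and even: "all_even Y" and ne: "Y \<noteq> {}" and AB: "A \<inter> B = {}"
    and bip: "\<And>d. d \<in> Y \<Longrightarrow> \<exists>a\<in>A. \<exists>b\<in>B. d = {a, b}"
  shows "4 \<le> card Y"
proof -
  obtain d where d: "d \<in> Y" using ne by auto
  then obtain a b where ab: "d = {a, b}" "a \<in> A" "b \<in> B" using bip by meson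
  obtain d' where d': "d' \<in> Y" "a \<in> d'" "d' \<noteq> d" using all_even_other_edge[OF fin even d] ab by blast
  obtain d'' where d'': "d'' \<in> Y" "b \<in> d''" "d'' \<noteq> d" using all_even_other_edge[OF fin even d] ab by blast
  obtain b' where b': "d' = {a, b'}" "b' \<in> B" using bip[OF d'(1)] d'(2) ab AB by auto
  obtain a' where a': "d'' = {a', b}" "a' \<in> A" using bip[OF d''(1)] d''(2) ab AB by auto
  obtain e where e: "e \<in> Y" "b' \<in> e" "e \<noteq> d'" using all_even_other_edge[OF fin even d'(1)] b' by blast
  have ne: "b' \<noteq> b" "b' \<noteq> a" "b' \<noteq> a'" "a' \<noteq> a" "a \<noteq> b" using b' a' ab d' d'' AB by auto
  then have "e \<noteq> d" "e \<noteq> d''" "d' \<noteq> d''" using e ab a' b' by auto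
  then have "card {d, d', d'', e} = 4" using d' d'' e by auto
  moreover have "card {d, d', d'', e} \<le> card Y" using fin d d' d'' e by (intro card_mono) auto
  ultimately show ?thesis by simp
qed

context plane_cubic
begin

lemma card_edge_dual: "d \<in> edges D \<Longrightarrow> card d = 2"
  using simple_dual by (simp add: simple_graph_def)

text \<open>
  Five mutually adjacent faces would give ten edges and cycles of length at least three, but
  \<open>3 * 12 > 2 * 10 + 3 * 5\<close>.
\<close>

lemma card_clique_le_4:
  assumes clique: "\<And>d. d \<subseteq> X \<Longrightarrow> card d = 2 \<Longrightarrow> d \<in> edges D" and X: "finite X"
  shows "card X \<le> 4"
proof (rule ccontr)
  assume "\<not> ?thesis"
  then obtain A where A: "A \<subseteq> X" "card A = 5" "finite A"
    using obtain_subset_with_card_n[of 5 X] by (metis not_less_eq_eq eval_nat_numeral(2) eval_nat_numeral(3) semiring_norm(26) semiring_norm(27) semiring_norm(28))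
  let ?H = "{d. d \<subseteq> A \<and> card d = 2}"
  have "card ?H = 5 choose 2" using n_subsets[OF A(3), of 2] A(2) by simp
  then have H: "card ?H = 10" by (simp add: choose_two)
  have "3 * (card ?H + 2) \<le> 2 * card ?H + 3 * card A"
  proof (rule dual_girth_bound)
    show "?H \<subseteq> edges D" using clique A by auto
    show "A \<noteq> {}" using A by auto
    fix Y assume Y: "Y \<subseteq> ?H" "all_even Y" "Y \<noteq> {}"
    then have "finite Y" using A finite_subset[of Y "Pow A"] by auto
    then show "3 \<le> card Y" using Y by (intro all_even_card_ge_3) auto
  qed (use A H in auto)
  then show False using H A by simp
qed

text \<open>
  Otherwise there are nine edges on six faces, with cycles of length at least four, but
  \<open>4 * 11 > 2 * 9 + 4 * 6\<close>.
\<close>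

lemma card_bipartite_le_2:
  assumes comp: "\<And>a b. a \<in> A \<Longrightarrow> b \<in> B \<Longrightarrow> {a, b} \<in> edges D" and fin: "finite A" "finite B"
  shows "card A \<le> 2 \<or> card B \<le> 2"
proof (rule ccontr)
  assume "\<not> ?thesis"
  then have "3 \<le> card A" "3 \<le> card B" by auto
  then obtain X Y where X: "X \<subseteq> A" "card X = 3" "finite X" and Y: "Y \<subseteq> B" "card Y = 3" "finite Y"
    using obtain_subset_with_card_n by metis
  have XY: "X \<inter> Y = {}"
  proof (rule ccontr)
    assume "X \<inter> Y \<noteq> {}"
    then obtain a where "a \<in> A" "a \<in> B" using X Y by auto
    then have "{a, a} \<in> edges D" by (rule comp)
    then show False using card_edge_dual by fastforce
  qed
  let ?p = "\<lambda>(a, b). {a, b}"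
  let ?H = "?p ` (X \<times> Y)"
  have "inj_on ?p (X \<times> Y)" using XY by (auto simp: inj_on_def doubleton_eq_iff)
  then have H: "card ?H = 9" using X Y by (simp add: card_image)
  have "4 * (card ?H + 2) \<le> 2 * card ?H + 4 * card (X \<union> Y)"
  proof (rule dual_girth_bound)
    show "?H \<subseteq> edges D" using comp X Y by auto
    show "card (X \<union> Y) \<le> card ?H" using X Y XY H by (simp add: card_Un_disjoint)
    show "finite (X \<union> Y)" using X Y by simp
    show "X \<union> Y \<noteq> {}" using X by auto
    show "d \<subseteq> X \<union> Y" if "d \<in> ?H" for d using that by auto
    fix Z assume Z: "Z \<subseteq> ?H" "all_even Z" "Z \<noteq> {}"
    have "finite ?H" using X Y by simp
    then have "finite Z" using Z finite_subset by blast
    moreover have "\<exists>a\<in>X. \<exists>b\<in>Y. d = {a, b}" if "d \<in> Z" for d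
      using subsetD[OF Z(1) that] by auto
    ultimately show "4 \<le> card Z" by (intro all_even_bipartite_card_ge_4[OF _ Z(2,3) XY])
  qed
  then show False using H X Y XY by (simp add: card_Un_disjoint)
qed

end

section \<open>Graphs whose Laplacian has rank at most two\<close>

lemma additive_image_in_subspace:
  assumes add: "additive_on (Pow A) h" and fin: "finite A" and V: "subspace V"
    and single: "\<And>a. a \<in> A \<Longrightarrow> h {a} \<in> V"
  shows "h ` Pow A \<subseteq> V"
proof
  fix Y assume "Y \<in> h ` Pow A"
  then obtain X where X: "X \<subseteq> A" "Y = h X" by auto
  have "finite X" using X fin finite_subset by blast
  then have "h X \<in> V" using X(1)
  proof (induction X)
    case empty
    then show ?case using additive_on_empty[OF add subspace_Pow] subspace_zero[OF V] by simp
  next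
    case (insert a X)
    have "insert a X = sym_diff {a} X" using insert by auto
    then have "h (insert a X) = sym_diff (h {a}) (h X)"
      using additive_onD[OF add, of "{a}" X] insert by simp
    then show ?case using subspace_sym_diff[OF V, of "h {a}" "h X"] single insert by simp
  qed
  then show "Y \<in> V" using X by simp
qed

definition tripartite :: "'b set \<Rightarrow> 'b set \<Rightarrow> 'b set \<Rightarrow> 'b set set" where
  "tripartite A B C = (\<Union>x\<in>A. \<Union>y\<in>B \<union> C. {{x, y}}) \<union> (\<Union>x\<in>B. \<Union>y\<in>C. {{x, y}})"

definition two_cliques :: "'b set \<Rightarrow> 'b set \<Rightarrow> 'b set \<Rightarrow> 'b set set" where
  "two_cliques A B C = (\<Union>x\<in>A. \<Union>y\<in>(A \<union> C) - {x}. {{x, y}}) \<union> (\<Union>x\<in>B. \<Union>y\<in>(B \<union> C) - {x}. {{x, y}})"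

definition disjoint3 :: "'b set \<Rightarrow> 'b set \<Rightarrow> 'b set \<Rightarrow> bool" where
  "disjoint3 A B C \<longleftrightarrow> A \<inter> B = {} \<and> A \<inter> C = {} \<and> B \<inter> C = {}"

text \<open>
  The space spanned by \<open>A \<union> C\<close> and \<open>B \<union> C\<close>.
\<close>

definition pair_unions :: "'b set \<Rightarrow> 'b set \<Rightarrow> 'b set \<Rightarrow> 'b set set" where
  "pair_unions A B C = {{}, A \<union> B, A \<union> C, B \<union> C}"

lemma doubleton_in_tripartite:
  "{x, y} \<in> tripartite A B C \<longleftrightarrow> x \<in> A \<and> y \<in> B \<union> C \<or> y \<in> A \<and> x \<in> B \<union> C \<or>
     x \<in> B \<and> y \<in> C \<or> y \<in> B \<and> x \<in> C"
  unfolding tripartite_def by (auto simp: doubleton_eq_iff)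

lemma doubleton_in_two_cliques:
  "{x, y} \<in> two_cliques A B C \<longleftrightarrow> x \<noteq> y \<and> (x \<in> A \<and> y \<in> A \<union> C \<or> y \<in> A \<and> x \<in> A \<union> C \<or>
     x \<in> B \<and> y \<in> B \<union> C \<or> y \<in> B \<and> x \<in> B \<union> C)"
  unfolding two_cliques_def by (auto simp: doubleton_eq_iff)

lemma subspace_pair_unions:
  assumes "disjoint3 A B C" shows "subspace (pair_unions A B C)"
proof -
  have "sym_diff (A \<union> B) (A \<union> C) = B \<union> C" "sym_diff (A \<union> B) (B \<union> C) = A \<union> C"
    "sym_diff (A \<union> C) (B \<union> C) = A \<union> B" "sym_diff (A \<union> C) (A \<union> B) = B \<union> C"
    "sym_diff (B \<union> C) (A \<union> B) = A \<union> C" "sym_diff (B \<union> C) (A \<union> C) = A \<union> B"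
    using assms unfolding disjoint3_def by blast+
  then show ?thesis unfolding subspace_def pair_unions_def by simp
qed

locale edge_set =
  fixes F :: "'b set" and H :: "'b set set"
  assumes fin: "finite F" and edges2: "\<And>d. d \<in> H \<Longrightarrow> d \<subseteq> F \<and> card d = 2"
begin

abbreviation row where "row f \<equiv> laplacian F H {f}"
abbreviation U where "U \<equiv> laplacian_image F H"

lemma finH: "finite H"
  using edges2 fin by (intro finite_subset[of H "Pow F"]) auto

lemma edge_pair:
  assumes "d \<in> H" "f \<in> d" shows "\<exists>g. d = {f, g} \<and> f \<noteq> g \<and> g \<in> F"
proof -
  obtain x y where "d = {x, y}" "x \<noteq> y" using edges2[OF assms(1)] by (meson card_2_iff)
  then show ?thesis using assms edges2[OF assms(1)] by (cases "f = x") auto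
qed

lemma row_subset: "row f \<subseteq> F"
  by (auto simp: laplacian_def)

lemma row_iff: "g \<in> row f \<longleftrightarrow> g \<in> F \<and> odd (card {d \<in> H. g \<in> d \<and> f \<in> d})"
proof -
  have "odd (card (d \<inter> {f})) \<longleftrightarrow> f \<in> d" for d by (cases "f \<in> d") auto
  then show ?thesis by (simp add: laplacian_def)
qed

lemma adjacent_iff: "f \<noteq> g \<Longrightarrow> f \<in> F \<Longrightarrow> g \<in> F \<Longrightarrow> g \<in> row f \<longleftrightarrow> {f, g} \<in> H"
proof -
  assume fg: "f \<noteq> g" "g \<in> F"
  have "{d \<in> H. g \<in> d \<and> f \<in> d} = (if {f, g} \<in> H then {{f, g}} else {})"
  proof -
    have unique: "d = {f, g}" if "d \<in> H" "g \<in> d" "f \<in> d" for d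
      using edge_pair[OF that(1,3)] that(2) fg by auto
    show ?thesis
    proof (cases "{f, g} \<in> H")
      case True
      then have "{d \<in> H. g \<in> d \<and> f \<in> d} = {{f, g}}" using unique by blast
      then show ?thesis using True by simp
    next
      case False
      then have "{d \<in> H. g \<in> d \<and> f \<in> d} = {}" using unique by blast
      then show ?thesis using False by simp
    qed
  qed
  then show ?thesis using fg by (simp add: row_iff)
qed

lemma self_row_iff: "f \<in> F \<Longrightarrow> f \<in> row f \<longleftrightarrow> odd (card {d \<in> H. f \<in> d})"
  by (simp add: row_iff)

lemma row_sym: "f \<in> F \<Longrightarrow> g \<in> F \<Longrightarrow> g \<in> row f \<longleftrightarrow> f \<in> row g"
  by (simp add: row_iff conj_commute)

lemma additive: "additive_on (Pow F) (laplacian F H)"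
  unfolding additive_on_def
proof (intro ballI)
  fix A B assume AB: "A \<in> Pow F" "B \<in> Pow F"
  then have f: "finite A" "finite B" using fin finite_subset by auto
  define K where "K X g = {d \<in> H. g \<in> d \<and> odd (card (d \<inter> X))}" for X g
  have "K (sym_diff A B) g = sym_diff (K A g) (K B g)" for g
    using even_card_sym_diff_Int[OF f] unfolding K_def by (auto simp: Int_commute)
  moreover have "finite (K X g)" for X g using finH by (simp add: K_def)
  ultimately have "even (card (K (sym_diff A B) g)) \<longleftrightarrow> (even (card (K A g)) \<longleftrightarrow> even (card (K B g)))" for g
    using even_card_sym_diff by metis
  then show "laplacian F H (sym_diff A B) = sym_diff (laplacian F H A) (laplacian F H B)"
    unfolding laplacian_def K_def[symmetric] by auto
qed

lemma subspace_U: "subspace U"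
  unfolding laplacian_image_def by (rule subspace_image[OF additive subspace_Pow])

lemma row_in_U: "f \<in> F \<Longrightarrow> row f \<in> U"
  by (simp add: laplacian_image_def)

lemma U_subset:
  assumes "subspace V" "\<And>f. f \<in> F \<Longrightarrow> row f \<in> V" shows "U \<subseteq> V"
  unfolding laplacian_image_def by (rule additive_image_in_subspace[OF additive fin assms])

lemma laplacian_mem_iff:
  assumes f: "f \<in> F" and X: "X \<subseteq> F" shows "f \<in> laplacian F H X \<longleftrightarrow> odd (card (row f \<inter> X))"
proof -
  have finl: "finite (laplacian F H Y)" for Y using fin by (simp add: laplacian_def)
  have s: "odd (card (Y \<inter> {f})) \<longleftrightarrow> f \<in> Y" for Y by (cases "f \<in> Y") auto
  have "{a \<in> F. f \<in> row a} = row f" using row_sym[OF f] row_subset by auto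
  then show ?thesis
    using additive_adjoint[OF additive fin finl X, of "{f}"] unfolding s by (metis s)
qed

text \<open>
  Off the diagonal a row lists the neighbours, and the diagonal entry makes its size even.
\<close>

lemma neighbours:
  assumes f: "f \<in> F" and N: "N \<subseteq> F" "f \<notin> N" "\<And>g. g \<in> F \<Longrightarrow> g \<noteq> f \<Longrightarrow> {f, g} \<in> H \<longleftrightarrow> g \<in> N"
  shows "row f = (if odd (card N) then insert f N else N)"
proof -
  have "{d \<in> H. f \<in> d} = (\<lambda>g. {f, g}) ` N"
  proof (intro subset_antisym subsetI)
    fix d assume "d \<in> {d \<in> H. f \<in> d}"
    then have d: "d \<in> H" "f \<in> d" by auto
    then obtain g where g: "d = {f, g}" "f \<noteq> g" "g \<in> F" using edge_pair by blast
    then show "d \<in> (\<lambda>g. {f, g}) ` N" using g d N(3)[of g] by auto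
  next
    fix d assume "d \<in> (\<lambda>g. {f, g}) ` N"
    then obtain g where "g \<in> N" "d = {f, g}" by auto
    then show "d \<in> {d \<in> H. f \<in> d}" using N by auto
  qed
  moreover have "inj_on (\<lambda>g. {f, g}) N" by (auto simp: inj_on_def doubleton_eq_iff)
  ultimately have "card {d \<in> H. f \<in> d} = card N" by (simp add: card_image)
  then have "f \<in> row f \<longleftrightarrow> odd (card N)" using self_row_iff[OF f] by simp
  moreover have "g \<in> row f \<longleftrightarrow> g \<in> N" if "g \<noteq> f" for g
    using adjacent_iff[of f g] that f N row_subset by (cases "g \<in> F") auto
  ultimately have "g \<in> row f \<longleftrightarrow> g \<in> (if odd (card N) then insert f N else N)" for g
    using N(2) by (cases "g = f") simp_all
  then show ?thesis by blast
qed

lemma edges_eqI: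
  assumes "\<And>d. d \<in> H' \<Longrightarrow> d \<subseteq> F \<and> card d = 2"
    and "\<And>f g. f \<in> F \<Longrightarrow> g \<in> F \<Longrightarrow> f \<noteq> g \<Longrightarrow> {f, g} \<in> H \<longleftrightarrow> {f, g} \<in> H'"
  shows "H = H'"
proof -
  have iff: "d \<in> H \<longleftrightarrow> d \<in> H'" if "d \<subseteq> F" "card d = 2" for d
  proof -
    obtain f g where fg: "d = {f, g}" "f \<noteq> g" using \<open>card d = 2\<close> unfolding card_2_iff by blast
    then show ?thesis using assms(2)[of f g] \<open>d \<subseteq> F\<close> by simp
  qed
  show ?thesis
  proof (rule set_eqI)
    fix d
    show "d \<in> H \<longleftrightarrow> d \<in> H'" using iff[of d] assms(1)[of d] edges2[of d] by blast
  qed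
qed

text \<open>
  All rows are empty or equal to one set \<open>X\<close>, and by symmetry the vertices with row \<open>X\<close> are those in
  \<open>X\<close>.
\<close>

lemma rank_one:
  assumes U: "card U = 2"
  shows "\<exists>X\<in>U. X \<noteq> {} \<and> H = {d. d \<subseteq> X \<and> card d = 2}"
proof -
  have "\<exists>f\<in>F. row f \<noteq> {}"
  proof (rule ccontr)
    assume "\<not> ?thesis"
    then have "U \<subseteq> {{}}" by (intro U_subset) (auto simp: subspace_def)
    then have "card U \<le> card {{} :: 'b set}" by (intro card_mono) auto
    then show False using U by simp
  qed
  then obtain f0 where f0: "f0 \<in> F" "row f0 \<noteq> {}" by auto
  let ?X = "row f0"
  have finU: "finite U" using U by (metis card.infinite zero_neq_numeral)
  have "{{}, ?X} \<subseteq> U" using subspace_zero[OF subspace_U] row_in_U f0 by auto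
  moreover have "card {{}, ?X} = 2" using f0(2)[symmetric] by simp
  ultimately have UX: "U = {{}, ?X}" using U card_subset_eq[OF finU] by metis
  have row: "row g = {} \<or> row g = ?X" if "g \<in> F" for g using row_in_U[OF that] UX by auto
  have "f0 \<in> ?X"
  proof -
    obtain h where h: "h \<in> ?X" using f0 by auto
    then have "f0 \<in> row h" "h \<in> F" using row_sym[OF f0(1)] row_subset by auto
    then show ?thesis using row[of h] by auto
  qed
  then have X: "g \<in> ?X \<longleftrightarrow> row g = ?X" if "g \<in> F" for g
    using row_sym[OF f0(1) that] row[OF that] by auto
  have "H = {d. d \<subseteq> ?X \<and> card d = 2}"
  proof (rule edges_eqI)
    fix f g assume fg: "f \<in> F" "g \<in> F" "f \<noteq> g"
    then have "{f, g} \<in> H \<longleftrightarrow> g \<in> row f" using adjacent_iff by simp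
    also have "\<dots> \<longleftrightarrow> f \<in> ?X \<and> g \<in> ?X" using X[OF fg(1)] row[OF fg(1)] by auto
    finally show "{f, g} \<in> H \<longleftrightarrow> {f, g} \<in> {d. d \<subseteq> ?X \<and> card d = 2}" using fg by simp
  qed (use row_subset in blast)
  then show ?thesis using f0 row_in_U by blast
qed

lemma rank_one_converse:
  assumes X: "X \<subseteq> F" "X \<noteq> {}" "even (card X)" and H: "H = {d. d \<subseteq> X \<and> card d = 2}"
  shows "U = {{}, X}"
proof -
  have r: "row f = (if f \<in> X then X else {})" if f: "f \<in> F" for f
  proof (cases "f \<in> X")
    case True
    have finX: "finite X" using X fin finite_subset by blast
    have "row f = (if odd (card (X - {f})) then insert f (X - {f}) else X - {f})"
      by (rule neighbours[OF f]) (use X True in \<open>auto simp: H\<close>)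
    moreover have "odd (card (X - {f}))" using card.remove[OF finX True] X(3) by simp
    ultimately show ?thesis using True by auto
  next
    case False
    have "row f = (if odd (card ({} :: 'b set)) then insert f {} else {})"
      by (rule neighbours[OF f]) (use False in \<open>auto simp: H\<close>)
    then show ?thesis using False by simp
  qed
  obtain f where f: "f \<in> X" using X by auto
  have "U \<subseteq> {{}, X}" by (rule U_subset) (auto simp: r subspace_def)
  moreover have "X \<in> U" using row_in_U[of f] r[of f] f X by auto
  ultimately show ?thesis using subspace_zero[OF subspace_U] by auto
qed

text \<open>
  Choose two linearly independent rows \<open>u\<^sub>1, u\<^sub>2\<close>, at \<open>f\<^sub>1, f\<^sub>2\<close>, and let \<open>u\<^sub>3\<close> be their sum. Every row is
  empty or one of the \<open>u\<^sub>i\<close>, and the blocks are the sets of the vertices that have the same row. By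
  symmetry, \<open>g\<close> lies in \<open>u\<^sub>1\<close> iff \<open>f\<^sub>1\<close> lies in the row of \<open>g\<close>, so the entries of the matrix at \<open>f\<^sub>1, f\<^sub>2\<close>
  determine which blocks make up each \<open>u\<^sub>i\<close>. This two by two matrix is invertible. Its four possible
  values lead to the tripartite graph if the diagonal is zero, and to the two cliques otherwise.
\<close>

lemma rank_two:
  assumes U: "card U = 4"
  shows "\<exists>A B C. A \<subseteq> F \<and> B \<subseteq> F \<and> C \<subseteq> F \<and> disjoint3 A B C \<and> U = pair_unions A B C \<and>
    (H = tripartite A B C \<or> H = two_cliques A B C)"
proof -
  have not_all: "\<exists>f\<in>F. row f \<notin> {{}, X}" for X
  proof (rule ccontr)
    assume "\<not> ?thesis"
    then have "U \<subseteq> {{}, X}" by (intro U_subset) (auto simp: subspace_def)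
    then have "card U \<le> card {{}, X}" by (intro card_mono) auto
    also have "\<dots> \<le> 2" by (simp add: card_insert_if)
    finally show False using U by simp
  qed
  obtain f1 where f1: "f1 \<in> F" "row f1 \<noteq> {}" using not_all[of "{}"] by auto
  obtain f2 where f2: "f2 \<in> F" "row f2 \<noteq> {}" "row f2 \<noteq> row f1" using not_all[of "row f1"] by auto
  define u1 where "u1 = row f1"
  define u2 where "u2 = row f2"
  define u3 where "u3 = sym_diff u1 u2"
  have u12: "u1 \<noteq> {}" "u2 \<noteq> {}" "u1 \<noteq> u2" using f1 f2 by (auto simp: u1_def u2_def)
  then have u3: "u3 \<noteq> {}" "u1 \<noteq> u3" "u2 \<noteq> u3" unfolding u3_def by blast+
  have U_eq: "U = {{}, u1, u2, u3}"
  proof (rule card_subset_eq[symmetric])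
    show "finite U" using U by (metis card.infinite zero_neq_numeral)
    have "u1 \<in> U" "u2 \<in> U" using row_in_U f1 f2 by (auto simp: u1_def u2_def)
    then show "{{}, u1, u2, u3} \<subseteq> U"
      using subspace_sym_diff[OF subspace_U, of u1 u2] subspace_zero[OF subspace_U] by (simp add: u3_def)
    show "card {{}, u1, u2, u3} = card U"
      using u12 u3 u12(1,2)[symmetric] u3(1)[symmetric] U by simp
  qed
  have row_cases: "row g = {} \<or> row g = u1 \<or> row g = u2 \<or> row g = u3" if "g \<in> F" for g
    using row_in_U[OF that] U_eq by auto
  \<comment> \<open>The two rows span the image, so a vector orthogonal to both is orthogonal to all rows.\<close>
  have sep: "u = {}" if u: "u \<in> U" "f1 \<notin> u" "f2 \<notin> u" for u
  proof -
    obtain X where X: "X \<subseteq> F" "u = laplacian F H X" using u by (auto simp: laplacian_image_def)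
    have e12: "even (card (u1 \<inter> X))" "even (card (u2 \<inter> X))"
      using u laplacian_mem_iff[OF f1(1) X(1)] laplacian_mem_iff[OF f2(1) X(1)] by (auto simp: X u1_def u2_def)
    have fu: "finite u1" "finite u2" using row_subset fin finite_subset unfolding u1_def u2_def by metis+
    have e3: "even (card (u3 \<inter> X))"
      unfolding u3_def even_card_sym_diff_Int[OF fu] using e12 by simp
    have "f \<notin> u" if f: "f \<in> F" for f
      using row_cases[OF f] e12 e3 laplacian_mem_iff[OF f X(1)] unfolding X(2) by auto
    moreover have "u \<subseteq> F" by (auto simp: X laplacian_def)
    ultimately show ?thesis by blast
  qed
  define R where "R u = {g \<in> F. row g = u}" for u
  have R_sub: "R u \<subseteq> F" for u by (auto simp: R_def)
  have R_disj: "disjoint3 (R x) (R y) (R z)" if "x \<noteq> y" "x \<noteq> z" "y \<noteq> z" for x y z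
    using that by (auto simp: R_def disjoint3_def)
  have tri: ?thesis
    if U3: "U = {{}, x, y, z}" and ne: "x \<noteq> {}" "y \<noteq> {}" "z \<noteq> {}" "x \<noteq> y" "x \<noteq> z" "y \<noteq> z"
      and x: "x = R y \<union> R z" and y: "y = R x \<union> R z" and z: "z = R x \<union> R y" for x y z
  proof -
    have mem: "g \<in> x \<longleftrightarrow> row g = y \<or> row g = z" "g \<in> y \<longleftrightarrow> row g = x \<or> row g = z"
      "g \<in> z \<longleftrightarrow> row g = x \<or> row g = y" if "g \<in> F" for g
    proof -
      have "g \<in> R u \<longleftrightarrow> row g = u" for u using that by (simp add: R_def)
      then show "g \<in> x \<longleftrightarrow> row g = y \<or> row g = z" "g \<in> y \<longleftrightarrow> row g = x \<or> row g = z"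
        "g \<in> z \<longleftrightarrow> row g = x \<or> row g = y" using arg_cong[OF x, of "\<lambda>X. g \<in> X"] arg_cong[OF y, of "\<lambda>X. g \<in> X"]
          arg_cong[OF z, of "\<lambda>X. g \<in> X"] by (simp_all only: Un_iff)
    qed
    have "H = tripartite (R x) (R y) (R z)"
    proof (rule edges_eqI)
      fix d assume "d \<in> tripartite (R x) (R y) (R z)"
      then show "d \<subseteq> F \<and> card d = 2" using ne by (auto simp: tripartite_def R_def card_2_iff)
    next
      fix f g assume fg: "f \<in> F" "g \<in> F" "f \<noteq> g"
      have "{f, g} \<in> H \<longleftrightarrow> g \<in> row f" using adjacent_iff fg by simp
      also have "\<dots> \<longleftrightarrow> row f = x \<and> g \<in> x \<or> row f = y \<and> g \<in> y \<or> row f = z \<and> g \<in> z"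
        using row_in_U[OF fg(1)] U3 by auto
      also have "\<dots> \<longleftrightarrow> {f, g} \<in> tripartite (R x) (R y) (R z)"
        unfolding mem[OF fg(2)] doubleton_in_tripartite using fg ne by (auto simp: R_def)
      finally show "{f, g} \<in> H \<longleftrightarrow> {f, g} \<in> tripartite (R x) (R y) (R z)" .
    qed
    moreover have "U = pair_unions (R x) (R y) (R z)"
      unfolding pair_unions_def x[symmetric] y[symmetric] z[symmetric] using U3 by auto
    ultimately show ?thesis using R_sub R_disj[OF ne(4-6)]
      by (intro exI[of _ "R x"] exI[of _ "R y"] exI[of _ "R z"]) simp
  qed
  have cliques: ?thesis
    if U3: "U = {{}, x, y, z}" and ne: "x \<noteq> {}" "y \<noteq> {}" "z \<noteq> {}" "x \<noteq> y" "x \<noteq> z" "y \<noteq> z"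
      and x: "x = R x \<union> R z" and y: "y = R y \<union> R z" and z: "z = R x \<union> R y" for x y z
  proof -
    have mem: "g \<in> x \<longleftrightarrow> row g = x \<or> row g = z" "g \<in> y \<longleftrightarrow> row g = y \<or> row g = z"
      "g \<in> z \<longleftrightarrow> row g = x \<or> row g = y" if "g \<in> F" for g
    proof -
      have "g \<in> R u \<longleftrightarrow> row g = u" for u using that by (simp add: R_def)
      then show "g \<in> x \<longleftrightarrow> row g = x \<or> row g = z" "g \<in> y \<longleftrightarrow> row g = y \<or> row g = z"
        "g \<in> z \<longleftrightarrow> row g = x \<or> row g = y" using arg_cong[OF x, of "\<lambda>X. g \<in> X"] arg_cong[OF y, of "\<lambda>X. g \<in> X"]
          arg_cong[OF z, of "\<lambda>X. g \<in> X"] by (simp_all only: Un_iff)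
    qed
    have "H = two_cliques (R x) (R y) (R z)"
    proof (rule edges_eqI)
      fix d assume "d \<in> two_cliques (R x) (R y) (R z)"
      then show "d \<subseteq> F \<and> card d = 2" by (auto simp: two_cliques_def R_def card_2_iff)
    next
      fix f g assume fg: "f \<in> F" "g \<in> F" "f \<noteq> g"
      have "{f, g} \<in> H \<longleftrightarrow> g \<in> row f" using adjacent_iff fg by simp
      also have "\<dots> \<longleftrightarrow> row f = x \<and> g \<in> x \<or> row f = y \<and> g \<in> y \<or> row f = z \<and> g \<in> z"
        using row_in_U[OF fg(1)] U3 by auto
      also have "\<dots> \<longleftrightarrow> {f, g} \<in> two_cliques (R x) (R y) (R z)"
        unfolding mem[OF fg(2)] doubleton_in_two_cliques using fg ne by (auto simp: R_def)
      finally show "{f, g} \<in> H \<longleftrightarrow> {f, g} \<in> two_cliques (R x) (R y) (R z)" .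
    qed
    moreover have "U = pair_unions (R x) (R y) (R z)"
      unfolding pair_unions_def x[symmetric] y[symmetric] z[symmetric] using U3 by auto
    ultimately show ?thesis using R_sub R_disj[OF ne(4-6)]
      by (intro exI[of _ "R x"] exI[of _ "R y"] exI[of _ "R z"]) simp
  qed
  let ?a = "f1 \<in> u1" and ?b = "f2 \<in> u1" and ?d = "f2 \<in> u2"
  have b: "f1 \<in> u2 \<longleftrightarrow> ?b" using row_sym f1 f2 by (simp add: u1_def u2_def)
  have in_u3: "g \<in> u3 \<longleftrightarrow> (g \<in> u1) \<noteq> (g \<in> u2)" for g by (auto simp: u3_def)
  \<comment> \<open>The matrix with diagonal \<open>?a, ?d\<close> and entries \<open>?b\<close> off the diagonal is invertible.\<close>
  have nonsing: "?a \<or> ?b" "?b \<or> ?d" "?a \<noteq> ?b \<or> ?b \<noteq> ?d"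
    using sep[of u1] sep[of u2] sep[of u3] u12 u3 b in_u3 U_eq by auto
  have in_u1: "g \<in> u1 \<longleftrightarrow> g \<in> F \<and> f1 \<in> row g" and in_u2: "g \<in> u2 \<longleftrightarrow> g \<in> F \<and> f2 \<in> row g" for g
    using row_sym f1(1) f2(1) row_subset unfolding u1_def u2_def by blast+
  have in_R: "g \<in> R u \<longleftrightarrow> g \<in> F \<and> row g = u" for g u by (simp add: R_def)
  note ne_u = u12 u3 u12[symmetric] u3[symmetric]
  have u1_eq: "u1 = (if ?a then R u1 else {}) \<union> (if ?b then R u2 else {}) \<union> (if ?a \<noteq> ?b then R u3 else {})" (is "_ = ?X1")
  proof (rule set_eqI)
    fix g
    have "g \<in> F \<and> f1 \<in> row g \<longleftrightarrow> g \<in> ?X1"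
    proof (cases "g \<in> F")
      case True
      from row_cases[OF this] show ?thesis
        by (elim disjE) (simp_all add: True in_R in_u3 b ne_u)
    qed (simp add: in_R)
    then show "g \<in> u1 \<longleftrightarrow> g \<in> ?X1" by (simp only: in_u1[of g])
  qed
  have u2_eq: "u2 = (if ?b then R u1 else {}) \<union> (if ?d then R u2 else {}) \<union> (if ?b \<noteq> ?d then R u3 else {})" (is "_ = ?X2")
  proof (rule set_eqI)
    fix g
    have "g \<in> F \<and> f2 \<in> row g \<longleftrightarrow> g \<in> ?X2"
    proof (cases "g \<in> F")
      case True
      from row_cases[OF this] show ?thesis
        by (elim disjE) (simp_all add: True in_R in_u3 b ne_u)
    qed (simp add: in_R)
    then show "g \<in> u2 \<longleftrightarrow> g \<in> ?X2" by (simp only: in_u2[of g])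
  qed
  have u3_eq: "u3 = (if ?a \<noteq> ?b then R u1 else {}) \<union> (if ?b \<noteq> ?d then R u2 else {}) \<union>
      (if (?a \<noteq> ?b) \<noteq> (?b \<noteq> ?d) then R u3 else {})" (is "_ = ?X3")
  proof (rule set_eqI)
    fix g
    have "(g \<in> F \<and> f1 \<in> row g) \<noteq> (g \<in> F \<and> f2 \<in> row g) \<longleftrightarrow> g \<in> ?X3"
    proof (cases "g \<in> F")
      case True
      from row_cases[OF this] show ?thesis
        by (elim disjE) (simp_all add: True in_R in_u3 b ne_u)
    qed (simp add: in_R)
    then show "g \<in> u3 \<longleftrightarrow> g \<in> ?X3" by (simp only: in_u3[of g] in_u1[of g] in_u2[of g])
  qed
  consider "?a" "\<not> ?b" "?d" | "\<not> ?a" "?b" "\<not> ?d" | "?a" "?b" "\<not> ?d" | "\<not> ?a" "?b" "?d"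
    using nonsing by blast
  then show ?thesis
  proof cases
    case 1
    have "u1 = R u1 \<union> R u3" by (rule trans[OF u1_eq]) (use 1 in simp)
    moreover have "u2 = R u2 \<union> R u3" by (rule trans[OF u2_eq]) (use 1 in simp)
    moreover have "u3 = R u1 \<union> R u2" by (rule trans[OF u3_eq]) (use 1 in simp)
    ultimately show ?thesis using u12 u3 by (intro cliques[OF U_eq])
  next
    case 2
    have "u1 = R u2 \<union> R u3" by (rule trans[OF u1_eq]) (use 2 in simp)
    moreover have "u2 = R u1 \<union> R u3" by (rule trans[OF u2_eq]) (use 2 in simp)
    moreover have "u3 = R u1 \<union> R u2" by (rule trans[OF u3_eq]) (use 2 in simp)
    ultimately show ?thesis using u12 u3 by (intro tri[OF U_eq])
  next
    case 3
    have "u1 = R u1 \<union> R u2" by (rule trans[OF u1_eq]) (use 3 in simp)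
    moreover have "u3 = R u3 \<union> R u2" by (rule trans[OF u3_eq]) (use 3 in auto)
    moreover have "u2 = R u1 \<union> R u3" by (rule trans[OF u2_eq]) (use 3 in simp)
    moreover have "U = {{}, u1, u3, u2}" using U_eq by (simp only: insert_commute)
    ultimately show ?thesis using u12 u3 by (intro cliques[of u1 u3 u2] not_sym[OF u3(3)])
  next
    case 4
    have "u2 = R u2 \<union> R u1" by (rule trans[OF u2_eq]) (use 4 in auto)
    moreover have "u3 = R u3 \<union> R u1" by (rule trans[OF u3_eq]) (use 4 in auto)
    moreover have "u1 = R u2 \<union> R u3" by (rule trans[OF u1_eq]) (use 4 in simp)
    moreover have "U = {{}, u2, u3, u1}" using U_eq by (simp only: insert_commute)
    ultimately show ?thesis using u12 u3 by (intro cliques[of u2 u3 u1] not_sym[OF u12(3)] not_sym[OF u3(2)])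
  qed
qed

end

text \<open>
  The blocks have sizes of the same parity and at most one of them is empty. This is when the
  Laplacians of \<open>tripartite A B C\<close> and \<open>two_cliques A B C\<close> have rank two with \<open>pair_unions A B C\<close> as
  their image.
\<close>

definition balanced :: "'b set \<Rightarrow> 'b set \<Rightarrow> 'b set \<Rightarrow> 'b set \<Rightarrow> bool" where
  "balanced F A B C \<longleftrightarrow> finite F \<and> A \<union> B \<union> C \<subseteq> F \<and> disjoint3 A B C \<and>
     even (card (A \<union> B)) \<and> even (card (A \<union> C)) \<and> even (card (B \<union> C)) \<and>
     A \<union> B \<noteq> {} \<and> A \<union> C \<noteq> {} \<and> B \<union> C \<noteq> {}"

lemma balancedD:
  assumes "balanced F A B C"
  shows "A \<subseteq> F" "B \<subseteq> F" "C \<subseteq> F" "disjoint3 A B C" "A \<inter> B = {}" "A \<inter> C = {}" "B \<inter> C = {}"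
    "finite A" "finite B" "finite C"
    "even (card (A \<union> B))" "even (card (A \<union> C))" "even (card (B \<union> C))"
    "card (A \<union> B) = card A + card B" "card (A \<union> C) = card A + card C" "card (B \<union> C) = card B + card C"
    "A \<noteq> {} \<or> B \<noteq> {}" "A \<noteq> {} \<or> C \<noteq> {}" "B \<noteq> {} \<or> C \<noteq> {}"
  using assms by (auto simp: balanced_def disjoint3_def card_Un_disjoint finite_subset)

lemma card_pair_unions:
  assumes bal: "balanced F A B C" shows "card (pair_unions A B C) = 4"
proof -
  have "A \<union> B \<noteq> {}" "A \<union> C \<noteq> {}" "B \<union> C \<noteq> {}" using bal by (simp_all add: balanced_def)
  moreover have "A \<union> B \<noteq> A \<union> C" "A \<union> B \<noteq> B \<union> C" "A \<union> C \<noteq> B \<union> C"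
    using balancedD(5-7,17-19)[OF bal] by blast+
  ultimately have "distinct [{}, A \<union> B, A \<union> C, B \<union> C]" by auto
  then have "card (set [{}, A \<union> B, A \<union> C, B \<union> C]) = 4" by (subst distinct_card) simp_all
  then show ?thesis by (simp add: pair_unions_def)
qed

context edge_set
begin

text \<open>
  The Laplacian annihilates the set of all vertices, as every edge has two ends.
\<close>

lemma even_card_U:
  assumes X: "X \<in> U" shows "even (card X)"
proof -
  obtain Y where Y: "Y \<subseteq> F" "X = laplacian F H Y" using X by (auto simp: laplacian_image_def)
  have "odd (card (d \<inter> F)) \<longleftrightarrow> False" if "d \<in> H" for d
    using edges2[OF that] by (simp add: Int_absorb2)
  then have "{d \<in> H. f \<in> d \<and> odd (card (d \<inter> F))} = {}" for f by blast
  then have "laplacian F H F = {}" unfolding laplacian_def by (simp only: card.empty even_zero) simp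
  then have rows: "even (card (row f \<inter> F))" if "f \<in> F" for f
    using laplacian_mem_iff[OF that subset_refl] by simp
  have "finite (laplacian F H Z)" for Z using fin by (simp add: laplacian_def)
  from additive_adjoint[OF additive fin this Y(1), of F] have
    "even (card (X \<inter> F)) \<longleftrightarrow> even (card ({a \<in> F. odd (card (row a \<inter> F))} \<inter> Y))"
    by (simp only: Y(2))
  moreover have "{a \<in> F. odd (card (row a \<inter> F))} = {}" using rows by blast
  moreover have "X \<inter> F = X" using Y by (auto simp: laplacian_def)
  ultimately show ?thesis by (metis Int_empty_left card.empty even_zero)
qed

lemma row_clique:
  assumes X: "X \<subseteq> F" "even (card X)" and H: "H = {d. d \<subseteq> X \<and> card d = 2}" and f: "f \<in> X"
  shows "row f = X"
proof -
  have finX: "finite X" using X fin finite_subset by blast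
  have "row f = (if odd (card (X - {f})) then insert f (X - {f}) else X - {f})"
    by (rule neighbours) (use X f in \<open>auto simp: H\<close>)
  moreover have "odd (card (X - {f}))" using card.remove[OF finX f] X(2) by simp
  ultimately show ?thesis using f by auto
qed

lemma row_tripartite:
  assumes bal: "balanced F A B C" and H: "H = tripartite A B C" and f: "f \<in> F"
  shows "row f = (if f \<in> A then B \<union> C else if f \<in> B then A \<union> C else if f \<in> C then A \<union> B else {})"
proof -
  note b = balancedD[OF bal]
  define N where "N = (if f \<in> A then B \<union> C else if f \<in> B then A \<union> C else if f \<in> C then A \<union> B else {})"
  have "row f = (if odd (card N) then insert f N else N)"
  proof (rule neighbours[OF f])
    show "N \<subseteq> F" using b(1-3) by (simp add: N_def)
    show "f \<notin> N" using b(5-7) by (auto simp: N_def)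
    fix g assume "g \<in> F" "g \<noteq> f"
    then show "{f, g} \<in> H \<longleftrightarrow> g \<in> N"
      unfolding H doubleton_in_tripartite N_def using b(5-7) by auto
  qed
  moreover have "even (card N)" using b(11-13) by (simp add: N_def)
  ultimately show ?thesis by (simp add: N_def)
qed

lemma row_two_cliques:
  assumes bal: "balanced F A B C" and H: "H = two_cliques A B C" and f: "f \<in> F"
  shows "row f = (if f \<in> A then A \<union> C else if f \<in> B then B \<union> C else if f \<in> C then A \<union> B else {})"
proof -
  note b = balancedD[OF bal]
  define M where "M = (if f \<in> A then A \<union> C else if f \<in> B then B \<union> C else if f \<in> C then A \<union> B else {})"
  have M: "M \<subseteq> F" "even (card M)" using b(1-3,11-13) by (simp_all add: M_def)
  have finM: "finite M" using M(1) fin finite_subset by blast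
  have r: "row f = (if odd (card (M - {f})) then insert f (M - {f}) else M - {f})"
  proof (rule neighbours[OF f])
    show "M - {f} \<subseteq> F" using M by auto
    fix g assume "g \<in> F" "g \<noteq> f"
    then show "{f, g} \<in> H \<longleftrightarrow> g \<in> M - {f}"
      unfolding H doubleton_in_two_cliques M_def using b(5-7) by auto
  qed simp
  have "row f = M"
  proof (cases "f \<in> M")
    case True
    then have "odd (card (M - {f}))" using card.remove[OF finM True] M(2) by simp
    then show ?thesis using r True by auto
  qed (use r M(2) in simp)
  then show ?thesis by (simp add: M_def)
qed

lemma image_of_block_rows:
  assumes bal: "balanced F A B C"
    and rows: "\<And>f. f \<in> F \<Longrightarrow> row f = (if f \<in> A then X else if f \<in> B then Y else if f \<in> C then A \<union> B else {})"
    and XY: "X = B \<union> C \<and> Y = A \<union> C \<or> X = A \<union> C \<and> Y = B \<union> C"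
  shows "U = pair_unions A B C"
proof
  note b = balancedD[OF bal]
  show "U \<subseteq> pair_unions A B C"
    by (rule U_subset[OF subspace_pair_unions[OF b(4)]]) (use XY in \<open>auto simp: rows pair_unions_def\<close>)
  have X: "X \<in> U" if ne: "A \<noteq> {}"
  proof -
    obtain f where "f \<in> A" "f \<in> F" using ne b(1) by auto
    then show ?thesis using row_in_U[of f] rows[of f] by simp
  qed
  have Y: "Y \<in> U" if ne: "B \<noteq> {}"
  proof -
    obtain f where f: "f \<in> B" "f \<in> F" using ne b(2) by auto
    then have "f \<notin> A" using b(5) by auto
    then show ?thesis using f row_in_U[of f] rows[of f] by simp
  qed
  have Z: "A \<union> B \<in> U" if ne: "C \<noteq> {}"
  proof -
    obtain f where f: "f \<in> C" "f \<in> F" using ne b(3) by auto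
    then have "f \<notin> A" "f \<notin> B" using b(6,7) by auto
    then show ?thesis using f row_in_U[of f] rows[of f] by simp
  qed
  have sums: "sym_diff X Y = A \<union> B" "sym_diff X (A \<union> B) = Y" "sym_diff Y (A \<union> B) = X"
    using XY b(5-7) by blast+
  have "X \<in> U \<and> Y \<in> U \<and> A \<union> B \<in> U"
    using X Y Z b(17-19) subspace_sym_diff[OF subspace_U, of X Y] subspace_sym_diff[OF subspace_U, of X "A \<union> B"]
      subspace_sym_diff[OF subspace_U, of Y "A \<union> B"] unfolding sums by blast
  then show "pair_unions A B C \<subseteq> U" using XY subspace_zero[OF subspace_U] by (auto simp: pair_unions_def)
qed

lemma U_tripartite: "balanced F A B C \<Longrightarrow> H = tripartite A B C \<Longrightarrow> U = pair_unions A B C"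
  by (rule image_of_block_rows[OF _ row_tripartite]) auto

lemma U_two_cliques: "balanced F A B C \<Longrightarrow> H = two_cliques A B C \<Longrightarrow> U = pair_unions A B C"
  by (rule image_of_block_rows[OF _ row_two_cliques]) auto

lemma rank_two_balanced:
  assumes U: "card U = 4"
  shows "\<exists>A B C. balanced F A B C \<and> (H = tripartite A B C \<or> H = two_cliques A B C)"
proof -
  obtain A B C where "A \<subseteq> F \<and> B \<subseteq> F \<and> C \<subseteq> F \<and> disjoint3 A B C \<and> U = pair_unions A B C \<and>
      (H = tripartite A B C \<or> H = two_cliques A B C)"
    using rank_two[OF U] by (elim exE)
  then have ABC: "A \<union> B \<union> C \<subseteq> F" "disjoint3 A B C" "U = pair_unions A B C" "H = tripartite A B C \<or> H = two_cliques A B C"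
    by simp_all
  have "A \<union> B \<in> U" "A \<union> C \<in> U" "B \<union> C \<in> U" unfolding ABC(3) by (simp_all add: pair_unions_def)
  then have "even (card (A \<union> B))" "even (card (A \<union> C))" "even (card (B \<union> C))" using even_card_U by simp_all
  moreover have "A \<union> B \<noteq> {} \<and> A \<union> C \<noteq> {} \<and> B \<union> C \<noteq> {}"
  proof (rule ccontr)
    assume "\<not> ?thesis"
    then have "pair_unions A B C \<subseteq> {{}, A \<union> B \<union> C}" by (auto simp: pair_unions_def)
    then have "card (pair_unions A B C) \<le> card {{}, A \<union> B \<union> C}" by (intro card_mono) auto
    also have "\<dots> \<le> 2" by (simp add: card_insert_if)
    finally show False using U ABC(3) by simp
  qed
  ultimately have "balanced F A B C" using ABC(1,2) fin by (simp add: balanced_def)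
  then show ?thesis using ABC(4) by blast
qed

end

section \<open>Strong embeddings on the projective plane, the torus and the Klein bottle\<close>

lemma Union_tripartite:
  assumes "A \<noteq> {}" "B \<noteq> {}" shows "\<Union>(tripartite A B C) = A \<union> B \<union> C"
  using assms
  by (auto simp: tripartite_def)

lemma Union_two_cliques:
  assumes "2 \<le> card A" "2 \<le> card B"
  shows "\<Union>(two_cliques A B C) = A \<union> B \<union> C"
proof
  show "\<Union>(two_cliques A B C) \<subseteq> A \<union> B \<union> C" by (auto simp: two_cliques_def)
  have other: "\<exists>y\<in>X. y \<noteq> x" if "2 \<le> card X" for X :: "'a set" and x
  proof (rule ccontr)
    assume "\<not> ?thesis"
    then have "X \<subseteq> {x}" by auto
    then have "card X \<le> card {x}" by (intro card_mono) auto
    then show False using that by simp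
  qed
  have "A \<noteq> {}" using assms by auto
  show "A \<union> B \<union> C \<subseteq> \<Union>(two_cliques A B C)"
  proof
    fix x assume x: "x \<in> A \<union> B \<union> C"
    obtain y z where yz: "y \<in> A" "y \<noteq> x" "z \<in> B" "z \<noteq> x" using other assms by metis
    have "{x, y} \<in> two_cliques A B C \<or> {x, z} \<in> two_cliques A B C"
      using x yz by (auto simp: doubleton_in_two_cliques)
    then show "x \<in> \<Union>(two_cliques A B C)" by blast
  qed
qed

lemma Union_clique:
  assumes "2 \<le> card X" shows "\<Union>{d. d \<subseteq> X \<and> card d = 2} = X"
proof (intro subset_antisym subsetI)
  fix x assume x: "x \<in> X"
  have "\<not> X \<subseteq> {x}"
  proof
    assume "X \<subseteq> {x}"
    then have "card X \<le> card {x}" by (intro card_mono) auto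
    then show False using assms by simp
  qed
  then obtain y where "y \<in> X" "y \<noteq> x" by auto
  then have "{x, y} \<in> {d. d \<subseteq> X \<and> card d = 2}" using x by simp
  then show "x \<in> \<Union>{d. d \<subseteq> X \<and> card d = 2}" by blast
qed auto

text \<open>
  Shapes of edge sets, without reference to a vertex set. The sets \<open>A, B, C\<close> are required to be
  finite because the cardinality \<open>0\<close> is meant to exclude infinite blocks.
\<close>

definition block_edges :: "('b set \<Rightarrow> 'b set \<Rightarrow> 'b set \<Rightarrow> 'b set set) \<Rightarrow> nat \<Rightarrow> nat \<Rightarrow> nat \<Rightarrow>
    ('b set \<Rightarrow> 'b set \<Rightarrow> bool) \<Rightarrow> 'b set set \<Rightarrow> bool" where
  "block_edges E a b c Q H \<longleftrightarrow> (\<exists>A B C. disjoint3 A B C \<and> finite A \<and> finite B \<and> finite C \<and>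
     card A = a \<and> card B = b \<and> card C = c \<and> H = E A B C \<and> Q A B)"

definition projective_shape :: "'b set set \<Rightarrow> bool" where
  "projective_shape H \<longleftrightarrow> block_edges (\<lambda>A B C. {d. d \<subseteq> A \<and> card d = 2}) 4 0 0 (\<lambda>A B. True) H"

definition nonadjacent_shape :: "'b graph \<Rightarrow> nat \<Rightarrow> 'b set set \<Rightarrow> bool" where
  "nonadjacent_shape D n H \<longleftrightarrow>
     block_edges tripartite 2 n 0 (\<lambda>A B. A \<notin> edges D \<and> (n = 2 \<longrightarrow> B \<notin> edges D)) H"

definition torus_shape :: "'b graph \<Rightarrow> 'b set set \<Rightarrow> bool" where
  "torus_shape D H \<longleftrightarrow> block_edges tripartite 2 2 2 (\<lambda>A B. True) H \<or> (\<exists>m\<ge>1. nonadjacent_shape D (2 * m) H)"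

definition klein_shape :: "'b graph \<Rightarrow> 'b set set \<Rightarrow> bool" where
  "klein_shape D H \<longleftrightarrow> block_edges two_cliques 4 4 0 (\<lambda>A B. True) H \<or>
     block_edges two_cliques 3 3 1 (\<lambda>A B. True) H \<or> block_edges two_cliques 2 2 2 (\<lambda>A B. True) H \<or>
     (\<exists>m\<ge>2. nonadjacent_shape D (2 * m - 1) H)"

lemma block_edgesE:
  assumes "block_edges E a b c Q H"
  obtains A B C where "disjoint3 A B C" "finite A" "finite B" "finite C" "card A = a" "card B = b" "card C = c"
    "H = E A B C" "Q A B"
  using assms unfolding block_edges_def by (elim exE conjE) (rule that)

lemma block_edgesI:
  assumes "balanced F A B C" "card A = a" "card B = b" "card C = c" "H = E A B C" "Q A B"
  shows "block_edges E a b c Q H"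
  unfolding block_edges_def using balancedD(4,8-10)[OF assms(1)] assms(2-)
  by (intro exI[of _ A] exI[of _ B] exI[of _ C]) simp

lemma card_disjoint3:
  assumes "finite A" "finite B" "finite C" "disjoint3 A B C"
  shows "card (A \<union> B) = card A + card B" "card (A \<union> C) = card A + card C" "card (B \<union> C) = card B + card C"
  using assms by (simp_all add: disjoint3_def card_Un_disjoint)

context plane_cubic
begin

lemma edge_set_sides: "T \<subseteq> edges G \<Longrightarrow> edge_set F (sides ` T)"
  using card_sides sides_subset finite_faces by (auto simp: edge_set_def)

lemma orientable_twist_rows:
  assumes T: "T \<subseteq> edges G"
  shows "orientable G (twist T P) \<longleftrightarrow> (\<forall>f\<in>F. f \<notin> laplacian F (sides ` T) {f})"
  unfolding orientable_twist_iff[OF T] using edge_set.self_row_iff[OF edge_set_sides[OF T]] by simp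

lemma sides_image_subset: "T \<subseteq> edges G \<Longrightarrow> sides ` T \<subseteq> edges D"
  by (auto simp: edges_dual)

lemma Union_sides_subset: "\<Union>(sides ` T) \<subseteq> F"
  using sides_subset by blast

lemma projective_plane_iff:
  assumes T: "T \<subseteq> edges G"
  shows "embedding_on G Projective_Plane (twist T P) \<and> strong G (twist T P) \<longleftrightarrow> projective_shape (sides ` T)"
proof -
  let ?H = "sides ` T"
  interpret H: edge_set F ?H by (rule edge_set_sides[OF T])
  have HD: "?H \<subseteq> edges D" by (rule sides_image_subset[OF T])
  have emb_iff: "embedding_on G Projective_Plane (twist T P) \<longleftrightarrow>
      (\<exists>f\<in>F. f \<in> H.row f) \<and> card H.U = 2"
    using euler_char_twist[OF T, of 1] embedding_scheme_twist[OF emb T] orientable_twist_rows[OF T]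
    by (auto simp: embedding_on_def)
  show ?thesis
  proof
    assume "embedding_on G Projective_Plane (twist T P) \<and> strong G (twist T P)"
    then have U: "card H.U = 2" and str: "edges D \<inter> H.U = {}"
      using emb_iff strong_twist[OF T] by auto
    obtain X where X: "X \<in> H.U" "X \<noteq> {}" "?H = {d. d \<subseteq> X \<and> card d = 2}" using H.rank_one[OF U] by blast
    have XF: "X \<subseteq> F" using subsetD[OF laplacian_image_subset X(1)] by simp
    then have finX: "finite X" using finite_faces finite_subset by blast
    have "card X \<le> 4" by (rule card_clique_le_4[OF _ finX]) (use X HD in auto)
    moreover have "card X \<noteq> 2"
    proof
      assume "card X = 2"
      then have "X \<in> edges D" using X(3) HD by auto
      then show False using str X by auto
    qed
    moreover have "card X \<noteq> 0" "even (card X)" using X finX H.even_card_U by auto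
    ultimately have "card X = 4" by presburger
    then show "projective_shape ?H"
      unfolding projective_shape_def block_edges_def using X(3) finX
      by (intro exI[of _ X] exI[of _ "{}"]) (simp add: disjoint3_def)
  next
    assume "projective_shape ?H"
    then obtain X where X: "card X = 4" "?H = {d. d \<subseteq> X \<and> card d = 2}"
      unfolding projective_shape_def block_edges_def by blast
    have "X = \<Union>?H" unfolding X(2) by (rule Union_clique[symmetric]) (simp add: X(1))
    then have XF: "X \<subseteq> F" using Union_sides_subset by simp
    have ne: "X \<noteq> {}" using X by auto
    then obtain f where f: "f \<in> X" by auto
    have U: "H.U = {{}, X}" by (rule H.rank_one_converse[OF XF ne _ X(2)]) (simp add: X)
    have "H.row f = X" by (rule H.row_clique[OF XF _ X(2) f]) (simp add: X)
    then have "\<exists>f\<in>F. f \<in> H.row f" using f XF by auto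
    moreover have "card H.U = 2" unfolding U using ne[symmetric] by simp
    moreover have "edges D \<inter> H.U = {}" unfolding U using card_edge_dual X(1) by fastforce
    ultimately show "embedding_on G Projective_Plane (twist T P) \<and> strong G (twist T P)"
      using emb_iff strong_twist[OF T] by simp
  qed
qed

text \<open>
  If \<open>X\<close> had three vertices, \<open>Y \<union> Z\<close> would have at most two and be an edge between \<open>Y\<close> and \<open>Z\<close>.
\<close>

lemma card_le_2_of_complete_to_union:
  assumes fin: "finite X" "finite Y" "finite Z" and disj: "disjoint3 X Y Z" and ne: "Y \<noteq> {}" "Z \<noteq> {}"
    and comp: "\<And>x y. x \<in> X \<Longrightarrow> y \<in> Y \<union> Z \<Longrightarrow> {x, y} \<in> edges D"
    and YZ: "\<And>y z. y \<in> Y \<Longrightarrow> z \<in> Z \<Longrightarrow> {y, z} \<in> edges D" and not_edge: "Y \<union> Z \<notin> edges D"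
  shows "card X \<le> 2"
proof (rule ccontr)
  assume "\<not> ?thesis"
  then have "card (Y \<union> Z) \<le> 2" using card_bipartite_le_2[of X "Y \<union> Z"] comp fin by auto
  moreover have "card (Y \<union> Z) = card Y + card Z" "card Y \<noteq> 0" "card Z \<noteq> 0"
    using card_disjoint3[OF fin disj] fin ne by auto
  ultimately have "card Y = 1" "card Z = 1" by linarith+
  then obtain y z where "Y = {y}" "Z = {z}" by (meson card_1_singletonE)
  then show False using YZ[of y z] not_edge by (simp add: insert_commute)
qed

lemma tripartite_swap: "tripartite A B C = tripartite B A C" "tripartite A {} C = tripartite A C {}"
    "tripartite {} B C = tripartite B C {}"
  unfolding tripartite_def by (auto simp: insert_commute)

lemma torus_shape_of_bipartite:
  assumes bal: "balanced F X Y {}" and H: "H = tripartite X Y {}" "H \<subseteq> edges D"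
    and not_edge: "X \<notin> edges D" "Y \<notin> edges D"
  shows "torus_shape D H"
proof -
  have shape: "torus_shape D H"
    if b: "balanced F X Y {}" and H: "H = tripartite X Y {}" and ne: "X \<notin> edges D" "Y \<notin> edges D"
      and X2: "card X = 2" for X Y
  proof -
    obtain m where m: "card Y = 2 * m" using balancedD(13)[OF b] by (auto elim: evenE)
    moreover have "card Y \<noteq> 0" using balancedD(9,19)[OF b] by simp
    ultimately have "nonadjacent_shape D (2 * m) H" "m \<ge> 1"
      unfolding nonadjacent_shape_def using ne H X2 by (auto intro!: block_edgesI[OF b])
    then show ?thesis unfolding torus_shape_def by blast
  qed
  note b = balancedD[OF bal]
  have comp: "{x, y} \<in> edges D" if "x \<in> X" "y \<in> Y" for x y
    using H that by (auto simp: doubleton_in_tripartite)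
  have "card X \<noteq> 0" "card Y \<noteq> 0" "even (card X)" "even (card Y)" using b(8,9,12,13,18,19) by simp_all
  moreover have "card X \<le> 2 \<or> card Y \<le> 2" by (rule card_bipartite_le_2[OF comp b(8,9)])
  ultimately have "card X = 2 \<or> card Y = 2" by presburger
  then show ?thesis
  proof
    assume "card X = 2"
    then show ?thesis by (rule shape[OF bal H(1) not_edge])
  next
    have "balanced F Y X {}" using bal by (simp add: balanced_def disjoint3_def Un_commute Int_commute)
    moreover have "H = tripartite Y X {}" using H(1) tripartite_swap(1)[of X Y "{}"] by simp
    moreover assume "card Y = 2"
    ultimately show ?thesis using not_edge by (intro shape)
  qed
qed

text \<open>
  If one block is empty, the graph is complete bipartite with even sides, one of which has two
  vertices. Otherwise no block has more than two vertices, and blocks of one vertex are excluded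
  since the union of two of them would be an edge.
\<close>

lemma torus_shape_of_tripartite:
  assumes bal: "balanced F A B C" and H: "H = tripartite A B C" "H \<subseteq> edges D"
    and not_edge: "A \<union> B \<notin> edges D" "A \<union> C \<notin> edges D" "B \<union> C \<notin> edges D"
  shows "torus_shape D H"
proof -
  note b = balancedD[OF bal]
  consider "C = {}" | "B = {}" | "A = {}" | "A \<noteq> {}" "B \<noteq> {}" "C \<noteq> {}" by blast
  then show ?thesis
  proof cases
    case 1
    show ?thesis
      by (rule torus_shape_of_bipartite[of A B]) (use 1 bal H not_edge in simp_all)
  next
    case 2
    show ?thesis
      by (rule torus_shape_of_bipartite[of A C])
        (use 2 bal H not_edge tripartite_swap(2)[of A C] in \<open>simp_all add: balanced_def disjoint3_def\<close>)
  next
    case 3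
    show ?thesis
      by (rule torus_shape_of_bipartite[of B C])
        (use 3 bal H not_edge tripartite_swap(3)[of B C] in \<open>simp_all add: balanced_def disjoint3_def\<close>)
  next
    case 4
    have comp: "{x, y} \<in> edges D" if "x \<in> A \<and> y \<in> B \<or> x \<in> A \<and> y \<in> C \<or> x \<in> B \<and> y \<in> C \<or>
        y \<in> A \<and> x \<in> B \<or> y \<in> A \<and> x \<in> C \<or> y \<in> B \<and> x \<in> C" for x y
      using H that by (auto simp: doubleton_in_tripartite)
    have perm: "disjoint3 B A C" "disjoint3 C A B" using b(4) by (auto simp: disjoint3_def)
    have "card A \<le> 2"
      by (rule card_le_2_of_complete_to_union[OF b(8-10,4) 4(2,3)]) (use comp not_edge in auto)
    moreover have "card B \<le> 2"
      by (rule card_le_2_of_complete_to_union[OF b(9,8,10) perm(1) 4(1,3)]) (use comp not_edge in auto)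
    moreover have "card C \<le> 2"
      by (rule card_le_2_of_complete_to_union[OF b(10,8,9) perm(2) 4(1,2)]) (use comp not_edge in auto)
    moreover have "card A \<noteq> 0" "card B \<noteq> 0" "card C \<noteq> 0" using b(8-10) 4 by auto
    moreover have "card A \<noteq> 1 \<or> card B \<noteq> 1"
    proof (rule ccontr)
      assume "\<not> ?thesis"
      then obtain a b where "A = {a}" "B = {b}" by (meson card_1_singletonE)
      then show False using comp[of a b] not_edge by (simp add: insert_commute)
    qed
    ultimately have "card A = 2" "card B = 2" "card C = 2" using b(11-13) unfolding b(14-16) by presburger+
    then have "block_edges tripartite 2 2 2 (\<lambda>A B. True) H" using H(1) by (intro block_edgesI[OF bal]) simp_all
    then show ?thesis unfolding torus_shape_def by blast
  qed
qed

lemma small_parity: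
  fixes n :: nat
  shows "even n \<Longrightarrow> n \<le> 4 \<Longrightarrow> n \<noteq> 0 \<Longrightarrow> n \<noteq> 2 \<Longrightarrow> n = 4" "odd n \<Longrightarrow> n \<le> 3 \<Longrightarrow> n \<noteq> 1 \<Longrightarrow> n = 3"
    "even n \<Longrightarrow> n \<le> 3 \<Longrightarrow> n = 2 \<or> n = 0"
  by presburger+

text \<open>
  The size of \<open>C\<close> decides. A vertex of \<open>C\<close> extends \<open>A\<close> and \<open>B\<close> to larger cliques, so these have at most
  four vertices if \<open>C\<close> is empty and at most three otherwise; if \<open>C\<close> has three vertices or more,
  \<open>A \<union> B\<close> has at most two. Parity and the condition that no union of two blocks is an edge leave
  \<open>(4, 4, 0)\<close>, \<open>(3, 3, 1)\<close>, \<open>(2, 2, 2)\<close> and \<open>(1, 1, 2 m - 1)\<close> with \<open>m \<ge> 2\<close>.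
\<close>

lemma klein_shape_of_two_cliques:
  assumes bal: "balanced F A B C" and H: "H = two_cliques A B C" "H \<subseteq> edges D"
    and not_edge: "A \<union> B \<notin> edges D" "A \<union> C \<notin> edges D" "B \<union> C \<notin> edges D"
  shows "klein_shape D H"
proof -
  note disj = balancedD(4)[OF bal] and fin = balancedD(8-10)[OF bal] and even = balancedD(11-13)[OF bal]
    and cards = balancedD(14-16)[OF bal]
  have zero: "card A = 0 \<longleftrightarrow> A = {}" "card B = 0 \<longleftrightarrow> B = {}" "card C = 0 \<longleftrightarrow> C = {}" using fin by auto
  have clique: "d \<in> edges D" if "d \<subseteq> A \<or> d \<subseteq> B" "card d = 2" for d
  proof -
    obtain x y where "d = {x, y}" "x \<noteq> y" using \<open>card d = 2\<close> unfolding card_2_iff by blast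
    then have "d \<in> H" using that(1) unfolding H(1) by (auto simp: doubleton_in_two_cliques)
    then show ?thesis using H(2) by auto
  qed
  have comp: "{x, c} \<in> edges D" if "x \<in> A \<union> B" "c \<in> C" for x c
  proof -
    have "x \<noteq> c" using that disj by (auto simp: disjoint3_def)
    then have "{x, c} \<in> H" using that unfolding H(1) by (auto simp: doubleton_in_two_cliques)
    then show ?thesis using H(2) by auto
  qed
  have le4: "card A \<le> 4" "card B \<le> 4"
    by (rule card_clique_le_4; use clique fin in auto)+
  have le3: "card X \<le> 3" if X: "X = A \<or> X = B" and C: "C \<noteq> {}" for X
  proof -
    obtain c where c: "c \<in> C" using C by auto
    then have cX: "c \<notin> X" using X disj by (auto simp: disjoint3_def)
    have "card (insert c X) \<le> 4"
    proof (rule card_clique_le_4)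
      fix d assume d: "d \<subseteq> insert c X" "card d = 2"
      show "d \<in> edges D"
      proof (cases "c \<in> d")
        case True
        obtain x y where xy: "d = {x, y}" "x \<noteq> y" using d(2) unfolding card_2_iff by blast
        then have "x = c \<and> y \<in> A \<union> B \<or> y = c \<and> x \<in> A \<union> B" using d(1) True X by auto
        then show ?thesis using comp[of x c] comp[of y c] c xy by (auto simp: insert_commute)
      next
        case False
        then have "d \<subseteq> A \<or> d \<subseteq> B" using d X by auto
        then show ?thesis using clique d(2) by simp
      qed
    qed (use X fin in auto)
    moreover have "finite X" using X fin by auto
    ultimately show ?thesis using cX by simp
  qed
  have bip: "card (A \<union> B) \<le> 2 \<or> card C \<le> 2"
    by (rule card_bipartite_le_2[OF comp]) (use fin in auto)
  have A2: "card A \<noteq> 2" if "B = {} \<or> C = {}" using that clique[of A] not_edge by auto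
  have B2: "card B \<noteq> 2" if "A = {} \<or> C = {}" using that clique[of B] not_edge by auto
  have one: "card X \<noteq> 1 \<or> card C \<noteq> 1" if "X = A \<or> X = B" for X
  proof (rule ccontr)
    assume "\<not> ?thesis"
    then obtain x c where "X = {x}" "C = {c}" by (meson card_1_singletonE)
    then show False using comp[of x c] not_edge that by (auto simp: insert_commute)
  qed
  note one_A = one[of A, simplified] and one_B = one[of B, simplified]
  have ne_card: "card A \<noteq> 0 \<or> card B \<noteq> 0" "card A \<noteq> 0 \<or> card C \<noteq> 0" "card B \<noteq> 0 \<or> card C \<noteq> 0"
    using balancedD(17-19)[OF bal] zero by simp_all
  consider "card C = 0" | "card C = 1" | "card C = 2" | "3 \<le> card C" by linarith
  then show ?thesis
  proof cases
    case 1
    then have "C = {}" using zero by simp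
    moreover have "even (card A)" "even (card B)" using even 1 unfolding cards by simp_all
    then have "card A = 4" "card B = 4"
      using 1 A2 B2 \<open>C = {}\<close> le4 ne_card by (simp_all add: small_parity(1))
    ultimately have "block_edges two_cliques 4 4 0 (\<lambda>A B. True) H" using H(1) by (intro block_edgesI[OF bal]) simp_all
    then show ?thesis unfolding klein_shape_def by blast
  next
    case 2
    then have "C \<noteq> {}" by auto
    then have "card A \<le> 3" "card B \<le> 3" using le3 by auto
    moreover have "odd (card A)" "odd (card B)" using even 2 unfolding cards by simp_all
    ultimately have "card A = 3" "card B = 3" using 2 one_A one_B by (simp_all add: small_parity(2))
    then have "block_edges two_cliques 3 3 1 (\<lambda>A B. True) H" using 2 H(1) by (intro block_edgesI[OF bal]) simp_all
    then show ?thesis unfolding klein_shape_def by blast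
  next
    case 3
    then have "C \<noteq> {}" by auto
    then have "card A \<le> 3" "card B \<le> 3" using le3 by auto
    moreover have "even (card A)" "even (card B)" using even 3 unfolding cards by simp_all
    ultimately have "card A = 2 \<or> card A = 0" "card B = 2 \<or> card B = 0" by (simp_all add: small_parity(3))
    moreover have "\<not> (card A = 2 \<and> card B = 0)" "\<not> (card A = 0 \<and> card B = 2)" using A2 B2 zero by auto
    ultimately have "card A = 2" "card B = 2" using ne_card by auto
    then have "block_edges two_cliques 2 2 2 (\<lambda>A B. True) H" using 3 H(1) by (intro block_edgesI[OF bal]) simp_all
    then show ?thesis unfolding klein_shape_def by blast
  next
    case 4
    then have le: "card A + card B \<le> 2" using bip cards by simp
    moreover have "\<not> (card A = 2 \<and> card B = 0)" "\<not> (card A = 0 \<and> card B = 2)" using A2 B2 zero by auto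
    moreover have "even (card A + card B)" using even(1) unfolding cards .
    moreover have "card A \<noteq> 0 \<or> card B \<noteq> 0" using ne_card by auto
    ultimately have "card A = 1 \<and> card B = 1" by presburger
    then have 1: "card A = 1" "card B = 1" by auto
    then obtain a b where ab: "A = {a}" "B = {b}" by (meson card_1_singletonE)
    \<comment> \<open>Two single vertices joined to \<open>C\<close> form one side of a complete bipartite graph.\<close>
    have "H = tripartite (A \<union> B) C {}"
      unfolding H(1) ab two_cliques_def tripartite_def using disj ab by (auto simp: disjoint3_def)
    moreover have "disjoint3 (A \<union> B) C {}" "card (A \<union> B) = 2" using disj 1 cards by (auto simp: disjoint3_def)
    moreover have "odd (card C)" using 1 even cards by simp
    then obtain k where "card C = 2 * k + 1" by (auto elim: oddE)
    then have k: "2 \<le> k + 1" "card C = 2 * (k + 1) - 1" "2 * (k + 1) - 1 \<noteq> 2" using 4 by auto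
    ultimately have "nonadjacent_shape D (2 * (k + 1) - 1) H"
      unfolding nonadjacent_shape_def block_edges_def using not_edge(1) fin k(2,3)
      by (intro exI[of _ "A \<union> B"] exI[of _ C] exI[of _ "{}"]) simp
    then show ?thesis unfolding klein_shape_def using k(1) by blast
  qed
qed

lemma orientable_tripartite:
  assumes T: "T \<subseteq> edges G" and bal: "balanced F A B C" and H: "sides ` T = tripartite A B C"
  shows "orientable G (twist T P)"
  unfolding orientable_twist_rows[OF T]
proof
  fix f assume f: "f \<in> F"
  interpret H: edge_set F "sides ` T" by (rule edge_set_sides[OF T])
  show "f \<notin> H.row f"
    unfolding H.row_tripartite[OF bal H f] using balancedD(5-7)[OF bal] by auto
qed

lemma not_orientable_two_cliques:
  assumes T: "T \<subseteq> edges G" and bal: "balanced F A B C" and H: "sides ` T = two_cliques A B C"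
  shows "\<not> orientable G (twist T P)"
proof -
  interpret H: edge_set F "sides ` T" by (rule edge_set_sides[OF T])
  obtain f where f: "f \<in> A \<union> B" using balancedD(17)[OF bal] by auto
  then have fF: "f \<in> F" using balancedD(1,2)[OF bal] by auto
  have "f \<in> H.row f"
    unfolding H.row_two_cliques[OF bal H fF] using f by auto
  then show ?thesis unfolding orientable_twist_rows[OF T] using fF by blast
qed

text \<open>
  Common to torus and Klein bottle, which are told apart by the diagonal of the Laplacian.
\<close>

lemma strong_rank_two_iff:
  assumes T: "T \<subseteq> edges G"
  shows "euler_char G (twist T P) = 0 \<and> strong G (twist T P) \<longleftrightarrow>
    (\<exists>A B C. balanced F A B C \<and> (sides ` T = tripartite A B C \<or> sides ` T = two_cliques A B C) \<and>
      A \<union> B \<notin> edges D \<and> A \<union> C \<notin> edges D \<and> B \<union> C \<notin> edges D)"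
proof -
  interpret H: edge_set F "sides ` T" by (rule edge_set_sides[OF T])
  have euler: "euler_char G (twist T P) = 0 \<longleftrightarrow> card H.U = 4" using euler_char_twist[OF T, of 2] by simp
  have "{} \<notin> edges D" using card_edge_dual by fastforce
  then have str: "strong G (twist T P) \<longleftrightarrow> A \<union> B \<notin> edges D \<and> A \<union> C \<notin> edges D \<and> B \<union> C \<notin> edges D"
    and four: "card H.U = 4"
    if bal: "balanced F A B C" and "sides ` T = tripartite A B C \<or> sides ` T = two_cliques A B C" for A B C
  proof -
    have U: "H.U = pair_unions A B C" using H.U_tripartite[OF bal] H.U_two_cliques[OF bal] that(2) by blast
    show "card H.U = 4" unfolding U by (rule card_pair_unions[OF bal])
    show "strong G (twist T P) \<longleftrightarrow> A \<union> B \<notin> edges D \<and> A \<union> C \<notin> edges D \<and> B \<union> C \<notin> edges D"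
      unfolding strong_twist[OF T] U pair_unions_def using \<open>{} \<notin> edges D\<close> by blast
  qed
  show ?thesis
  proof
    assume l: "euler_char G (twist T P) = 0 \<and> strong G (twist T P)"
    then obtain A B C where ABC: "balanced F A B C" "sides ` T = tripartite A B C \<or> sides ` T = two_cliques A B C"
      using H.rank_two_balanced euler by (elim exE conjE) blast
    then show "\<exists>A B C. balanced F A B C \<and> (sides ` T = tripartite A B C \<or> sides ` T = two_cliques A B C) \<and>
        A \<union> B \<notin> edges D \<and> A \<union> C \<notin> edges D \<and> B \<union> C \<notin> edges D"
      using str[OF ABC] l by (intro exI[of _ A] exI[of _ B] exI[of _ C]) simp
  next
    assume "\<exists>A B C. balanced F A B C \<and> (sides ` T = tripartite A B C \<or> sides ` T = two_cliques A B C) \<and>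
        A \<union> B \<notin> edges D \<and> A \<union> C \<notin> edges D \<and> B \<union> C \<notin> edges D"
    then obtain A B C where ABC: "balanced F A B C" "sides ` T = tripartite A B C \<or> sides ` T = two_cliques A B C"
      and ne: "A \<union> B \<notin> edges D \<and> A \<union> C \<notin> edges D \<and> B \<union> C \<notin> edges D"
      by (elim exE conjE) simp
    then show "euler_char G (twist T P) = 0 \<and> strong G (twist T P)"
      using str[OF ABC] four[OF ABC] euler by simp
  qed
qed

lemma torus_iff:
  assumes T: "T \<subseteq> edges G"
  shows "embedding_on G Torus (twist T P) \<and> strong G (twist T P) \<longleftrightarrow> torus_shape D (sides ` T)"
proof -
  have emb_iff: "embedding_on G Torus (twist T P) \<longleftrightarrow> orientable G (twist T P) \<and> euler_char G (twist T P) = 0"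
    using embedding_scheme_twist[OF emb T] by (simp add: embedding_on_def)
  note HD = sides_image_subset[OF T]
  show ?thesis
  proof
    assume e: "embedding_on G Torus (twist T P) \<and> strong G (twist T P)"
    then obtain A B C where ABC: "balanced F A B C" "sides ` T = tripartite A B C \<or> sides ` T = two_cliques A B C"
      "A \<union> B \<notin> edges D" "A \<union> C \<notin> edges D" "B \<union> C \<notin> edges D"
      using emb_iff strong_rank_two_iff[OF T] by blast
    then have "sides ` T = tripartite A B C" using not_orientable_two_cliques[OF T ABC(1)] e emb_iff by blast
    then show "torus_shape D (sides ` T)" by (rule torus_shape_of_tripartite[OF ABC(1) _ HD ABC(3-5)])
  next
    assume "torus_shape D (sides ` T)"
    then obtain A B C where ABC: "disjoint3 A B C" "finite A" "finite B" "finite C" "sides ` T = tripartite A B C" "card A = 2"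
      "card B = 2 \<and> card C = 2 \<or>
        C = {} \<and> A \<notin> edges D \<and> even (card B) \<and> card B \<noteq> 0 \<and> (card B = 2 \<longrightarrow> B \<notin> edges D)"
      unfolding torus_shape_def nonadjacent_shape_def block_edges_def by fastforce
    have ne: "A \<noteq> {}" "B \<noteq> {}" using ABC(6,7) by auto
    note cards = card_disjoint3[OF ABC(2-4,1)]
    have "\<Union>(tripartite A B C) = A \<union> B \<union> C" by (rule Union_tripartite[OF ne])
    then have "A \<union> B \<union> C \<subseteq> F" using Union_sides_subset[of T] unfolding ABC(5) by simp
    then have bal: "balanced F A B C"
      unfolding balanced_def cards using ABC(1,6,7) ne finite_faces by auto
    have "X \<notin> edges D" if "X = A \<union> B \<or> X = A \<union> C \<or> X = B \<union> C" for X
    proof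
      assume X: "X \<in> edges D"
      then have "card X = 2" by (rule card_edge_dual)
      moreover have "card (A \<union> B) \<noteq> 2" "C \<noteq> {} \<Longrightarrow> card (A \<union> C) \<noteq> 2 \<and> card (B \<union> C) \<noteq> 2"
        unfolding cards using ABC(6,7) by auto
      ultimately have "C = {}" "X = A \<or> X = B" using that by auto
      then show False using ABC(6,7) X \<open>card X = 2\<close> by auto
    qed
    then show "embedding_on G Torus (twist T P) \<and> strong G (twist T P)"
      using emb_iff strong_rank_two_iff[OF T] orientable_tripartite[OF T bal ABC(5)] bal ABC(5) by blast
  qed
qed

lemma klein_iff:
  assumes T: "T \<subseteq> edges G"
  shows "embedding_on G Klein_Bottle (twist T P) \<and> strong G (twist T P) \<longleftrightarrow> klein_shape D (sides ` T)"
proof -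
  have emb_iff: "embedding_on G Klein_Bottle (twist T P) \<longleftrightarrow>
      \<not> orientable G (twist T P) \<and> euler_char G (twist T P) = 0"
    using embedding_scheme_twist[OF emb T] by (simp add: embedding_on_def)
  note HD = sides_image_subset[OF T]
  show ?thesis
  proof
    assume e: "embedding_on G Klein_Bottle (twist T P) \<and> strong G (twist T P)"
    then obtain A B C where ABC: "balanced F A B C" "sides ` T = tripartite A B C \<or> sides ` T = two_cliques A B C"
      "A \<union> B \<notin> edges D" "A \<union> C \<notin> edges D" "B \<union> C \<notin> edges D"
      using emb_iff strong_rank_two_iff[OF T] by blast
    then have "sides ` T = two_cliques A B C" using orientable_tripartite[OF T ABC(1)] e emb_iff by blast
    then show "klein_shape D (sides ` T)" by (rule klein_shape_of_two_cliques[OF ABC(1) _ HD ABC(3-5)])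
  next
    assume shape: "klein_shape D (sides ` T)"
    have "\<exists>A B C. disjoint3 A B C \<and> finite A \<and> finite B \<and> finite C \<and> \<Union>(sides ` T) = A \<union> B \<union> C \<and>
        sides ` T = two_cliques A B C \<and>
        (card A = 4 \<and> card B = 4 \<and> card C = 0 \<or> card A = 3 \<and> card B = 3 \<and> card C = 1 \<or>
         card A = 2 \<and> card B = 2 \<and> card C = 2 \<or>
         card A = 1 \<and> card B = 1 \<and> A \<union> B \<notin> edges D \<and> odd (card C) \<and> 3 \<le> card C)"
    proof (cases "\<exists>m\<ge>2. nonadjacent_shape D (2 * m - 1) (sides ` T)")
      case True
      then obtain m A B C where c: "2 \<le> m" "disjoint3 A B C" "finite A" "finite B" "finite C" "card A = 2"
        "card B = 2 * m - 1" "card C = 0" "sides ` T = tripartite A B C" "A \<notin> edges D"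
        unfolding nonadjacent_shape_def by (elim exE conjE block_edgesE) (rule that; simp)
      have C: "C = {}" using c(5,8) by simp
      obtain a b where ab: "A = {a, b}" "a \<noteq> b" using c(6) unfolding card_2_iff by blast
      have "A \<noteq> {}" "B \<noteq> {}" using c by auto
      then have "\<Union>(tripartite A B C) = A \<union> B \<union> C" by (rule Union_tripartite)
      then have Un: "\<Union>(sides ` T) = {a} \<union> {b} \<union> B" unfolding c(9) ab C by (simp add: insert_commute)
      have H: "sides ` T = two_cliques {a} {b} B"
        unfolding c(9) ab C two_cliques_def tripartite_def using c(2) ab by (auto simp: disjoint3_def)
      have disj: "disjoint3 {a} {b} B" using c(2) ab by (auto simp: disjoint3_def)
      have B: "odd (card B)" "3 \<le> card B" using c(1,7) by auto
      have not_edge: "{a} \<union> {b} \<notin> edges D" using c(10) ab by (simp add: insert_commute)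
      show ?thesis
        by (rule exI[of _ "{a}"], rule exI[of _ "{b}"], rule exI[of _ B])
          (intro conjI disjI2 disj Un H B not_edge c(4); simp)
    next
      case False
      then have "block_edges two_cliques 4 4 0 (\<lambda>A B. True) (sides ` T) \<or>
          block_edges two_cliques 3 3 1 (\<lambda>A B. True) (sides ` T) \<or>
          block_edges two_cliques 2 2 2 (\<lambda>A B. True) (sides ` T)"
        using shape unfolding klein_shape_def by (simp only: simp_thms)
      then have "\<exists>(n, k)\<in>{(4, 0), (3, 1), (2, 2)}. block_edges two_cliques n n k (\<lambda>A B. True) (sides ` T)"
        by simp
      then obtain n k where nk: "n = 4 \<and> k = 0 \<or> n = 3 \<and> k = 1 \<or> n = 2 \<and> k = 2"
        and b: "block_edges two_cliques n n k (\<lambda>A B. True) (sides ` T)" by force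
      from b obtain A B C where c: "disjoint3 A B C" "finite A" "finite B" "finite C" "card A = n" "card B = n" "card C = k"
        "sides ` T = two_cliques A B C" by (rule block_edgesE)
      have Un: "\<Union>(sides ` T) = A \<union> B \<union> C"
        unfolding c(8) by (rule Union_two_cliques) (use c(5,6) nk in auto)
      show ?thesis
        by (rule exI[of _ A], rule exI[of _ B], rule exI[of _ C])
          (intro conjI c(1-4,8) Un, simp only: c(5-7), use nk in blast)
    qed
    then obtain A B C where ABC: "disjoint3 A B C" "finite A" "finite B" "finite C" "\<Union>(sides ` T) = A \<union> B \<union> C"
        "sides ` T = two_cliques A B C"
        "card A = 4 \<and> card B = 4 \<and> card C = 0 \<or> card A = 3 \<and> card B = 3 \<and> card C = 1 \<or>
         card A = 2 \<and> card B = 2 \<and> card C = 2 \<or>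
         card A = 1 \<and> card B = 1 \<and> A \<union> B \<notin> edges D \<and> odd (card C) \<and> 3 \<le> card C"
      by (elim exE conjE) (rule that)
    note cards = card_disjoint3[OF ABC(2-4,1)]
    have "A \<noteq> {}" "B \<noteq> {}" using ABC(7) by auto
    then have bal: "balanced F A B C"
      unfolding balanced_def cards using ABC(1,5,7) Union_sides_subset[of T] finite_faces by auto
    have "X \<notin> edges D" if X: "X = A \<union> B \<or> X = A \<union> C \<or> X = B \<union> C" for X
    proof
      assume XD: "X \<in> edges D"
      then have "card X = 2" by (rule card_edge_dual)
      then have "card A + card B = 2 \<and> X = A \<union> B \<or> card A + card C = 2 \<or> card B + card C = 2"
        using X cards by auto
      then have "X = A \<union> B \<and> A \<union> B \<notin> edges D" using ABC(7) by auto
      then show False using XD by simp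
    qed
    then show "embedding_on G Klein_Bottle (twist T P) \<and> strong G (twist T P)"
      using emb_iff strong_rank_two_iff[OF T] not_orientable_two_cliques[OF T bal ABC(6)] bal ABC(6) by blast
  qed
qed

end

section \<open>Recognising the subgraphs of the dual\<close>

lemma graph_iso_inverse:
  assumes iso: "graph_iso \<phi> H K" and H: "\<And>e. e \<in> edges H \<Longrightarrow> e \<subseteq> verts H"
  shows "graph_iso (inv_into (verts H) \<phi>) K H"
proof -
  have bij: "bij_betw \<phi> (verts H) (verts K)" and E: "edges K = (\<lambda>e. \<phi> ` e) ` edges H"
    using iso by (auto simp: graph_iso_def)
  have inj: "inj_on \<phi> (verts H)" using bij by (simp add: bij_betw_def)
  have "inv_into (verts H) \<phi> ` \<phi> ` e = e" if "e \<in> edges H" for e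
    by (rule inv_into_image_cancel[OF inj H[OF that]])
  then have "edges H = (\<lambda>e. inv_into (verts H) \<phi> ` e) ` edges K"
    unfolding E image_image by simp
  then show ?thesis using bij_betw_inv_into[OF bij] by (simp add: graph_iso_def)
qed

lemma isomorphic_iff:
  assumes H: "simple_graph H" and K: "\<And>e. e \<in> edges K \<Longrightarrow> e \<subseteq> verts K"
  shows "isomorphic H K \<longleftrightarrow> (\<exists>\<phi>. graph_iso \<phi> K H)"
proof
  assume "isomorphic H K"
  then obtain \<phi> where "graph_iso \<phi> H K" by (auto simp: isomorphic_def)
  from graph_iso_inverse[OF this] show "\<exists>\<phi>. graph_iso \<phi> K H"
    using H by (auto simp: simple_graph_def)
next
  assume "\<exists>\<phi>. graph_iso \<phi> K H"
  then obtain \<phi> where "graph_iso \<phi> K H" by auto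
  from graph_iso_inverse[OF this K] show "isomorphic H K" by (auto simp: isomorphic_def)
qed

lemma exists_block_bijection:
  assumes "finite A0" "finite B0" "finite C0" "disjoint3 A0 B0 C0"
    and "finite A" "finite B" "finite C" "disjoint3 A B C"
    and "card A = card A0" "card B = card B0" "card C = card C0"
  shows "\<exists>\<phi>. inj_on \<phi> (A0 \<union> B0 \<union> C0) \<and> \<phi> ` A0 = A \<and> \<phi> ` B0 = B \<and> \<phi> ` C0 = C"
proof -
  obtain f g h where f: "bij_betw f A0 A" and g: "bij_betw g B0 B" and h: "bij_betw h C0 C"
    using assms by (metis finite_same_card_bij)
  define \<phi> where "\<phi> x = (if x \<in> A0 then f x else if x \<in> B0 then g x else h x)" for x
  have d: "A0 \<inter> B0 = {}" "A0 \<inter> C0 = {}" "B0 \<inter> C0 = {}" "A \<inter> B = {}" "A \<inter> C = {}" "B \<inter> C = {}"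
    using assms by (simp_all add: disjoint3_def)
  have "\<phi> ` A0 = f ` A0" "\<phi> ` B0 = g ` B0" "\<phi> ` C0 = h ` C0"
    using d by (auto simp: \<phi>_def intro!: image_cong)
  then have im: "\<phi> ` A0 = A" "\<phi> ` B0 = B" "\<phi> ` C0 = C"
    using f g h by (simp_all add: bij_betw_def)
  have "inj_on \<phi> A0" "inj_on \<phi> B0" "inj_on \<phi> C0"
    using f g h d unfolding bij_betw_def
    by (auto simp: \<phi>_def inj_on_def disjoint_iff)
  then have "inj_on \<phi> (A0 \<union> B0 \<union> C0)"
    using im d by (simp add: inj_on_Un) blast
  then show ?thesis using im by blast
qed

text \<open>
  If a graph is built from three blocks in a way that commutes with relabelling, its isomorphic
  copies are the graphs built in the same way from blocks of the same sizes. The predicate \<open>Q\<close>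
  carries the condition on non-adjacent vertices.
\<close>

lemma graph_iso_blocks_iff:
  fixes K :: "'k graph" and H :: "'b graph"
  assumes verts: "verts K = A0 \<union> B0 \<union> C0" and disj0: "disjoint3 A0 B0 C0" and fin0: "finite (verts K)"
    and equiv: "\<And>\<phi> :: 'k \<Rightarrow> 'b. inj_on \<phi> (verts K) \<Longrightarrow> (\<lambda>e. \<phi> ` e) ` edges K = E (\<phi> ` A0) (\<phi> ` B0) (\<phi> ` C0)"
    and no_isolated: "\<And>A B C :: 'b set. finite B \<Longrightarrow> finite C \<Longrightarrow> card A = card A0 \<Longrightarrow> card B = card B0 \<Longrightarrow> card C = card C0 \<Longrightarrow>
      \<Union>(E A B C) = A \<union> B \<union> C"
  shows "(\<exists>\<phi>. graph_iso \<phi> K H \<and> Q (\<phi> ` A0) (\<phi> ` B0)) \<longleftrightarrow>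
    verts H = \<Union>(edges H) \<and> block_edges E (card A0) (card B0) (card C0) Q (edges H)"
proof
  assume "\<exists>\<phi>. graph_iso \<phi> K H \<and> Q (\<phi> ` A0) (\<phi> ` B0)"
  then obtain \<phi> where \<phi>: "graph_iso \<phi> K H" "Q (\<phi> ` A0) (\<phi> ` B0)" by auto
  then have inj: "inj_on \<phi> (verts K)" and VH: "verts H = \<phi> ` verts K" and EH: "edges H = (\<lambda>e. \<phi> ` e) ` edges K"
    by (auto simp: graph_iso_def bij_betw_def)
  have sub: "A0 \<subseteq> verts K" "B0 \<subseteq> verts K" "C0 \<subseteq> verts K" using verts by auto
  have E: "edges H = E (\<phi> ` A0) (\<phi> ` B0) (\<phi> ` C0)" unfolding EH by (rule equiv[OF inj])
  have "disjoint3 (\<phi> ` A0) (\<phi> ` B0) (\<phi> ` C0)"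
    using disj0 inj_on_image_Int[OF inj] sub unfolding disjoint3_def by (metis image_empty)
  moreover have cards: "card (\<phi> ` A0) = card A0" "card (\<phi> ` B0) = card B0" "card (\<phi> ` C0) = card C0"
    using inj sub by (meson card_image inj_on_subset)+
  moreover have fin: "finite (\<phi> ` A0)" "finite (\<phi> ` B0)" "finite (\<phi> ` C0)" using fin0 unfolding verts by simp_all
  ultimately have "block_edges E (card A0) (card B0) (card C0) Q (edges H)"
    unfolding block_edges_def using E \<phi>(2)
    by (intro exI[of _ "\<phi> ` A0"] exI[of _ "\<phi> ` B0"] exI[of _ "\<phi> ` C0"] conjI)
  moreover have "verts H = \<Union>(edges H)"
    unfolding VH verts E no_isolated[OF fin(2,3) cards] by (simp add: image_Un)
  ultimately show "verts H = \<Union>(edges H) \<and> block_edges E (card A0) (card B0) (card C0) Q (edges H)" by simp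
next
  assume a: "verts H = \<Union>(edges H) \<and> block_edges E (card A0) (card B0) (card C0) Q (edges H)"
  then have "block_edges E (card A0) (card B0) (card C0) Q (edges H)" ..
  then obtain A B C where ABC: "disjoint3 A B C" "finite A" "finite B" "finite C"
      "card A = card A0" "card B = card B0" "card C = card C0" "edges H = E A B C" "Q A B"
    by (rule block_edgesE)
  have fin: "finite A0" "finite B0" "finite C0" using fin0 unfolding verts by simp_all
  obtain \<phi> where \<phi>: "inj_on \<phi> (A0 \<union> B0 \<union> C0)" "\<phi> ` A0 = A" "\<phi> ` B0 = B" "\<phi> ` C0 = C"
    using exists_block_bijection[OF fin disj0 ABC(2-4,1,5-7)] by blast
  have "inj_on \<phi> (verts K)" using \<phi>(1) verts by simp
  moreover from equiv[OF this] have "edges H = (\<lambda>e. \<phi> ` e) ` edges K" using ABC(8) \<phi> by simp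
  moreover have "verts H = A \<union> B \<union> C" using a ABC(8) no_isolated[OF ABC(3-7)] by simp
  then have "verts H = \<phi> ` verts K" unfolding verts using \<phi> by (simp add: image_Un)
  ultimately have "graph_iso \<phi> K H" by (simp add: graph_iso_def bij_betw_def)
  then show "\<exists>\<phi>. graph_iso \<phi> K H \<and> Q (\<phi> ` A0) (\<phi> ` B0)" using ABC(9) \<phi> by blast
qed

lemmas isomorphic_blocks_iff = graph_iso_blocks_iff[where Q = "\<lambda>A B. True", simplified simp_thms]

lemma image_tripartite: "(\<lambda>e. \<phi> ` e) ` tripartite A B C = tripartite (\<phi> ` A) (\<phi> ` B) (\<phi> ` C)"
  by (simp add: tripartite_def image_Un image_UN)

lemma image_two_cliques:
  assumes inj: "inj_on \<phi> (A \<union> B \<union> C)"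
  shows "(\<lambda>e. \<phi> ` e) ` two_cliques A B C = two_cliques (\<phi> ` A) (\<phi> ` B) (\<phi> ` C)"
proof -
  have d: "\<phi> ` ((X \<union> C) - {x}) = (\<phi> ` X \<union> \<phi> ` C) - {\<phi> x}" if "X = A \<or> X = B" "x \<in> X" for X x
  proof -
    have "inj_on \<phi> (X \<union> C)" using inj that by (auto simp: inj_on_def)
    then have "\<phi> ` ((X \<union> C) - {x}) = \<phi> ` (X \<union> C) - \<phi> ` {x}"
      using that by (intro inj_on_image_set_diff[of _ "X \<union> C"]) auto
    then show ?thesis by (simp add: image_Un)
  qed
  have "(\<lambda>e. \<phi> ` e) ` (\<Union>x\<in>X. \<Union>y\<in>(X \<union> C) - {x}. {{x, y}}) =
      (\<Union>x\<in>\<phi> ` X. \<Union>y\<in>(\<phi> ` X \<union> \<phi> ` C) - {x}. {{x, y}})" if X: "X = A \<or> X = B" for X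
  proof -
    have "(\<lambda>e. \<phi> ` e) ` (\<Union>x\<in>X. \<Union>y\<in>(X \<union> C) - {x}. {{x, y}}) = (\<Union>x\<in>X. \<Union>y\<in>\<phi> ` ((X \<union> C) - {x}). {{\<phi> x, y}})"
      by (simp add: image_UN)
    also have "\<dots> = (\<Union>x\<in>X. \<Union>y\<in>(\<phi> ` X \<union> \<phi> ` C) - {\<phi> x}. {{\<phi> x, y}})"
      by (intro SUP_cong refl) (simp only: d[OF X])
    finally show ?thesis by (simp only: image_image)
  qed
  then show ?thesis by (simp add: two_cliques_def image_Un)
qed

lemma image_pairs:
  assumes inj: "inj_on \<phi> X"
  shows "(\<lambda>e. \<phi> ` e) ` {d. d \<subseteq> X \<and> card d = 2} = {d. d \<subseteq> \<phi> ` X \<and> card d = 2}"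
proof (intro subset_antisym subsetI)
  fix d assume "d \<in> (\<lambda>e. \<phi> ` e) ` {d. d \<subseteq> X \<and> card d = 2}"
  then obtain e where "e \<subseteq> X" "card e = 2" "d = \<phi> ` e" by auto
  moreover from this have "card (\<phi> ` e) = card e" using inj by (meson card_image inj_on_subset)
  ultimately show "d \<in> {d. d \<subseteq> \<phi> ` X \<and> card d = 2}" by auto
next
  fix d assume d: "d \<in> {d. d \<subseteq> \<phi> ` X \<and> card d = 2}"
  then obtain e where e: "e \<subseteq> X" "d = \<phi> ` e" by (auto simp: subset_image_iff)
  then have "card d = card e" using inj by (meson card_image inj_on_subset)
  then show "d \<in> (\<lambda>e. \<phi> ` e) ` {d. d \<subseteq> X \<and> card d = 2}" using e d by auto
qed

lemma complete_graph_pairs: "edges (complete_graph n) = {d. d \<subseteq> {..<n} \<and> card d = 2}"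
proof (intro subset_antisym subsetI)
  fix d assume "d \<in> edges (complete_graph n)"
  then show "d \<in> {d. d \<subseteq> {..<n} \<and> card d = 2}" by (auto simp: complete_graph_def)
next
  fix d assume d: "d \<in> {d. d \<subseteq> {..<n} \<and> card d = 2}"
  then obtain x y where "d = {x, y}" "x \<noteq> y" unfolding card_2_iff by blast
  then show "d \<in> edges (complete_graph n)" using d by (auto simp: complete_graph_def)
qed

lemma isomorphic_complete_graph_4_iff:
  assumes H: "simple_graph (H :: 'b graph)"
  shows "isomorphic H (complete_graph 4) \<longleftrightarrow> verts H = \<Union>(edges H) \<and> projective_shape (edges H)"
proof -
  let ?K = "complete_graph 4"
  have V: "verts ?K = {..<4} \<union> {} \<union> {}" by (simp add: complete_graph_def)
  have "isomorphic H ?K \<longleftrightarrow> (\<exists>\<phi>. graph_iso \<phi> ?K H)"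
    using isomorphic_iff[OF H, of ?K] by (auto simp: complete_graph_pairs V)
  also have "\<dots> \<longleftrightarrow> verts H = \<Union>(edges H) \<and>
      block_edges (\<lambda>A B C. {d. d \<subseteq> A \<and> card d = 2}) (card {..<4 :: nat}) (card ({} :: nat set)) (card ({} :: nat set))
        (\<lambda>A B. True) (edges H)"
  proof (rule isomorphic_blocks_iff[OF V])
    fix A B C :: "'b set" assume c: "finite B" "finite C" "card A = card {..<4 :: nat}" "card B = card ({} :: nat set)" "card C = card ({} :: nat set)"
    have "\<Union>{d. d \<subseteq> A \<and> card d = 2} = A" by (rule Union_clique) (simp add: c)
    then show "\<Union>{d. d \<subseteq> A \<and> card d = 2} = A \<union> B \<union> C" using c by simp
  qed (simp_all add: disjoint3_def V complete_graph_pairs image_pairs)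
  finally show ?thesis by (simp add: projective_shape_def)
qed

lemma complete_multipartite_3:
  "verts (complete_multipartite [a, b, c]) = {0} \<times> {..<a} \<union> {1} \<times> {..<b} \<union> {2} \<times> {..<c}"
  "edges (complete_multipartite [a, b, c]) = tripartite ({0} \<times> {..<a}) ({1} \<times> {..<b}) ({2} \<times> {..<c})"
proof -
  have less_3: "i < 3 \<longleftrightarrow> i = 0 \<or> i = 1 \<or> i = 2" for i :: nat by auto
  have "(i, j) \<in> verts (complete_multipartite [a, b, c]) \<longleftrightarrow>
      i = 0 \<and> j < a \<or> i = 1 \<and> j < b \<or> i = 2 \<and> j < c" for i j
    by (cases "i = 0"; cases "i = 1"; cases "i = 2") (simp_all add: complete_multipartite_def less_3)
  then show V: "verts (complete_multipartite [a, b, c]) = {0} \<times> {..<a} \<union> {1} \<times> {..<b} \<union> {2} \<times> {..<c}"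
    by auto
  have "edges (complete_multipartite [a, b, c]) = {{x, y} | x y. x \<in> verts (complete_multipartite [a, b, c]) \<and>
      y \<in> verts (complete_multipartite [a, b, c]) \<and> fst x \<noteq> fst y}"
    by (simp add: complete_multipartite_def Let_def)
  also have "\<dots> = tripartite ({0} \<times> {..<a}) ({1} \<times> {..<b}) ({2} \<times> {..<c})"
  proof (intro subset_antisym subsetI)
    fix d assume "d \<in> {{x, y} | x y. x \<in> verts (complete_multipartite [a, b, c]) \<and>
      y \<in> verts (complete_multipartite [a, b, c]) \<and> fst x \<noteq> fst y}"
    then obtain x y where "d = {x, y}" "x \<in> verts (complete_multipartite [a, b, c])"
      "y \<in> verts (complete_multipartite [a, b, c])" "fst x \<noteq> fst y" by blast
    then show "d \<in> tripartite ({0} \<times> {..<a}) ({1} \<times> {..<b}) ({2} \<times> {..<c})"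
      unfolding V by (auto simp: doubleton_in_tripartite)
  next
    fix d assume "d \<in> tripartite ({0 :: nat} \<times> {..<a}) ({1} \<times> {..<b}) ({2} \<times> {..<c})"
    then obtain x y where xy: "d = {x, y}" "x \<in> {0} \<times> {..<a} \<and> y \<in> {1} \<times> {..<b} \<union> {2} \<times> {..<c} \<or>
        x \<in> {1} \<times> {..<b} \<and> y \<in> {2} \<times> {..<c}"
      unfolding tripartite_def by blast
    then have "x \<in> verts (complete_multipartite [a, b, c])" "y \<in> verts (complete_multipartite [a, b, c])" "fst x \<noteq> fst y"
      unfolding V by auto
    then show "d \<in> {{x, y} | x y. x \<in> verts (complete_multipartite [a, b, c]) \<and>
      y \<in> verts (complete_multipartite [a, b, c]) \<and> fst x \<noteq> fst y}"
      using xy(1) by blast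
  qed
  finally show "edges (complete_multipartite [a, b, c]) = tripartite ({0} \<times> {..<a}) ({1} \<times> {..<b}) ({2} \<times> {..<c})" .
qed

lemma complete_multipartite_2:
  "verts (complete_multipartite [a, b]) = {0} \<times> {..<a} \<union> {1} \<times> {..<b} \<union> {}"
  "edges (complete_multipartite [a, b]) = tripartite ({0} \<times> {..<a}) ({1} \<times> {..<b}) {}"
proof -
  have less_2_3: "i < 2 \<longleftrightarrow> i = 0 \<or> i = 1" "i < 3 \<longleftrightarrow> i = 0 \<or> i = 1 \<or> i = 2" for i :: nat by auto
  have "(i, j) \<in> verts (complete_multipartite [a, b]) \<longleftrightarrow> (i, j) \<in> verts (complete_multipartite [a, b, 0])" for i j
    by (cases "i = 0"; cases "i = 1"; cases "i = 2") (simp_all add: complete_multipartite_def less_2_3)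
  then have V: "verts (complete_multipartite [a, b]) = verts (complete_multipartite [a, b, 0])" by auto
  then show "verts (complete_multipartite [a, b]) = {0} \<times> {..<a} \<union> {1} \<times> {..<b} \<union> {}"
    by (simp add: complete_multipartite_3)
  have "edges (complete_multipartite [a, b]) = edges (complete_multipartite [a, b, 0])"
    using V by (simp add: complete_multipartite_def Let_def)
  then show "edges (complete_multipartite [a, b]) = tripartite ({0} \<times> {..<a}) ({1} \<times> {..<b}) {}"
    by (simp add: complete_multipartite_3)
qed

lemma complete_multipartite_edges_subset:
  "e \<in> edges (complete_multipartite ns) \<Longrightarrow> e \<subseteq> verts (complete_multipartite ns)"
  by (auto simp: complete_multipartite_def Let_def)

lemma isomorphic_K222_iff:
  assumes H: "simple_graph (H :: 'b graph)"
  shows "isomorphic H (complete_multipartite [2, 2, 2]) \<longleftrightarrow>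
    verts H = \<Union>(edges H) \<and> block_edges tripartite 2 2 2 (\<lambda>A B. True) (edges H)"
proof -
  let ?K = "complete_multipartite [2, 2, 2]"
  let ?A = "{0 :: nat} \<times> {..<2 :: nat}" and ?B = "{1 :: nat} \<times> {..<2 :: nat}" and ?C = "{2 :: nat} \<times> {..<2 :: nat}"
  have "isomorphic H ?K \<longleftrightarrow> (\<exists>\<phi>. graph_iso \<phi> ?K H)"
    by (rule isomorphic_iff[OF H complete_multipartite_edges_subset])
  also have "\<dots> \<longleftrightarrow> verts H = \<Union>(edges H) \<and> block_edges tripartite (card ?A) (card ?B) (card ?C) (\<lambda>A B. True) (edges H)"
  proof (rule isomorphic_blocks_iff[OF complete_multipartite_3(1)])
    fix A B C :: "'b set" assume "card A = card ?A" "card B = card ?B"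
    then show "\<Union>(tripartite A B C) = A \<union> B \<union> C" by (intro Union_tripartite) auto
  qed (auto simp: disjoint3_def complete_multipartite_3 image_tripartite)
  finally show ?thesis by simp
qed

lemma nonadjacent_K2n_iff:
  assumes n: "n \<noteq> 0"
  shows "nonadjacent_K2n D n H \<longleftrightarrow> verts H = \<Union>(edges H) \<and> nonadjacent_shape D n (edges H)"
proof -
  let ?K = "complete_multipartite [2, n]"
  let ?A = "{0 :: nat} \<times> {..<2 :: nat}" and ?B = "{1 :: nat} \<times> {..<n}" and ?C = "{} :: (nat \<times> nat) set"
  let ?Q = "\<lambda>A B. A \<notin> edges D \<and> (n = 2 \<longrightarrow> B \<notin> edges D)"
  have two: "{..<2} = {0, 1 :: nat}" by auto
  have A: "\<phi> ` ?A = {\<phi> (0, 0), \<phi> (0, 1)}" for \<phi> :: "nat \<times> nat \<Rightarrow> 'a" unfolding two by auto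
  have B: "\<phi> ` ?B = {\<phi> (1, 0), \<phi> (1, 1)}" if "n = 2" for \<phi> :: "nat \<times> nat \<Rightarrow> 'a" unfolding that two by auto
  have "(\<forall>i<2. [2, n] ! i = 2 \<longrightarrow> {\<phi> (i, 0), \<phi> (i, 1)} \<notin> edges D) \<longleftrightarrow> ?Q (\<phi> ` ?A) (\<phi> ` ?B)" for \<phi>
    using B[of \<phi>] by (auto simp: A less_2_cases_iff)
  then have "nonadjacent_K2n D n H \<longleftrightarrow> (\<exists>\<phi>. graph_iso \<phi> ?K H \<and> ?Q (\<phi> ` ?A) (\<phi> ` ?B))"
    by (simp add: nonadjacent_K2n_def)
  also have "\<dots> \<longleftrightarrow> verts H = \<Union>(edges H) \<and> block_edges tripartite (card ?A) (card ?B) (card ?C) ?Q (edges H)"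
  proof (rule graph_iso_blocks_iff[OF complete_multipartite_2(1), where Q = ?Q])
    fix A B C :: "'a set" assume "card A = card ?A" "card B = card ?B"
    then show "\<Union>(tripartite A B C) = A \<union> B \<union> C" using n by (intro Union_tripartite) auto
  qed (auto simp: disjoint3_def complete_multipartite_2 image_tripartite)
  finally show ?thesis by (simp add: nonadjacent_shape_def)
qed

lemma isomorphic_two_cliques_iff:
  assumes H: "simple_graph (H :: 'b graph)" and V: "verts K = A0 \<union> B0 \<union> C0" and E: "edges K = two_cliques A0 B0 C0"
    and disj: "disjoint3 A0 B0 C0" and fin: "finite (verts K)" and cards: "card A0 = a" "card B0 = a" "card C0 = c" "2 \<le> a"
  shows "isomorphic H K \<longleftrightarrow> verts H = \<Union>(edges H) \<and> block_edges two_cliques a a c (\<lambda>A B. True) (edges H)"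
proof -
  have "isomorphic H K \<longleftrightarrow> (\<exists>\<phi>. graph_iso \<phi> K H)"
    using isomorphic_iff[OF H, of K] unfolding V E by (auto simp: two_cliques_def)
  also have "\<dots> \<longleftrightarrow> verts H = \<Union>(edges H) \<and>
      block_edges two_cliques (card A0) (card B0) (card C0) (\<lambda>A B. True) (edges H)"
    by (rule isomorphic_blocks_iff[OF V disj fin]) (simp_all add: E V image_two_cliques Union_two_cliques cards)
  finally show ?thesis by (simp add: cards)
qed

text \<open>
  These equations list every edge of a concrete graph once.
\<close>

lemma two_cliques_insert_left:
  assumes "a \<notin> A" "a \<notin> C"
  shows "two_cliques (insert a A) B C = (\<lambda>y. {a, y}) ` (A \<union> C) \<union> two_cliques A B C"
  using assms unfolding two_cliques_def by (auto simp: insert_commute)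

lemma two_cliques_insert_right:
  assumes "b \<notin> B" "b \<notin> C"
  shows "two_cliques {} (insert b B) C = (\<lambda>y. {b, y}) ` (B \<union> C) \<union> two_cliques {} B C"
  using assms unfolding two_cliques_def by (auto simp: insert_commute)

lemma two_cliques_empty: "two_cliques {} {} C = {}"
  by (simp add: two_cliques_def)

lemmas two_cliques_enum = two_cliques_insert_left two_cliques_insert_right two_cliques_empty

lemma graph_A3_blocks:
  "verts graph_A3 = {0, 1, 2, 3} \<union> {4, 5, 6, 7} \<union> {}" "edges graph_A3 = two_cliques {0, 1, 2, 3} {4, 5, 6, 7} {}"
proof -
  show "edges graph_A3 = two_cliques {0, 1, 2, 3} {4, 5, 6, 7} {}"
    by (simp add: graph_A3_def two_cliques_enum) (simp only: insert_commute[where 'a = "nat set"])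
qed (auto simp: graph_A3_def)

lemma graph_A5_blocks:
  "verts graph_A5 = {0, 1, 2} \<union> {4, 5, 6} \<union> {3}" "edges graph_A5 = two_cliques {0, 1, 2} {4, 5, 6} {3}"
proof -
  show "edges graph_A5 = two_cliques {0, 1, 2} {4, 5, 6} {3}"
    by (simp add: graph_A5_def two_cliques_enum insert_commute[of 4 3 "{} :: nat set"]
        insert_commute[of 5 3 "{} :: nat set"] insert_commute[of 6 3 "{} :: nat set"])
      (simp only: insert_commute[where 'a = "nat set"])
qed (auto simp: graph_A5_def)

lemma graph_A6_blocks:
  "verts graph_A6 = {0, 1} \<union> {4, 5} \<union> {2, 3}" "edges graph_A6 = two_cliques {0, 1} {4, 5} {2, 3}"
proof -
  show "edges graph_A6 = two_cliques {0, 1} {4, 5} {2, 3}"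
    by (simp add: graph_A6_def two_cliques_enum insert_commute[of 4 2 "{} :: nat set"]
        insert_commute[of 4 3 "{} :: nat set"] insert_commute[of 5 2 "{} :: nat set"]
        insert_commute[of 5 3 "{} :: nat set"])
      (simp only: insert_commute[where 'a = "nat set"])
qed (auto simp: graph_A6_def)

lemma isomorphic_A_iff:
  assumes H: "simple_graph (H :: 'b graph)"
  shows "isomorphic H graph_A3 \<longleftrightarrow> verts H = \<Union>(edges H) \<and> block_edges two_cliques 4 4 0 (\<lambda>A B. True) (edges H)"
    "isomorphic H graph_A5 \<longleftrightarrow> verts H = \<Union>(edges H) \<and> block_edges two_cliques 3 3 1 (\<lambda>A B. True) (edges H)"
    "isomorphic H graph_A6 \<longleftrightarrow> verts H = \<Union>(edges H) \<and> block_edges two_cliques 2 2 2 (\<lambda>A B. True) (edges H)"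
  by (rule isomorphic_two_cliques_iff[OF H graph_A3_blocks], simp_all add: disjoint3_def graph_A3_blocks(1))
    (rule isomorphic_two_cliques_iff[OF H graph_A5_blocks], simp_all add: disjoint3_def graph_A5_blocks(1),
     rule isomorphic_two_cliques_iff[OF H graph_A6_blocks], simp_all add: disjoint3_def graph_A6_blocks(1))

lemma torus_graph_iff:
  assumes H: "simple_graph H"
  shows "isomorphic H (complete_multipartite [2, 2, 2]) \<or> (\<exists>m\<ge>1. nonadjacent_K2n D (2 * m) H) \<longleftrightarrow>
    verts H = \<Union>(edges H) \<and> torus_shape D (edges H)"
proof -
  have "nonadjacent_K2n D (2 * m) H \<longleftrightarrow> verts H = \<Union>(edges H) \<and> nonadjacent_shape D (2 * m) (edges H)" if "m \<ge> 1" for m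
    by (rule nonadjacent_K2n_iff) (use that in simp)
  then show ?thesis unfolding isomorphic_K222_iff[OF H] torus_shape_def by blast
qed

lemma klein_graph_iff:
  assumes H: "simple_graph H"
  shows "isomorphic H graph_A3 \<or> isomorphic H graph_A5 \<or> isomorphic H graph_A6 \<or>
      (\<exists>m\<ge>2. nonadjacent_K2n D (2 * m - 1) H) \<longleftrightarrow>
    verts H = \<Union>(edges H) \<and> klein_shape D (edges H)"
proof -
  have "nonadjacent_K2n D (2 * m - 1) H \<longleftrightarrow> verts H = \<Union>(edges H) \<and> nonadjacent_shape D (2 * m - 1) (edges H)"
    if "m \<ge> 2" for m
    by (rule nonadjacent_K2n_iff) (use that in simp)
  then show ?thesis unfolding isomorphic_A_iff[OF H] klein_shape_def by blast
qed

section \<open>The correspondence\<close>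

context cubic_3connected
begin

lemma equivalent_invariants:
  assumes S: "embedding_scheme G S" and eq: "equivalent G S S'"
  shows "embedding_on G X S' \<longleftrightarrow> embedding_on G X S" "strong G S' \<longleftrightarrow> strong G S"
proof -
  have S': "embedding_scheme G S'" by (rule embedding_scheme_equivalent[OF S eq])
  interpret S: cubic_scheme G S by unfold_locales (rule S)
  interpret S': cubic_scheme G S' by unfold_locales (rule S')
  obtain X where X: "X \<subseteq> verts G" "S' = flip G X S" using eq equivalent_iff_flip[OF S] by auto
  have bs: "boundary_space G S' = boundary_space G S" unfolding X(2) by (rule boundary_space_flip[OF S X(1)])
  then show "strong G S' \<longleftrightarrow> strong G S"
    by (simp add: S.strong_iff_boundary_space S'.strong_iff_boundary_space)
  have "(2 :: nat) ^ card (faces G S') = 2 ^ card (faces G S)"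
    using S.card_boundary_space S'.card_boundary_space bs by simp
  then have "card (faces G S') = card (faces G S)" by simp
  then have "euler_char G S' = euler_char G S" by (simp add: euler_char_def)
  moreover have "orientable G S' \<longleftrightarrow> orientable G S"
    using equivalent_trans[OF eq] equivalent_trans[OF equivalent_sym[OF S eq]] unfolding orientable_def by blast
  ultimately show "embedding_on G X S' \<longleftrightarrow> embedding_on G X S" for X
    using S S' by (simp add: embedding_on_def)
qed

end

context plane_cubic
begin

text \<open>
  Classes of embeddings correspond to sets of edges of \<open>G\<close>, and these to edge sets of \<open>D\<close>. An edge set
  determines a subgraph because none of the subgraphs in question has isolated vertices.
\<close>

lemma bij_betw_classes:
  assumes shape: "\<And>T. T \<subseteq> edges G \<Longrightarrow>
      embedding_on G X (twist T P) \<and> strong G (twist T P) \<longleftrightarrow> R (sides ` T)"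
    and Q: "\<And>H. simple_graph H \<Longrightarrow> Q H \<longleftrightarrow> verts H = \<Union>(edges H) \<and> R (edges H)"
  shows "\<exists>f. bij_betw f (inequivalent_strong_embeddings G X) {H. subgraph H D \<and> Q H}"
proof -
  define TT where "TT = {T. T \<subseteq> edges G \<and> R (sides ` T)}"
  define cls where "cls S = {(S, S'). equivalent G S S'} `` {S}" for S
  define dual where "dual T = \<lparr>verts = \<Union>(sides ` T), edges = sides ` T\<rparr>" for T
  have emb_T: "embedding_scheme G (twist T P)" if "T \<subseteq> edges G" for T
    by (rule embedding_scheme_twist[OF emb that])
  have cls_iff: "S' \<in> cls S \<longleftrightarrow> equivalent G S S'" for S S' by (simp add: cls_def)
  have classes: "cls ` (\<lambda>T. twist T P) ` TT = inequivalent_strong_embeddings G X"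
  proof (intro subset_antisym subsetI)
    fix c assume "c \<in> cls ` (\<lambda>T. twist T P) ` TT"
    then obtain T where "T \<in> TT" "c = cls (twist T P)" by auto
    then show "c \<in> inequivalent_strong_embeddings G X"
      using shape[of T] quotientI[of "twist T P" "{S. embedding_on G X S \<and> strong G S}" "{(S, S'). equivalent G S S'}"]
      by (simp add: inequivalent_strong_embeddings_def TT_def cls_def)
  next
    fix c assume "c \<in> inequivalent_strong_embeddings G X"
    then obtain S where S: "embedding_on G X S" "strong G S" "c = cls S"
      unfolding inequivalent_strong_embeddings_def cls_def by (auto elim: quotientE)
    then have Sem: "embedding_scheme G S" by (simp add: embedding_on_def)
    obtain T where T: "T \<subseteq> edges G" "equivalent G (twist T P) S" using exists_flip_twist[OF emb Sem] by auto
    note inv = equivalent_invariants[OF emb_T[OF T(1)] T(2)]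
    have "T \<in> TT" using S inv shape[OF T(1)] T(1) by (simp add: TT_def)
    moreover have "cls S = cls (twist T P)"
      using T(2) equivalent_sym[OF emb_T[OF T(1)] T(2)] equivalent_trans unfolding set_eq_iff cls_iff by blast
    ultimately show "c \<in> cls ` (\<lambda>T. twist T P) ` TT" using S(3) by blast
  qed
  have "inj_on (cls \<circ> (\<lambda>T. twist T P)) TT"
  proof (rule inj_onI)
    fix T T' assume T: "T \<in> TT" "T' \<in> TT" "(cls \<circ> (\<lambda>T. twist T P)) T = (cls \<circ> (\<lambda>T. twist T P)) T'"
    have "twist T' P \<in> cls (twist T' P)" by (simp add: cls_iff equivalent_refl)
    then have "twist T' P \<in> cls (twist T P)" using T(3) by simp
    then have "equivalent G (twist T P) (twist T' P)" by (simp only: cls_iff)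
    then show "T = T'" using twist_equivalent_unique[OF emb] T by (simp add: TT_def)
  qed
  then have bij1: "bij_betw (cls \<circ> (\<lambda>T. twist T P)) TT (inequivalent_strong_embeddings G X)"
    using classes by (simp add: bij_betw_def image_comp)
  have simple_sub: "simple_graph H" if "subgraph H D" for H using that by (simp add: subgraph_def)
  have "bij_betw dual TT {H. subgraph H D \<and> Q H}"
  proof (rule bij_betw_imageI)
    show "inj_on dual TT"
      using inj_on_sides unfolding inj_on_def dual_def TT_def by (auto simp: inj_on_image_eq_iff[OF inj_on_sides])
    show "dual ` TT = {H. subgraph H D \<and> Q H}"
    proof (intro subset_antisym subsetI)
      fix H assume "H \<in> dual ` TT"
      then obtain T where T: "T \<subseteq> edges G" "R (sides ` T)" "H = dual T" by (auto simp: TT_def)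
      have "finite (\<Union>(sides ` T))" using Union_sides_subset finite_faces finite_subset by metis
      then have sub: "subgraph H D"
        using T card_sides Union_sides_subset[of T] by (auto simp: subgraph_def simple_graph_def dual_def verts_dual edges_dual)
      moreover have "Q H" unfolding Q[OF simple_sub[OF sub]] using T by (simp add: dual_def)
      ultimately show "H \<in> {H. subgraph H D \<and> Q H}" by simp
    next
      fix H assume "H \<in> {H. subgraph H D \<and> Q H}"
      then have H: "subgraph H D" "verts H = \<Union>(edges H)" "R (edges H)" using Q simple_sub by auto
      then have "edges H \<subseteq> sides ` edges G" by (simp add: subgraph_def edges_dual)
      then obtain T where T: "T \<subseteq> edges G" "edges H = sides ` T" by (rule subset_imageE)
      then have "H = dual T" using H(2) by (simp add: dual_def)
      moreover have "T \<in> TT" using T H(3) by (simp add: TT_def)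
      ultimately show "H \<in> dual ` TT" by simp
    qed
  qed
  then have "bij_betw (dual \<circ> inv_into TT (cls \<circ> (\<lambda>T. twist T P))) (inequivalent_strong_embeddings G X) {H. subgraph H D \<and> Q H}"
    using bij_betw_inv_into[OF bij1] by (rule bij_betw_trans[rotated])
  then show ?thesis by blast
qed

end

theorem theorem1:
  fixes G :: "'a graph" and P :: "'a scheme"
  assumes "simple_graph G" and "k_connected 3 G" and "cubic G"
    and planar: "embedding_on G Sphere P"
  defines "D \<equiv> dual_graph G P"
  shows
    "(\<exists>f. bij_betw f (inequivalent_strong_embeddings G Projective_Plane)
        {H. subgraph H D \<and> isomorphic H (complete_graph 4)}) \<and>
     (\<exists>f. bij_betw f (inequivalent_strong_embeddings G Torus)
        {H. subgraph H D \<and>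
           (isomorphic H (complete_multipartite [2, 2, 2]) \<or>
            (\<exists>m\<ge>1. nonadjacent_K2n D (2 * m) H))}) \<and>
     (\<exists>f. bij_betw f (inequivalent_strong_embeddings G Klein_Bottle)
        {H. subgraph H D \<and>
           (isomorphic H graph_A3 \<or> isomorphic H graph_A5 \<or> isomorphic H graph_A6 \<or>
            (\<exists>m\<ge>2. nonadjacent_K2n D (2 * m - 1) H))})"
proof -
  interpret plane_cubic G P by unfold_locales (fact assms)+
  show ?thesis
    unfolding D_def
  proof (intro conjI)
    show "\<exists>f. bij_betw f (inequivalent_strong_embeddings G Projective_Plane)
        {H. subgraph H (dual_graph G P) \<and> isomorphic H (complete_graph 4)}"
      by (rule bij_betw_classes[OF projective_plane_iff isomorphic_complete_graph_4_iff])
    show "\<exists>f. bij_betw f (inequivalent_strong_embeddings G Torus)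
        {H. subgraph H (dual_graph G P) \<and>
           (isomorphic H (complete_multipartite [2, 2, 2]) \<or>
            (\<exists>m\<ge>1. nonadjacent_K2n (dual_graph G P) (2 * m) H))}"
      by (rule bij_betw_classes[OF torus_iff torus_graph_iff])
    show "\<exists>f. bij_betw f (inequivalent_strong_embeddings G Klein_Bottle)
        {H. subgraph H (dual_graph G P) \<and>
           (isomorphic H graph_A3 \<or> isomorphic H graph_A5 \<or> isomorphic H graph_A6 \<or>
            (\<exists>m\<ge>2. nonadjacent_K2n (dual_graph G P) (2 * m - 1) H))}"
      by (rule bij_betw_classes[OF klein_iff klein_graph_iff])
  qed
qed

end
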